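(* Let $d,g$ be derivations of a complex unital semisimple Banach algebra $B$. Suppose that $\sigma(d(x))$ is finite for every $x\in B$. If $\sigma(g(x))\subseteq\sigma(d(x))$ for every $x\in B$, then there exist derivations $d_0,d_1,d_2$ of $B$ such that $d=d_0+d_1+d_2$, $g=d_1-d_2$, and $d_i(B)\,B\,d_j(B)=0$ for all $i,j\in\{0,1,2\}$ with $i\neq j$ (that is, $d_i(x)\,y\,d_j(z)=0$ for all $x,y,z\in B$).
   Context: All Banach algebras are complex and have an identity element. $\sigma(x)$ denotes the spectrum of $x$ in $B$. A derivation of $B$ is a linear map $d:B\to B$ with $d(xy)=d(x)y+xd(y)$ for all $x,y\in B$ (continuity is not assumed). Semisimple means that the Jacobson radical is zero. *)

theory Defs
  imports "HOL-Analysis.Analysis"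
begin

text \<open>
  Complex Banach algebras with identity \<open>1 \<noteq> 0\<close>. The library has only real normed algebras,
  so the complex scalar multiplication is added to these, extending the real one. The norm of the
  identity is not required to be 1 (hence not \<^class>\<open>real_normed_algebra_1\<close>).
\<close>

class complex_banach_algebra_1 = real_normed_algebra + real_algebra_1 + banach +
  fixes scaleC :: "complex \<Rightarrow> 'a \<Rightarrow> 'a"  (infixr "*\<^sub>C" 75)
  assumes scaleC_add_right: "c *\<^sub>C (x + y) = c *\<^sub>C x + c *\<^sub>C y"
    and scaleC_add_left: "(b + c) *\<^sub>C x = b *\<^sub>C x + c *\<^sub>C x"
    and scaleC_scaleC: "b *\<^sub>C (c *\<^sub>C x) = (b * c) *\<^sub>C x"
    and scaleC_one: "1 *\<^sub>C x = x"
    and scaleC_of_real: "complex_of_real r *\<^sub>C x = r *\<^sub>R x"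
    and mult_scaleC_left: "(c *\<^sub>C x) * y = c *\<^sub>C (x * y)"
    and mult_scaleC_right: "x * (c *\<^sub>C y) = c *\<^sub>C (x * y)"
    and norm_scaleC: "norm (c *\<^sub>C x) = cmod c * norm x"

definition spectrum :: "'a::complex_banach_algebra_1 \<Rightarrow> complex set" where
  "spectrum x = {c. \<not> (\<exists>y. (x - c *\<^sub>C 1) * y = 1 \<and> y * (x - c *\<^sub>C 1) = 1)}"

definition derivation :: "('a::complex_banach_algebra_1 \<Rightarrow> 'a) \<Rightarrow> bool" where
  "derivation d \<longleftrightarrow>
     Vector_Spaces.linear (*\<^sub>C) (*\<^sub>C) d \<and> (\<forall>x y. d (x * y) = d x * y + x * d y)"

text \<open>
  Left ideals are taken in the ring-theoretic sense; because of the identity they are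
  automatically complex subspaces.
\<close>

definition left_ideal :: "'a::ring_1 set \<Rightarrow> bool" where
  "left_ideal L \<longleftrightarrow>
     0 \<in> L \<and> (\<forall>x\<in>L. \<forall>y\<in>L. x + y \<in> L) \<and> (\<forall>a. \<forall>x\<in>L. a * x \<in> L)"

definition maximal_left_ideal :: "'a::ring_1 set \<Rightarrow> bool" where
  "maximal_left_ideal L \<longleftrightarrow>
     left_ideal L \<and> L \<noteq> UNIV \<and> (\<forall>J. left_ideal J \<longrightarrow> L \<subseteq> J \<longrightarrow> J = L \<or> J = UNIV)"

definition jacobson_radical :: "'a::ring_1 set" where
  "jacobson_radical = \<Inter> {L. maximal_left_ideal L}"

definition semisimple :: "'a::ring_1 itself \<Rightarrow> bool" where
  "semisimple _ \<longleftrightarrow> jacobson_radical = ({0} :: 'a set)"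

end

theory Submission
  imports Defs "HOL-Computational_Algebra.Fundamental_Theorem_Algebra"
begin

text \<open>
  If \<open>w z = 0\<close>, then every element of \<open>d(w) z B\<close> has finite spectrum, and a nonzero right ideal of
  elements with finite spectrum contains a minimal idempotent. Let \<open>A\<close> be the annihilator of the socle;
  it contains no minimal idempotent, so \<open>d\<close> kills the idempotents of \<open>A\<close>. Hence the spectral
  idempotents of \<open>d(x)\<close>, \<open>x \<in> A\<close>, are central, which on a simple module is incompatible with a
  nonzero derivation; thus \<open>d(A) = 0\<close>. On a minimal left ideal \<open>B f\<close> the derivation is implemented by
  \<open>v \<mapsto> d(v) f\<close>. If this map were not a scalar modulo finite rank, a convergent series of rank one
  elements \<open>v u\<close> would produce a \<open>d(x)\<close> with infinitely many eigenvalues. Therefore \<open>d(B)\<close> lies in the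
  socle. Finally, for \<open>u v = 0\<close> the nonzero spectrum of \<open>d(v u)\<close> is \<open>{c, -c}\<close>, where
  \<open>u d(v) f = c f\<close>; so the spectral inclusion forces \<open>g \<in> {0, d, -d}\<close> on each minimal ideal, and
  \<open>d\<^sub>0, d\<^sub>1, d\<^sub>2\<close> are the components of \<open>d\<close> in the corresponding parts of the socle.
\<close>

section \<open>Inverses and spectra\<close>

text \<open>Continuity of \<open>d\<close> is not assumed, and this shapes the use of series: where
  \<open>x\<close> is an infinite sum of rank one elements, \<open>d x\<close> is not expanded
  termwise. Instead \<open>x * v = 0\<close> is arranged for a test vector \<open>v\<close>, so that
  \<open>d x * v = - x * d v\<close> and only a multiplication is applied to the series.

  Killing the idempotents of \<open>A\<close> is a strong condition because
  \<open>e + e x (1 - e)\<close> is again an idempotent: the identity \<open>d e = 0\<close> spreads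
  to both off-diagonal corners. Centrality then acts through eigenvalues. A central idempotent is 0
  or 1 on a simple module, so there \<open>d x\<close> cannot have a nonzero eigenvalue together
  with a different one, whereas left multiples of \<open>x\<close> would manufacture the pairs 1, 0
  and 1, -1.

  For a single pair \<open>u, v\<close> the spectral inclusion gives a sign that may depend on the
  pair. The pairs violating a given sign form a generic set as soon as there is one, and this makes
  the sign uniform on a minimal ideal.\<close>

interpretation cvs: vector_space "scaleC :: complex \<Rightarrow> 'a \<Rightarrow> 'a::complex_banach_algebra_1"
  by unfold_locales (simp_all add: scaleC_add_right scaleC_add_left scaleC_scaleC scaleC_one)

lemmas scaleC_mult_simps = mult_scaleC_left mult_scaleC_right scaleC_scaleC scaleC_one

lemma power_scaleC: "(c *\<^sub>C (x::'a::complex_banach_algebra_1)) ^ n = c ^ n *\<^sub>C x ^ n"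
  by (induction n) (simp_all add: scaleC_mult_simps)

definition bi_invertible :: "'a::ring_1 \<Rightarrow> bool" where
  "bi_invertible x \<longleftrightarrow> (\<exists>y. x * y = 1 \<and> y * x = 1)"

lemma bi_invertibleI: "bi_invertible x" if "l * x = 1" "x * r = 1"
proof -
  have "l = r" using that by (metis mult.assoc mult_1_left mult_1_right)
  then show ?thesis using that by (auto simp: bi_invertible_def)
qed

lemma inverse_commutes:
  fixes x y a :: "'a::ring_1"
  assumes "x * y = 1" "y * x = 1" "a * x = x * a"
  shows "a * y = y * a"
proof -
  have "a * y = y * (x * a) * y" using assms by (simp flip: mult.assoc)
  also have "\<dots> = y * a * (x * y)" using assms by (simp add: mult.assoc flip: assms(3))
  finally show ?thesis using assms by simp
qed

lemma spectrum_iff: "c \<in> spectrum x \<longleftrightarrow> \<not> bi_invertible (x - c *\<^sub>C 1)"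
  by (simp add: spectrum_def bi_invertible_def)

lemma bi_invertible_scaleC_iff:
  fixes x :: "'a::complex_banach_algebra_1"
  assumes "c \<noteq> 0"
  shows "bi_invertible (c *\<^sub>C x) \<longleftrightarrow> bi_invertible x"
proof -
  have *: "bi_invertible (c *\<^sub>C x)" if "bi_invertible x" "c \<noteq> 0" for c and x :: 'a
  proof -
    from that obtain y where "x * y = 1" "y * x = 1" by (auto simp: bi_invertible_def)
    then show ?thesis using that
      by (intro bi_invertibleI[where l = "inverse c *\<^sub>C y" and r = "inverse c *\<^sub>C y"])
        (simp_all add: scaleC_mult_simps)
  qed
  from *[of x c] *[of "c *\<^sub>C x" "inverse c"] assms show ?thesis
    by (auto simp: scaleC_mult_simps)
qed

lemma one_minus_scaleC_bi_invertible_iff: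
  fixes x :: "'a::complex_banach_algebra_1"
  assumes "c \<noteq> 0"
  shows "bi_invertible (1 - c *\<^sub>C x) \<longleftrightarrow> inverse c \<notin> spectrum x"
proof -
  have "1 - c *\<^sub>C x = (- c) *\<^sub>C (x - inverse c *\<^sub>C 1)"
    using assms by (simp add: cvs.scale_right_diff_distrib scaleC_mult_simps)
  then show ?thesis using bi_invertible_scaleC_iff[of "- c"] assms by (simp add: spectrum_iff)
qed

lemma eigenvalue_in_spectrum:
  fixes x m :: "'a::complex_banach_algebra_1"
  assumes "x * m = c *\<^sub>C m" "m \<noteq> 0"
  shows "c \<in> spectrum x"
proof (rule ccontr)
  assume "c \<notin> spectrum x"
  then obtain y where "y * (x - c *\<^sub>C 1) = 1" by (auto simp: spectrum_def)
  then have "m = y * ((x - c *\<^sub>C 1) * m)" by (simp flip: mult.assoc)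
  also have "\<dots> = 0" using assms by (simp add: left_diff_distrib mult_scaleC_left)
  finally show False using assms by simp
qed

lemma norm_power_le:
  fixes x :: "'a::complex_banach_algebra_1"
  shows "norm (x ^ n) \<le> norm (1::'a) * norm x ^ n"
proof (induction n)
  case (Suc n)
  have "norm (x ^ Suc n) \<le> norm x * norm (x ^ n)" by (simp add: norm_mult_ineq)
  also have "\<dots> \<le> norm x * (norm (1::'a) * norm x ^ n)"
    by (intro mult_left_mono Suc) simp
  finally show ?case by (simp add: ac_simps)
qed simp

lemma neumann_inverse:
  fixes x :: "'a::complex_banach_algebra_1"
  assumes "summable (\<lambda>n. norm (x ^ n))"
  shows "bi_invertible (1 - x)"
proof -
  have s: "summable (\<lambda>n. x ^ n)" using assms by (rule summable_norm_cancel)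
  define S where "S = (\<Sum>n. x ^ n)"
  have "S = 1 + (\<Sum>n. x ^ Suc n)" unfolding S_def using suminf_split_head[OF s] by simp
  moreover have "(\<Sum>n. x ^ Suc n) = x * S"
    unfolding S_def using suminf_mult[OF s, of x] by simp
  moreover have "(\<Sum>n. x ^ Suc n) = S * x"
    unfolding S_def using suminf_mult2[OF s, of x] by (simp add: power_commutes)
  ultimately have "S - x * S = 1" "S - S * x = 1" by (simp_all add: algebra_simps)
  then show ?thesis by (intro bi_invertibleI[of S _ S]) (simp_all add: algebra_simps)
qed

lemma bi_invertible_one_minus_of_norm_less:
  fixes x :: "'a::complex_banach_algebra_1"
  assumes "norm x < 1"
  shows "bi_invertible (1 - x)"
proof (rule neumann_inverse)
  have "summable (\<lambda>n. norm (1::'a) * norm x ^ n)"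
    using assms by (intro summable_mult summable_geometric) simp
  then show "summable (\<lambda>n. norm (x ^ n))"
    by (rule summable_comparison_test[rotated]) (auto intro: norm_power_le)
qed

section \<open>Quasinilpotent elements\<close>

text \<open>Spectral radius 0 as a growth condition: boundedness for every \<open>R\<close> means
  that the n-th roots of \<open>norm (x ^ n)\<close> tend to 0. In this form every power series in
  \<open>x\<close> with geometrically bounded coefficients converges absolutely.\<close>

definition quasinilpotent :: "'a::complex_banach_algebra_1 \<Rightarrow> bool" where
  "quasinilpotent x \<longleftrightarrow> (\<forall>R>0. \<exists>C. \<forall>n. R ^ n * norm (x ^ n) \<le> C)"

lemma quasinilpotent_summable:
  fixes x :: "'a::complex_banach_algebra_1"
  assumes "quasinilpotent x" "r > 0" "\<And>n. norm (c n) \<le> K * r ^ n"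
  shows "summable (\<lambda>n. norm (c n *\<^sub>R x ^ n))"
proof -
  obtain C where C: "\<And>n. (2 * r) ^ n * norm (x ^ n) \<le> C"
    using assms unfolding quasinilpotent_def by (meson mult_pos_pos zero_less_numeral)
  have "K \<ge> 0" using order_trans[OF norm_ge_zero assms(3)[of 0]] by simp
  have le: "norm (c n *\<^sub>R x ^ n) \<le> K * C * (1/2) ^ n" for n
  proof -
    have "norm (c n *\<^sub>R x ^ n) \<le> K * r ^ n * norm (x ^ n)"
      using assms(3)[of n] by (simp add: mult_right_mono)
    also have "\<dots> = K * ((2 * r) ^ n * norm (x ^ n)) * (1/2) ^ n"
      by (simp add: power_mult_distrib power_one_over)
    also have "\<dots> \<le> K * C * (1/2) ^ n"
      by (intro mult_right_mono mult_left_mono C \<open>K \<ge> 0\<close>) simp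
    finally show ?thesis .
  qed
  have "summable (\<lambda>n. K * C * (1/2::real) ^ n)"
    by (intro summable_mult summable_geometric) simp
  then show ?thesis
    by (rule summable_comparison_test'[where N = 0]) (use le in simp)
qed

lemma quasinilpotent_one_minus:
  fixes x :: "'a::complex_banach_algebra_1"
  assumes "quasinilpotent x"
  shows "bi_invertible (1 - x)"
  using quasinilpotent_summable[OF assms, of 1 "\<lambda>_. 1" 1] by (intro neumann_inverse) simp

lemma power_mult_commuting:
  fixes x y :: "'a::monoid_mult"
  assumes "x * y = y * x"
  shows "(x * y) ^ n = x ^ n * y ^ n"
proof (induction n)
  case (Suc n)
  have "y * x ^ n = x ^ n * y" using power_commuting_commutes[OF assms] by simp
  then have "x * x ^ n * (y * y ^ n) = x * (y * x ^ n) * y ^ n" by (simp add: mult.assoc)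
  then show ?case using Suc by (simp add: mult.assoc)
qed simp

lemma quasinilpotent_mult:
  fixes x y :: "'a::complex_banach_algebra_1"
  assumes "quasinilpotent x" "x * y = y * x"
  shows "quasinilpotent (x * y)"
  unfolding quasinilpotent_def
proof (intro allI impI)
  fix R :: real assume "R > 0"
  define N where "N = norm y + 1"
  have N: "N > 0" "norm y \<le> N" by (auto simp: N_def add_nonneg_pos)
  obtain C where C: "\<And>n. (R * N) ^ n * norm (x ^ n) \<le> C"
    using assms(1) \<open>R > 0\<close> N unfolding quasinilpotent_def by (meson mult_pos_pos)
  have "R ^ n * norm ((x * y) ^ n) \<le> C * norm (1::'a)" for n
  proof -
    have "norm ((x * y) ^ n) \<le> norm (x ^ n) * norm (y ^ n)"
      by (simp add: power_mult_commuting[OF assms(2)] norm_mult_ineq)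
    also have "\<dots> \<le> norm (x ^ n) * (norm (1::'a) * N ^ n)"
      using norm_power_le[of y n] power_mono[OF N(2), of n]
      by (intro mult_left_mono) (auto intro: order_trans mult_left_mono)
    finally have "R ^ n * norm ((x * y) ^ n) \<le> R ^ n * (norm (x ^ n) * (norm (1::'a) * N ^ n))"
      using \<open>R > 0\<close> by (simp add: mult_left_mono)
    also have "\<dots> = ((R * N) ^ n * norm (x ^ n)) * norm (1::'a)" by (simp add: power_mult_distrib)
    also have "\<dots> \<le> C * norm (1::'a)" by (intro mult_right_mono C) simp
    finally show ?thesis .
  qed
  then show "\<exists>C. \<forall>n. R ^ n * norm ((x * y) ^ n) \<le> C" by blast
qed

lemma quasinilpotent_scaleC:
  "quasinilpotent x \<Longrightarrow> quasinilpotent (c *\<^sub>C x)"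
  using quasinilpotent_mult[of x "c *\<^sub>C 1"] by (simp add: scaleC_mult_simps)

lemma quasinilpotent_plus_scalar:
  fixes x :: "'a::complex_banach_algebra_1"
  assumes "quasinilpotent x" "c \<noteq> 0"
  shows "bi_invertible (x + c *\<^sub>C 1)"
proof -
  have "x + c *\<^sub>C 1 = c *\<^sub>C (1 - (- inverse c) *\<^sub>C x)"
    using assms by (simp add: cvs.scale_right_diff_distrib scaleC_mult_simps cvs.scale_right_distrib)
  moreover have "bi_invertible (1 - (- inverse c) *\<^sub>C x)"
    by (intro quasinilpotent_one_minus quasinilpotent_scaleC assms)
  ultimately show ?thesis using bi_invertible_scaleC_iff assms by metis
qed

lemma quasinilpotent_power_small:
  assumes "quasinilpotent x" "K \<ge> 0"
  shows "(\<lambda>n. K ^ n * norm (x ^ n)) \<longlonglongrightarrow> 0"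
proof -
  have "summable (\<lambda>n. norm (((K + 1) ^ n) *\<^sub>R x ^ n))"
    using assms by (intro quasinilpotent_summable[of x "K + 1" _ 1]) auto
  then have *: "(\<lambda>n. (K + 1) ^ n * norm (x ^ n)) \<longlonglongrightarrow> 0"
    using assms by (auto dest!: summable_LIMSEQ_zero)
  show ?thesis
    by (rule tendsto_sandwich[OF _ _ tendsto_const *])
      (use assms in \<open>auto intro!: always_eventually mult_right_mono power_mono\<close>)
qed

section \<open>Averaging the resolvent over roots of unity\<close>

lemma sum_roots_of_unity_power:
  fixes n j :: nat
  assumes "j < n"
  shows "(\<Sum>k<n. (exp (2 * of_real pi * \<i> * of_nat k / of_nat n)) ^ j) = (if j = 0 then of_nat n else 0)"
proof -
  define w where "w = exp (2 * of_real pi * \<i> * of_nat j / of_nat n)"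
  have eq: "(exp (2 * of_real pi * \<i> * of_nat k / of_nat n)) ^ j = w ^ k" for k
    unfolding w_def by (simp add: mult_ac flip: exp_of_nat_mult)
  show ?thesis
  proof (cases "j = 0")
    case False
    have "w \<noteq> 1" using complex_root_unity_eq_1[of n j] assms False
      by (auto simp: w_def dest: dvd_imp_le)
    moreover have "w ^ n = 1"
    proof -
      have "w ^ n = exp (2 * of_real pi * \<i> * of_nat j)"
        using assms by (simp add: w_def flip: exp_of_nat_mult)
      also have "\<dots> = exp (2 * of_real pi * \<i>) ^ j"
        by (simp add: mult_ac flip: exp_of_nat_mult)
      finally show ?thesis by (simp add: exp_two_pi_i)
    qed
    ultimately have "(\<Sum>k<n. w ^ k) = 0" by (simp add: geometric_sum)
    then show ?thesis using False by (simp add: eq)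
  qed simp
qed

lemma geometric_factor:
  fixes y :: "'a::ring_1"
  shows "(\<Sum>j<n. y ^ j) * (1 - y) = 1 - y ^ n" "(1 - y) * (\<Sum>j<n. y ^ j) = 1 - y ^ n"
proof -
  show "(\<Sum>j<n. y ^ j) * (1 - y) = 1 - y ^ n"
    by (induction n) (simp_all only: sum.lessThan_Suc distrib_right power_Suc2, simp_all add: algebra_simps)
  show "(1 - y) * (\<Sum>j<n. y ^ j) = 1 - y ^ n"
    by (induction n) (simp_all only: sum.lessThan_Suc distrib_left power_Suc, simp_all add: algebra_simps)
qed

text \<open>Since \<open>w k ^ n = 1\<close>, the factor \<open>1 - (z *\<^sub>C q) ^ n\<close>
  turns \<open>G (z * w k)\<close> into the sum of the first \<open>n\<close> powers of
  \<open>(z * w k) *\<^sub>C q\<close>. Averaging over \<open>k\<close> cancels every power except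
  the zeroth.\<close>

lemma resolvent_average:
  fixes q :: "'a::complex_banach_algebra_1" and G :: "complex \<Rightarrow> 'a" and z :: complex
  assumes G1: "\<And>z. (1 - z *\<^sub>C q) * G z = 1" and G2: "\<And>z. G z * (1 - z *\<^sub>C q) = 1"
  assumes n: "n > 0"
  defines "w \<equiv> \<lambda>k. exp (2 * of_real pi * \<i> * of_nat k / of_nat n)"
  defines "S \<equiv> inverse (of_nat n) *\<^sub>C (\<Sum>k<n. G (z * w k))"
  shows "(1 - (z *\<^sub>C q) ^ n) * S = 1" "S * (1 - (z *\<^sub>C q) ^ n) = 1"
proof -
  have wn: "w k ^ n = 1" for k
  proof -
    have "w k ^ n = exp (2 * of_real pi * \<i> * of_nat k)"
      using n by (simp add: w_def flip: exp_of_nat_mult)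
    also have "\<dots> = exp (2 * of_real pi * \<i>) ^ k"
      by (simp add: mult_ac flip: exp_of_nat_mult)
    finally show ?thesis by (simp add: exp_two_pi_i)
  qed
  have pw: "((z * w k) *\<^sub>C q) ^ n = (z *\<^sub>C q) ^ n" for k
    by (simp add: power_scaleC power_mult_distrib wn)
  have e1: "(1 - (z *\<^sub>C q) ^ n) * G (z * w k) = (\<Sum>j<n. ((z * w k) *\<^sub>C q) ^ j)" for k
    by (simp add: geometric_factor(1)[where n = n and y = "(z * w k) *\<^sub>C q", unfolded pw, symmetric] mult.assoc G1)
  have e2: "G (z * w k) * (1 - (z *\<^sub>C q) ^ n) = (\<Sum>j<n. ((z * w k) *\<^sub>C q) ^ j)" for k
    by (simp add: geometric_factor(2)[where n = n and y = "(z * w k) *\<^sub>C q", unfolded pw, symmetric] G2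
        flip: mult.assoc)
  have "(\<Sum>k<n. \<Sum>j<n. ((z * w k) *\<^sub>C q) ^ j) = (\<Sum>j<n. \<Sum>k<n. (w k ^ j) *\<^sub>C ((z *\<^sub>C q) ^ j))"
    by (subst sum.swap) (simp add: power_scaleC power_mult_distrib scaleC_scaleC mult.commute)
  also have "\<dots> = (\<Sum>j<n. (\<Sum>k<n. w k ^ j) *\<^sub>C ((z *\<^sub>C q) ^ j))"
    by (simp add: cvs.scale_sum_left)
  also have "\<dots> = (\<Sum>j<n. if j = 0 then of_nat n *\<^sub>C 1 else 0)"
    by (intro sum.cong) (auto simp: w_def sum_roots_of_unity_power)
  also have "\<dots> = of_nat n *\<^sub>C 1" using n by simp
  finally have tot: "(\<Sum>k<n. \<Sum>j<n. ((z * w k) *\<^sub>C q) ^ j) = of_nat n *\<^sub>C 1" .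
  show "(1 - (z *\<^sub>C q) ^ n) * S = 1"
    using n by (simp add: S_def mult_scaleC_right sum_distrib_left e1 tot scaleC_mult_simps)
  show "S * (1 - (z *\<^sub>C q) ^ n) = 1"
    using n by (simp add: S_def mult_scaleC_left sum_distrib_right e2 tot scaleC_mult_simps)
qed

text \<open>The resolvent identity bounds the increment by a multiple of \<open>norm (G z)\<close>,
  which is not yet known to be bounded near \<open>z'\<close>. Within distance
  \<open>1 / (2 * K)\<close> the increment is at most half of \<open>norm (G z)\<close>; hence
  \<open>norm (G z)\<close> is at most twice \<open>norm (G z')\<close>, and the estimate
  closes.\<close>

lemma resolvent_continuous:
  fixes q :: "'a::complex_banach_algebra_1" and G :: "complex \<Rightarrow> 'a"
  assumes G1: "\<And>z. (1 - z *\<^sub>C q) * G z = 1" and G2: "\<And>z. G z * (1 - z *\<^sub>C q) = 1"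
  shows "continuous_on A G"
proof -
  have "isCont G z'" for z'
  proof -
    have diff: "G z - G z' = (z - z') *\<^sub>C (G z * q * G z')" for z
    proof -
      have "(z - z') *\<^sub>C (G z * q * G z') = G z * ((1 - z' *\<^sub>C q) - (1 - z *\<^sub>C q)) * G z'"
        by (simp add: cvs.scale_left_diff_distrib algebra_simps scaleC_mult_simps)
      also have "\<dots> = G z * ((1 - z' *\<^sub>C q) * G z') - (G z * (1 - z *\<^sub>C q)) * G z'"
        by (simp add: right_diff_distrib left_diff_distrib mult.assoc)
      finally show ?thesis by (simp add: G1 G2)
    qed
    define K where "K = norm q * norm (G z') + 1"
    have K: "K > 0" by (simp add: K_def add_nonneg_pos)
    have b1: "norm (G z - G z') \<le> norm (z - z') * K * norm (G z)" for z
    proof -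
      have "norm (G z * q * G z') \<le> norm (G z) * norm q * norm (G z')"
        by (meson mult_right_mono norm_ge_zero norm_mult_ineq order_trans)
      also have "\<dots> \<le> norm (G z) * K" by (simp add: K_def algebra_simps)
      finally show ?thesis unfolding diff norm_scaleC
        by (simp add: mult_left_mono mult.assoc mult.commute[of K])
    qed
    have b2: "norm (G z - G z') \<le> norm (z - z') * (K * 2 * norm (G z'))"
      if "norm (z - z') < 1 / (2 * K)" for z
    proof -
      have "norm (z - z') * K \<le> 1/2" using that K by (simp add: field_simps)
      then have "norm (z - z') * K * norm (G z) \<le> 1/2 * norm (G z)"
        by (intro mult_right_mono) auto
      with b1[of z] have "norm (G z - G z') \<le> 1/2 * norm (G z)" by linarith
      then have "norm (G z) \<le> 2 * norm (G z')" using norm_triangle_ineq2[of "G z" "G z'"] by linarith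
      then have "norm (z - z') * K * norm (G z) \<le> norm (z - z') * K * (2 * norm (G z'))"
        using K by (intro mult_left_mono) auto
      with b1[of z] show ?thesis by (simp add: mult.assoc)
    qed
    have "((\<lambda>z. G z - G z') \<longlongrightarrow> 0) (at z')"
    proof (rule Lim_null_comparison)
      show "\<forall>\<^sub>F z in at z'. norm (G z - G z') \<le> norm (z - z') * (K * 2 * norm (G z'))"
        unfolding eventually_at using K b2
        by (intro exI[of _ "1 / (2 * K)"]) (auto simp: dist_norm)
      show "((\<lambda>z. norm (z - z') * (K * 2 * norm (G z'))) \<longlongrightarrow> 0) (at z')"
        by (auto intro!: tendsto_eq_intros)
    qed
    then show ?thesis by (simp add: isCont_def LIM_zero_iff)
  qed
  then show ?thesis by (simp add: continuous_at_imp_continuous_on)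
qed

text \<open>
  The averages of the resolvent over roots of unity are the inverses of \<open>1 - (z q)\<^sup>n\<close>. They are
  equicontinuous in \<open>z\<close>, so the convergence \<open>(z q)\<^sup>n \<rightarrow> 0\<close> propagates from \<open>z = 0\<close> to every disc
  on which the resolvent exists.
\<close>

lemma quasinilpotent_of_spectrum:
  fixes q :: "'a::complex_banach_algebra_1"
  assumes "spectrum q \<subseteq> {0}"
  shows "quasinilpotent q"
proof -
  have "\<exists>y. (1 - z *\<^sub>C q) * y = 1 \<and> y * (1 - z *\<^sub>C q) = 1" for z
  proof (cases "z = 0")
    case False
    then have "inverse z \<notin> spectrum q" using assms by auto
    then show ?thesis using one_minus_scaleC_bi_invertible_iff[OF False, of q]
      by (simp add: bi_invertible_def)
  qed auto
  then obtain G where G1: "\<And>z. (1 - z *\<^sub>C q) * G z = 1" and G2: "\<And>z. G z * (1 - z *\<^sub>C q) = 1"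
    by metis
  define w where "w = (\<lambda>n k. exp (2 * of_real pi * \<i> * of_nat k / of_nat n))"
  have nw: "norm (w n k) = 1" for n k
    by (simp add: w_def norm_exp_eq_Re)
  define S where "S = (\<lambda>n z. inverse (of_nat n) *\<^sub>C (\<Sum>k<n. G (z * w n k)))"
  have S1: "(1 - (z *\<^sub>C q) ^ n) * S n z = 1" and S2: "S n z * (1 - (z *\<^sub>C q) ^ n) = 1" if "n > 0" for n z
    using resolvent_average[OF G1 G2 that, of z] by (simp_all add: S_def w_def)
  have nc: "norm (inverse (of_nat n) *\<^sub>C x) = norm x / n" for n and x :: 'a
    by (simp add: norm_scaleC norm_inverse divide_inverse mult.commute)
  define Z where "Z = (\<lambda>t::real. (\<lambda>n. t ^ n * norm (q ^ n)) \<longlonglongrightarrow> 0)"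
  have nY: "norm ((complex_of_real t *\<^sub>C q) ^ n) = t ^ n * norm (q ^ n)" if "t \<ge> 0" for t n
    using that by (simp add: power_scaleC norm_scaleC norm_power)
  have "Z R" if "R > 0" for R :: real
  proof -
    have cmp: "compact (cball (0::complex) (R + 1))" by simp
    have co: "continuous_on (cball 0 (R + 1)) G" by (rule resolvent_continuous[OF G1 G2])
    obtain M where M: "\<And>z. norm z \<le> R + 1 \<Longrightarrow> norm (G z) \<le> M"
      using compact_imp_bounded[OF compact_continuous_image[OF co cmp]]
      unfolding bounded_iff by (metis image_eqI mem_cball_0)
    obtain d0 where d0: "d0 > 0" and d0': "\<And>z z'. norm z \<le> R + 1 \<Longrightarrow> norm z' \<le> R + 1 \<Longrightarrow>
        norm (z - z') < d0 \<Longrightarrow> norm (G z - G z') < 1/2"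
      using compact_uniformly_continuous[OF co cmp] unfolding uniformly_continuous_on_def
      by (auto simp: dist_norm dest!: spec[of _ "1/2::real"])
    have SM: "norm (S n z) \<le> M" if "norm z \<le> R + 1" "n > 0" for n z
    proof -
      have "norm (\<Sum>k<n. G (z * w n k)) \<le> (\<Sum>k<n. M)"
        by (intro sum_norm_le M) (simp add: norm_mult nw that)
      then show ?thesis using that by (simp add: S_def nc pos_divide_le_eq mult.commute)
    qed
    have Sd: "norm (S n z - S n z') \<le> 1/2"
      if "norm z \<le> R + 1" "norm z' \<le> R + 1" "norm (z - z') < d0" "n > 0" for n z z'
    proof -
      have "norm (G (z * w n k) - G (z' * w n k)) \<le> 1/2" for k
        using that by (intro less_imp_le[OF d0']) (simp_all add: norm_mult nw flip: left_diff_distrib)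
      then have "norm (\<Sum>k<n. G (z * w n k) - G (z' * w n k)) \<le> (\<Sum>k<n. 1/2)"
        by (intro sum_norm_le)
      then show ?thesis using that
        by (simp add: S_def nc pos_divide_le_eq sum_subtractf flip: cvs.scale_right_diff_distrib)
    qed
    \<comment> \<open>For large \<open>n\<close> the average at \<open>t\<close> is within 1/4 of 1,
      and the average at \<open>t'\<close> within 1/2 of that at \<open>t\<close>. As 3/4 is below
      1, \<open>Y' = (A' - 1) * (1 - Y')\<close> can be solved for a bound on \<open>Y'\<close>,
      which gives decay at every radius strictly below \<open>t'\<close>.\<close>
    have step: "Z s" if "Z t" "0 \<le> t" "t < t'" "t' \<le> R + 1" "t' - t < d0" "0 \<le> s" "s < t'" for s t t'
    proof -
      have "\<forall>\<^sub>F n in sequentially. t ^ n * norm (q ^ n) * M < 1/4"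
      proof -
        have "(\<lambda>n. t ^ n * norm (q ^ n) * M) \<longlonglongrightarrow> 0 * M"
          using \<open>Z t\<close> unfolding Z_def by (intro tendsto_mult_right)
        then show ?thesis by (intro order_tendstoD(2)[of _ 0]) auto
      qed
      then have "\<forall>\<^sub>F n in sequentially. t' ^ n * norm (q ^ n) \<le> 3 * norm (1::'a)"
        using eventually_gt_at_top[of 0]
      proof eventually_elim
        case (elim n)
        define Y where "Y = (complex_of_real t *\<^sub>C q) ^ n"
        define Y' where "Y' = (complex_of_real t' *\<^sub>C q) ^ n"
        define A where "A = S n (complex_of_real t)"
        define A' where "A' = S n (complex_of_real t')"
        have "A - 1 = Y * A" using S1[OF \<open>0 < n\<close>, of "complex_of_real t"]
          unfolding A_def Y_def by (simp add: algebra_simps)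
        then have "norm (A - 1) \<le> norm Y * norm A" by (simp add: norm_mult_ineq)
        also have "\<dots> \<le> norm Y * M" using that elim unfolding A_def by (intro mult_left_mono SM) auto
        finally have a: "norm (A - 1) \<le> 1/4" using elim that by (simp add: Y_def nY)
        have "norm (A' - A) \<le> 1/2" using that elim unfolding A_def A'_def
          by (intro Sd) (auto simp flip: of_real_diff)
        with a have b: "norm (A' - 1) \<le> 3/4"
          using norm_triangle_ineq[of "A' - A" "A - 1"] by simp
        have "Y' = (A' - 1) * (1 - Y')" using S2[OF \<open>0 < n\<close>, of "complex_of_real t'"]
          unfolding A'_def Y'_def by (simp add: algebra_simps)
        then have "norm Y' \<le> norm (A' - 1) * norm (1 - Y')" by (metis norm_mult_ineq)
        also have "\<dots> \<le> 3/4 * (norm (1::'a) + norm Y')"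
          using b by (intro mult_mono norm_triangle_ineq4) auto
        finally have "norm Y' \<le> 3 * norm (1::'a)" by simp
        then show ?case using that by (simp add: Y'_def nY)
      qed
      then have "\<forall>\<^sub>F n in sequentially. norm (s ^ n * norm (q ^ n)) \<le> (s / t') ^ n * (3 * norm (1::'a))"
      proof eventually_elim
        case (elim n)
        have "s ^ n * norm (q ^ n) = (s / t') ^ n * (t' ^ n * norm (q ^ n))"
          using that by (simp add: power_divide)
        also have "\<dots> \<le> (s / t') ^ n * (3 * norm (1::'a))"
          using that by (intro mult_left_mono elim) auto
        finally show ?case using that by simp
      qed
      moreover have "(\<lambda>n. (s / t') ^ n * (3 * norm (1::'a))) \<longlonglongrightarrow> 0"
        using that by (intro tendsto_mult_left_zero LIMSEQ_realpow_zero) auto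
      ultimately show ?thesis unfolding Z_def by (rule Lim_null_comparison)
    qed
    have Z0: "Z 0" unfolding Z_def
      by (rule tendsto_eventually) (auto intro: eventually_mono[OF eventually_gt_at_top[of 0]])
    \<comment> \<open>A step goes from \<open>s - h\<close> to \<open>s + h\<close>, beyond
      \<open>s\<close>, because decay is gained only strictly below the end point. So
      \<open>2 * h\<close> has to be less than \<open>d0\<close>, and \<open>h \<le> 1\<close> keeps
      \<open>s + h\<close> inside the disc of radius \<open>R + 1\<close>.\<close>
    define h where "h = min 1 (d0 / 3)"
    have h: "h > 0" "h \<le> 1" "2 * h < d0" using d0 by (auto simp: h_def min_def)
    have "0 \<le> s \<Longrightarrow> s \<le> real k * h \<Longrightarrow> s \<le> R \<Longrightarrow> Z s" for k s
    proof (induction k arbitrary: s)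
      case 0
      then show ?case using Z0 by simp
    next
      case (Suc k)
      define t where "t = max 0 (s - h)"
      have "Z t" using Suc.prems h by (intro Suc.IH) (auto simp: t_def algebra_simps)
      then show ?case
        by (rule step[where t' = "s + h"]) (use Suc.prems h in \<open>auto simp: t_def\<close>)
    qed
    moreover obtain k where "R \<le> real k * h"
      using reals_Archimedean3[OF h(1)] less_imp_le by blast
    ultimately show ?thesis using that by (meson less_imp_le order_refl)
  qed
  then have Bs: "Bseq (\<lambda>n. R ^ n * norm (q ^ n))" if "R > 0" for R :: real
    using that unfolding Z_def by (intro convergent_imp_Bseq convergentI)
  show ?thesis unfolding quasinilpotent_def
  proof (intro allI impI)
    fix R :: real assume "R > 0"
    from Bs[OF this] obtain C where "\<And>n. norm (R ^ n * norm (q ^ n)) \<le> C"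
      by (auto simp: Bseq_def)
    then show "\<exists>C. \<forall>n. R ^ n * norm (q ^ n) \<le> C"
      by (intro exI[of _ C] allI) (metis abs_le_D1 real_norm_def)
  qed
qed

section \<open>Spectral idempotents\<close>

lemma bi_invertible_mult:
  assumes "bi_invertible x" "bi_invertible y"
  shows "bi_invertible (x * y)"
proof -
  from assms obtain a b where a: "x * a = 1" "a * x = 1" and b: "y * b = 1" "b * y = 1"
    by (auto simp: bi_invertible_def)
  have "b * a * (x * y) = b * (a * x) * y" "x * y * (b * a) = x * (y * b) * a"
    by (simp_all only: mult.assoc)
  then show ?thesis using a b by (intro bi_invertibleI[of "b * a" _ "b * a"]) simp_all
qed

section \<open>Polynomial calculus on a finite spectrum\<close>

definition peval :: "'a::complex_banach_algebra_1 \<Rightarrow> complex poly \<Rightarrow> 'a" where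
  "peval x p = fold_coeffs (\<lambda>a y. a *\<^sub>C 1 + x * y) p 0"

lemma peval_0 [simp]: "peval x 0 = 0"
  by (simp add: peval_def)

lemma peval_pCons [simp]: "peval x (pCons a p) = a *\<^sub>C 1 + x * peval x p"
  by (cases "p = 0 \<and> a = 0") (auto simp: peval_def)

lemma peval_1 [simp]: "peval x 1 = 1"
  by (simp add: one_pCons scaleC_one)

lemma peval_add: "peval x (p + q) = peval x p + peval x q"
  by (induction p q rule: poly_induct2) (simp_all add: scaleC_add_left algebra_simps)

lemma peval_smult: "peval x (smult c p) = c *\<^sub>C peval x p"
  by (induction p) (simp_all add: scaleC_add_right scaleC_mult_simps)

lemma peval_diff: "peval x (p - q) = peval x p - peval x q"
  using peval_add[of x "p - q" q] by simp

lemma peval_mult: "peval x (p * q) = peval x p * peval x q"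
  by (induction p) (simp_all add: peval_add peval_smult scaleC_mult_simps algebra_simps)

lemma peval_commutes: "a * x = x * a \<Longrightarrow> a * peval x p = peval x p * a"
proof (induction p)
  case (pCons c p)
  have "a * (x * peval x p) = x * (a * peval x p)" using pCons.prems by (simp flip: mult.assoc)
  then show ?case using pCons by (simp add: algebra_simps scaleC_mult_simps)
qed simp

lemma peval_bi_invertible:
  fixes x :: "'a::complex_banach_algebra_1"
  assumes "p \<noteq> 0" "\<And>z. poly p z = 0 \<Longrightarrow> z \<notin> spectrum x"
  shows "bi_invertible (peval x p)"
  using assms
proof (induction "degree p" arbitrary: p)
  case 0
  then obtain c where c: "p = [:c:]" using degree_eq_zeroE by metis
  with 0 have "c \<noteq> 0" by auto
  moreover have "bi_invertible (1::'a)" by (auto simp: bi_invertible_def)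
  ultimately show ?case using c by (simp add: bi_invertible_scaleC_iff)
next
  case (Suc n)
  have "\<not> constant (poly p)" using Suc by (simp add: constant_degree)
  then obtain z where z: "poly p z = 0" using fundamental_theorem_of_algebra by blast
  then obtain q where q: "p = [:- z, 1:] * q" by (metis dvdE poly_eq_0_iff_dvd)
  then have "q \<noteq> 0" using Suc.prems by auto
  then have "degree p = Suc (degree q)" unfolding q by (subst degree_mult_eq) auto
  then have "bi_invertible (peval x q)" using Suc q \<open>q \<noteq> 0\<close> by (intro Suc.hyps(1)) auto
  moreover have "bi_invertible (x - z *\<^sub>C 1)" using Suc.prems(2)[OF z] by (simp add: spectrum_iff)
  moreover have "peval x p = (x - z *\<^sub>C 1) * peval x q"
    unfolding q peval_mult by (simp add: scaleC_one)
  ultimately show ?case by (simp add: bi_invertible_mult)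
qed

text \<open>The product \<open>P\<close> vanishes exactly on the spectrum, so for
  \<open>k \<noteq> 0\<close> the polynomial \<open>P - [:k:]\<close> has no root there and its
  value at \<open>x\<close> is invertible. Nonemptiness of the spectrum gives \<open>P\<close> a
  root and so keeps \<open>P - [:k:]\<close> from being the zero polynomial.\<close>

lemma quasinilpotent_spectral_product:
  fixes x :: "'a::complex_banach_algebra_1"
  assumes "finite (spectrum x)" "spectrum x \<noteq> {}"
  shows "quasinilpotent (peval x (\<Prod>\<mu>\<in>spectrum x. [:- \<mu>, 1:]))"
proof (rule quasinilpotent_of_spectrum, rule subsetI)
  define P where "P = (\<Prod>\<mu>\<in>spectrum x. [:- \<mu>, 1:])"
  have root: "poly P z = 0 \<longleftrightarrow> z \<in> spectrum x" for z
    using assms by (auto simp: P_def poly_prod)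
  fix k assume k: "k \<in> spectrum (peval x P)"
  show "k \<in> {0}"
  proof (rule ccontr)
    assume "k \<notin> {0}"
    then have k0: "k \<noteq> 0" by simp
    have "P - [:k:] \<noteq> 0"
    proof
      assume "P - [:k:] = 0"
      then have "P = [:k:]" by simp
      then have "poly P z = k" for z by simp
      with k0 root assms(2) show False by (metis ex_in_conv)
    qed
    moreover have "z \<notin> spectrum x" if "poly (P - [:k:]) z = 0" for z
      using that k0 root[of z] by auto
    ultimately have "bi_invertible (peval x (P - [:k:]))" by (rule peval_bi_invertible)
    then show False using k by (simp add: peval_diff spectrum_iff)
  qed
qed

text \<open>\<open>norm f\<close> is at most a constant times
  \<open>norm r ^ j * norm (n ^ j)\<close>, which tends to 0. The product is \<open>f\<close> rather
  than 1 so that the lemma applies in a corner \<open>f B f\<close>; exponents start at 1 because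
  the zeroth product is 1.\<close>

lemma quasinilpotent_right_inverse_powers:
  fixes n r f :: "'a::complex_banach_algebra_1"
  assumes "quasinilpotent n" "\<And>j. n ^ Suc j * r ^ Suc j = f"
  shows "f = 0"
proof -
  have le: "norm f \<le> norm (1::'a) * (norm r ^ j * norm (n ^ j))" if j: "j > 0" for j
  proof -
    obtain i where "j = Suc i" using j by (cases j) auto
    then have "norm f \<le> norm (n ^ j) * norm (r ^ j)"
      using assms(2)[of i] norm_mult_ineq[of "n ^ j" "r ^ j"] by simp
    also have "\<dots> \<le> norm (n ^ j) * (norm (1::'a) * norm r ^ j)"
      by (intro mult_left_mono norm_power_le) simp
    finally show ?thesis by (simp add: ac_simps)
  qed
  have lim: "(\<lambda>j. norm (1::'a) * (norm r ^ j * norm (n ^ j))) \<longlonglongrightarrow> norm (1::'a) * 0"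
    by (intro tendsto_mult_left quasinilpotent_power_small assms) simp
  have "norm f \<le> norm (1::'a) * 0"
    by (rule LIMSEQ_le_const[OF lim]) (use le in \<open>auto intro!: exI[of _ 1]\<close>)
  then show ?thesis by simp
qed

lemma quasinilpotent_not_bi_invertible:
  fixes n :: "'a::complex_banach_algebra_1"
  assumes "quasinilpotent n"
  shows "\<not> bi_invertible n"
proof
  assume "bi_invertible n"
  then obtain r where r: "n * r = 1" "r * n = 1" by (auto simp: bi_invertible_def)
  then have "n ^ Suc j * r ^ Suc j = 1" for j
    using power_mult_commuting[of n r "Suc j"] by simp
  then have "(1::'a) = 0" by (rule quasinilpotent_right_inverse_powers[OF assms])
  then show False by simp
qed

text \<open>An empty spectrum would make \<open>x\<close> both quasinilpotent and
  invertible.\<close>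

lemma spectrum_nonempty: "spectrum (x::'a::complex_banach_algebra_1) \<noteq> {}"
proof
  assume "spectrum x = {}"
  then have "quasinilpotent x" by (intro quasinilpotent_of_spectrum) simp
  moreover from \<open>spectrum x = {}\<close> have "0 \<notin> spectrum x" by blast
  then have "bi_invertible x" unfolding spectrum_iff by simp
  ultimately show False by (simp add: quasinilpotent_not_bi_invertible)
qed

section \<open>Lifting idempotents modulo quasinilpotent elements\<close>

lemma abs_gbinomial_minus_half_le: "\<bar>(-1/2 :: real) gchoose n\<bar> \<le> 1"
proof (induction n)
  case (Suc n)
  define X Y where "X = (-1/2 :: real) gchoose n" and "Y = (-1/2 :: real) gchoose Suc n"
  have "-1/2 * X = real n * X + (real n + 1) * Y"
    using gbinomial_mult_1[of "-1/2 :: real" n] by (simp add: X_def Y_def add.commute)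
  then have "(real n + 1) * Y = - ((1/2 + real n) * X)" by (simp add: algebra_simps)
  then have "\<bar>(real n + 1) * Y\<bar> = \<bar>(1/2 + real n) * X\<bar>" by simp
  then have "(real n + 1) * \<bar>Y\<bar> = (1/2 + real n) * \<bar>X\<bar>" by (simp add: abs_mult)
  also have "\<dots> \<le> (real n + 1) * 1" using Suc by (intro mult_mono) (auto simp: X_def)
  finally have "\<bar>Y\<bar> \<le> 1" by (subst (asm) mult_le_cancel_left_pos) auto
  then show ?case by (simp add: Y_def)
qed simp

text \<open>
  Since \<open>(2l - 1)\<^sup>2 = 1 + 4w\<close> for \<open>w = l\<^sup>2 - l\<close>, dividing \<open>2l - 1\<close> by a square root of \<open>1 + 4w\<close>
  gives an involution; the root is the binomial series, which converges as \<open>w\<close> is quasinilpotent.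
\<close>

lemma idempotent_lifting:
  fixes l :: "'a::complex_banach_algebra_1"
  assumes "quasinilpotent (l * l - l)"
  obtains e h where "e = l + (l * l - l) * h" "e * e = e" "\<And>a. a * l = l * a \<Longrightarrow> a * h = h * a"
proof -
  define w where "w = l * l - l"
  \<comment> \<open>\<open>c n\<close> is the coefficient of \<open>w ^ n\<close> in the series of
    (1 + 4w)^(-1/2).\<close>
  define c where "c = (\<lambda>n. ((-1/2 :: real) gchoose n) * 4 ^ n)"
  have cle: "norm (c n) \<le> 4 ^ n" for n
    using abs_gbinomial_minus_half_le[of n] by (simp add: c_def abs_mult)
  have sc: "summable (\<lambda>n. norm (c n *\<^sub>R w ^ n))"
    using assms cle by (intro quasinilpotent_summable[of w 4 _ 1]) (auto simp: w_def)
  have sc': "summable (\<lambda>n. norm (c (Suc n) *\<^sub>R w ^ n))"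
    using assms cle[of "Suc n" for n] by (intro quasinilpotent_summable[of w 4 _ 4]) (auto simp: w_def)
  note s = summable_norm_cancel[OF sc] and s' = summable_norm_cancel[OF sc']
  define S where "S = (\<Sum>n. c n *\<^sub>R w ^ n)"
  define h' where "h' = (\<Sum>n. c (Suc n) *\<^sub>R w ^ n)"
  have Sh: "S = 1 + w * h'"
  proof -
    have "S = 1 + (\<Sum>n. c (Suc n) *\<^sub>R w ^ Suc n)"
      unfolding S_def using suminf_split_head[OF s] by (simp add: c_def)
    also have "(\<Sum>n. c (Suc n) *\<^sub>R w ^ Suc n) = w * h'"
      unfolding h'_def using suminf_mult[OF s', of w] by simp
    finally show ?thesis .
  qed
  \<comment> \<open>By Vandermonde the Cauchy square of the series has the coefficients for the
    exponent -1/2 - 1/2 = -1, so it is the Neumann series of 1 + 4w.\<close>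
  have SS: "(1 + 4 *\<^sub>R w) * (S * S) = 1"
  proof -
    have "(\<lambda>n. \<Sum>i\<le>n. (c i *\<^sub>R w ^ i) * (c (n - i) *\<^sub>R w ^ (n - i))) sums (S * S)"
      unfolding S_def by (rule Cauchy_product_sums[OF sc sc])
    moreover have "(\<Sum>i\<le>n. (c i *\<^sub>R w ^ i) * (c (n - i) *\<^sub>R w ^ (n - i))) = (- (4 *\<^sub>R w)) ^ n" for n
    proof -
      have "(\<Sum>i\<le>n. (c i *\<^sub>R w ^ i) * (c (n - i) *\<^sub>R w ^ (n - i)))
          = (\<Sum>i\<le>n. (((-1/2) gchoose i) * ((-1/2) gchoose (n - i)) * 4 ^ n) *\<^sub>R w ^ n)"
        by (intro sum.cong) (auto simp: c_def simp flip: power_add)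
      also have "\<dots> = (((-1/2 + -1/2) gchoose n) * 4 ^ n) *\<^sub>R w ^ n"
        by (simp only: gbinomial_Vandermonde[symmetric] atLeast0AtMost sum_distrib_right scaleR_sum_left)
      also have "((-1/2 + -1/2 :: real) gchoose n) = (-1) ^ n"
        using gbinomial_minus[of "1::real" n] by (simp flip: binomial_gbinomial)
      also have "((-1) ^ n * 4 ^ n) *\<^sub>R w ^ n = (- (4 *\<^sub>R w)) ^ n"
      proof (induction n)
        case (Suc n)
        then show ?case by (simp add: Suc.IH[symmetric] mult.left_commute)
      qed simp
      finally show ?thesis .
    qed
    ultimately have sums: "(\<lambda>n. (- (4 *\<^sub>R w)) ^ n) sums (S * S)" by simp
    have "(\<lambda>n. (- (4 *\<^sub>R w)) ^ Suc n) sums ((- (4 *\<^sub>R w)) * (S * S))"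
      using sums_mult[OF sums, of "- (4 *\<^sub>R w)"] by simp
    moreover have "(\<lambda>n. (- (4 *\<^sub>R w)) ^ Suc n) sums (S * S - 1)"
      using sums_Suc_iff[of "\<lambda>n. (- (4 *\<^sub>R w)) ^ n" "S * S - 1"] sums by simp
    ultimately have "(- (4 *\<^sub>R w)) * (S * S) = S * S - 1" by (rule sums_unique2)
    then show ?thesis by (simp add: algebra_simps)
  qed
  have comm: "a * S = S * a \<and> a * h' = h' * a" if "a * l = l * a" for a
  proof -
    have "a * w = w * a" unfolding w_def using that by (metis mult.assoc right_diff_distrib left_diff_distrib)
    then have "a * w ^ n = w ^ n * a" for n using power_commuting_commutes[of w a n] by simp
    then show ?thesis unfolding S_def h'_def
      using suminf_mult[OF s, of a] suminf_mult2[OF s, of a] suminf_mult[OF s', of a] suminf_mult2[OF s', of a]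
      by simp
  qed
  \<comment> \<open>Obtained by solving \<open>2 *\<^sub>R e - 1 = v * S\<close> for
    \<open>e\<close> with \<open>S = 1 + w * h'\<close>.\<close>
  define h where "h = (l - (1/2) *\<^sub>R 1) * h'"
  define e where "e = l + w * h"
  define v where "v = 2 *\<^sub>R l - 1"
  have lw: "l * w = w * l" by (simp add: w_def algebra_simps)
  have ve: "2 *\<^sub>R e - 1 = v * S"
  proof -
    have "l * (w * h') = w * (l * h')" using lw by (simp flip: mult.assoc)
    then show ?thesis by (simp add: e_def h_def v_def Sh algebra_simps)
  qed
  have vS: "v * S = S * v" using comm[of l] by (simp add: v_def algebra_simps)
  have "(2 *\<^sub>R e - 1) * (2 *\<^sub>R e - 1) = v * (S * v) * S" by (simp add: ve mult.assoc)
  also have "\<dots> = (v * v) * (S * S)" by (simp add: vS[symmetric] mult.assoc)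
  also have "v * v = 1 + 4 *\<^sub>R w" 
    by (simp add: v_def w_def algebra_simps) (simp flip: scaleR_add_left)
  finally have "(2 *\<^sub>R e - 1) * (2 *\<^sub>R e - 1) = 1" by (simp add: SS)
  moreover have "(2 *\<^sub>R e - 1) * (2 *\<^sub>R e - 1) = 1 + 4 *\<^sub>R (e * e - e)"
    by (simp add: algebra_simps) (simp flip: scaleR_add_left)
  ultimately have "4 *\<^sub>R (e * e - e) = 0" by simp
  then have "e * e = e" by simp
  moreover have "a * h = h * a" if "a * l = l * a" for a
  proof -
    have "(l - (1/2) *\<^sub>R 1) * (a * h') = ((l - (1/2) *\<^sub>R 1) * a) * h'" by (simp add: mult.assoc)
    also have "(l - (1/2) *\<^sub>R 1) * a = a * (l - (1/2) *\<^sub>R 1)" using that by (simp add: algebra_simps)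
    finally show ?thesis using comm[OF that] by (simp add: h_def mult.assoc)
  qed
  ultimately show ?thesis using that[of e h] by (simp add: e_def w_def)
qed

text \<open>An algebraic Riesz projection. The interpolation polynomial \<open>L\<close> is 1 at
  \<open>c\<close> and 0 on the rest of the spectrum; its value \<open>l\<close> at \<open>x\<close>
  is idempotent up to a multiple of the quasinilpotent \<open>(x - c *\<^sub>C 1) * l\<close> and
  can be lifted. The factorisations through \<open>x\<close> put \<open>e\<close> into every ideal
  containing \<open>x\<close>; those of \<open>1 - e\<close> make \<open>e\<close> act as 1 on
  eigenvectors for \<open>c\<close>.\<close>

lemma spectral_idempotent:
  fixes x :: "'a::complex_banach_algebra_1"
  assumes fin: "finite (spectrum x)" and c: "c \<in> spectrum x" "c \<noteq> 0"
  obtains e r s where "e * e = e" "e \<noteq> 0" "e = x * r" "e = r * x"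
    "1 - e = (x - c *\<^sub>C 1) * s" "1 - e = s * (x - c *\<^sub>C 1)"
    "quasinilpotent ((x - c *\<^sub>C 1) * e)" "x * e = e * x"
proof -
  define T where "T = spectrum x - {c}"
  define k where "k = inverse (\<Prod>\<mu>\<in>T. c - \<mu>)"
  define L where "L = smult k (\<Prod>\<mu>\<in>T. [:- \<mu>, 1:])"
  have "finite T" using fin by (simp add: T_def)
  then have "poly L c = 1" by (auto simp: L_def k_def poly_prod T_def)
  then have "poly (L - 1) c = 0" by simp
  then obtain s where s: "L - 1 = [:- c, 1:] * s" by (metis dvdE poly_eq_0_iff_dvd)
  have P: "[:- c, 1:] * L = smult k (\<Prod>\<mu>\<in>spectrum x. [:- \<mu>, 1:])"
    using prod.remove[OF fin c(1), of "\<lambda>\<mu>. [:- \<mu>, 1:]"] by (simp add: L_def T_def del: mult_pCons_left)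
  define l where "l = peval x L"
  define y where "y = x - c *\<^sub>C 1"
  have y: "y = peval x [:- c, 1:]" by (simp add: y_def scaleC_one)
  have yl: "quasinilpotent (y * l)" unfolding y l_def peval_mult[symmetric] P peval_smult
    by (intro quasinilpotent_scaleC quasinilpotent_spectral_product fin) (use c in blast)
  have l1: "l - 1 = y * peval x s"
    unfolding y l_def peval_mult[symmetric] s[symmetric] by (simp add: peval_diff)
  have pc: "peval x p * peval x q = peval x q * peval x p" for p q
    by (simp add: peval_mult[symmetric] mult.commute)
  have ls: "l * l - l = (y * l) * peval x s"
  proof -
    have "l * l - l = (l - 1) * l" by (simp add: algebra_simps)
    also have "\<dots> = y * (peval x s * l)" by (simp add: l1 mult.assoc)
    also have "peval x s * l = l * peval x s" unfolding l_def by (rule pc)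
    finally show ?thesis by (simp add: mult.assoc)
  qed
  have "quasinilpotent (l * l - l)" unfolding ls
    by (rule quasinilpotent_mult[OF yl])
      (simp only: y l_def peval_mult[symmetric] mult.commute)
  then obtain e h where e: "e = l + (l * l - l) * h" "e * e = e"
    and h: "\<And>a. a * l = l * a \<Longrightarrow> a * h = h * a"
    by (rule idempotent_lifting) blast
  have xl: "x * l = l * x" unfolding l_def by (rule peval_commutes) simp
  have xh: "x * h = h * x" by (rule h[OF xl])
  have lh: "l * h = h * l" by (rule h) simp
  have yc: "y * a = a * y" if "x * a = a * x" for a
    using that by (simp add: y_def algebra_simps scaleC_mult_simps)
  \<comment> \<open>With \<open>e = l * u\<close> and commuting factors,
    \<open>y * e = (y * l) * u\<close> inherits quasinilpotency.\<close>
  define u where "u = 1 + (l - 1) * h"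
  have eu: "e = l * u" by (simp add: e u_def algebra_simps)
  have xu: "x * u = u * x"
  proof -
    have "x * ((l - 1) * h) = (x * (l - 1)) * h" by (simp add: mult.assoc)
    also have "x * (l - 1) = (l - 1) * x" using xl by (simp add: algebra_simps)
    finally show ?thesis using xh by (simp add: u_def algebra_simps)
  qed
  have xe: "x * e = e * x"
  proof -
    have "x * e = (x * l) * u" by (simp add: eu mult.assoc)
    also have "\<dots> = l * (x * u)" by (simp add: xl mult.assoc)
    finally show ?thesis by (simp add: xu eu mult.assoc)
  qed
  have lu: "l * u = u * l"
  proof -
    have "l * (h * l) = h * (l * l)" by (metis lh mult.assoc)
    then show ?thesis by (simp add: u_def algebra_simps lh)
  qed
  have ye: "quasinilpotent (y * e)"
  proof -
    have "(y * l) * u = u * (y * l)" using yc[OF xu] lu by (metis mult.assoc)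
    from quasinilpotent_mult[OF yl this] show ?thesis by (simp add: eu mult.assoc)
  qed
  define t where "t = peval x s * (- 1 - l * h)"
  have t1: "1 - e = y * t"
  proof -
    have "1 - e = (l - 1) * (- 1 - l * h)" by (simp add: e algebra_simps)
    then show ?thesis by (simp add: l1 t_def mult.assoc)
  qed
  have "x * t = t * x"
  proof -
    have "x * (- 1 - l * h) = (- 1 - l * h) * x"
      using xl xh by (simp add: algebra_simps) (metis mult.assoc)
    moreover have "x * peval x s = peval x s * x" by (rule peval_commutes) simp
    ultimately show ?thesis unfolding t_def by (metis mult.assoc)
  qed
  then have t2: "1 - e = t * y" using t1 yc by simp
  have "e \<noteq> 0"
    using t1 t2 c(1) bi_invertibleI[of t y t] by (auto simp: spectrum_iff y_def)
  \<comment> \<open>\<open>n + c *\<^sub>C 1\<close> is invertible and agrees with \<open>x\<close>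
    after multiplication by \<open>e\<close>, so its inverse also inverts \<open>x\<close> relative
    to \<open>e\<close>.\<close>
  define n where "n = y * e"
  obtain g where g: "(n + c *\<^sub>C 1) * g = 1" "g * (n + c *\<^sub>C 1) = 1"
    using quasinilpotent_plus_scalar[OF ye c(2)] unfolding n_def bi_invertible_def by blast
  have "e * y = y * e" using yc[OF xe] by simp
  then have ne: "e * n = n * e" by (simp add: n_def e(2) flip: mult.assoc)
  have eg: "e * g = g * e"
    by (rule inverse_commutes[OF g]) (simp add: ne algebra_simps scaleC_mult_simps)
  have ce: "(n + c *\<^sub>C 1) * e = x * e"
  proof -
    have "n * e = n" unfolding n_def mult.assoc e(2) ..
    then show ?thesis by (simp add: distrib_right mult_scaleC_left n_def y_def left_diff_distrib)
  qed
  have "g * (x * e) = e" using g(2) by (simp add: ce[symmetric] flip: mult.assoc)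
  then have r1: "e = (g * e) * x" using xe by (simp add: mult.assoc)
  have "x * (e * g) = (n + c *\<^sub>C 1) * (e * g)" using ce by (simp flip: mult.assoc)
  also have "\<dots> = e" using g(1) by (simp add: eg flip: mult.assoc)
  finally have r2: "e = x * (g * e)" using eg by simp
  show ?thesis
    by (rule that[of e "g * e" t]) (use e(2) \<open>e \<noteq> 0\<close> r1 r2 t1 t2 ye xe in \<open>simp_all add: y_def\<close>)
qed

section \<open>Semisimplicity and minimal idempotents\<close>

lemma left_ideal_diff: "left_ideal L \<Longrightarrow> x \<in> L \<Longrightarrow> y \<in> L \<Longrightarrow> x - y \<in> L"
  unfolding left_ideal_def by (metis add_uminus_conv_diff mult_minus1)

lemma maximal_left_ideal_one: "maximal_left_ideal L \<Longrightarrow> 1 \<notin> L"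
  unfolding maximal_left_ideal_def left_ideal_def by (metis UNIV_eq_I mult_1_right)

text \<open>In the simple module \<open>B/L\<close> the nonzero class of \<open>u\<close> can be
  moved to any class \<open>c\<close>: by maximality \<open>L + B u\<close> is everything.\<close>

lemma maximal_left_ideal_generates:
  assumes "maximal_left_ideal L" "u \<notin> L"
  obtains b where "b * u - c \<in> L"
proof -
  define J where "J = {l + b * u | l b. l \<in> L}"
  have L: "left_ideal L" using assms by (simp add: maximal_left_ideal_def)
  have JI: "l + b * u \<in> J" if "l \<in> L" for l b using that by (auto simp: J_def)
  have "left_ideal J"
    unfolding left_ideal_def
  proof (intro conjI ballI allI)
    show "0 \<in> J" using JI[of 0 0] L by (simp add: left_ideal_def)
    fix x assume x: "x \<in> J"
    then obtain l b where lb: "x = l + b * u" "l \<in> L" by (auto simp: J_def)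
    have "a * x = a * l + (a * b) * u" for a by (simp add: lb(1) distrib_left mult.assoc)
    then show "a * x \<in> J" for a using JI lb(2) L by (auto simp: left_ideal_def)
    fix y assume "y \<in> J"
    then obtain l' b' where lb': "y = l' + b' * u" "l' \<in> L" by (auto simp: J_def)
    have "x + y = (l + l') + (b + b') * u" by (simp add: lb(1) lb'(1) algebra_simps)
    then show "x + y \<in> J" using JI lb(2) lb'(2) L by (auto simp: left_ideal_def)
  qed
  moreover have "L \<subseteq> J" using JI[of _ 0] by auto
  moreover have "u \<in> J" using JI[of 0 1] L by (simp add: left_ideal_def)
  ultimately have "J = UNIV" using assms by (auto simp: maximal_left_ideal_def)
  then have "c \<in> J" by simp
  then obtain l b where "c = l + b * u" "l \<in> L" by (auto simp: J_def)
  then have "b * u - c \<in> L" using L left_ideal_diff[OF L, of 0 l] by (simp add: left_ideal_def)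
  then show ?thesis by (rule that)
qed

lemma semisimple_eq_0I:
  fixes u :: "'a::complex_banach_algebra_1"
  assumes "semisimple TYPE('a)" "\<And>L. maximal_left_ideal L \<Longrightarrow> u \<in> L"
  shows "u = 0"
  using assms by (auto simp: semisimple_def jacobson_radical_def)

lemma semisimple_left_invertible_eq_0I:
  fixes u :: "'a::complex_banach_algebra_1"
  assumes "semisimple TYPE('a)" "\<And>b. bi_invertible (1 - b * u)"
  shows "u = 0"
proof (rule semisimple_eq_0I[OF assms(1)], rule ccontr)
  fix L :: "'a set" assume L: "maximal_left_ideal L" and "u \<notin> L"
  then obtain b where b: "b * u - 1 \<in> L" by (rule maximal_left_ideal_generates)
  obtain y where "y * (1 - b * u) = 1" using assms(2)[of b] by (auto simp: bi_invertible_def)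
  then have "(- y) * (b * u - 1) = 1" by (simp add: algebra_simps)
  then have "1 \<in> L" using b L by (metis left_ideal_def maximal_left_ideal_def)
  then show False using L maximal_left_ideal_one by blast
qed

lemma bi_invertible_one_minus_swap:
  assumes "bi_invertible (1 - x * y)"
  shows "bi_invertible (1 - y * x)"
proof -
  obtain g where g: "(1 - x * y) * g = 1" "g * (1 - x * y) = 1"
    using assms by (auto simp: bi_invertible_def)
  have 1: "x * y * g = g - 1" "g * (x * y) = g - 1" using g by (simp_all add: algebra_simps)
  have "(1 - y * x) * (1 + y * g * x) = 1 - y * x + y * g * x - y * (x * y * g) * x"
    by (simp add: algebra_simps)
  also have "\<dots> = 1" unfolding 1 by (simp add: algebra_simps)
  finally have 2: "(1 - y * x) * (1 + y * g * x) = 1" .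
  have "(1 + y * g * x) * (1 - y * x) = 1 - y * x + y * g * x - y * (g * (x * y)) * x"
    by (simp add: algebra_simps)
  also have "\<dots> = 1" unfolding 1 by (simp add: algebra_simps)
  finally show ?thesis using 2 bi_invertibleI by blast
qed

lemma semisimple_quasinilpotent_eq_0I:
  fixes u :: "'a::complex_banach_algebra_1"
  assumes "semisimple TYPE('a)" "\<And>b. quasinilpotent (u * b)"
  shows "u = 0"
  by (rule semisimple_left_invertible_eq_0I[OF assms(1)])
    (rule bi_invertible_one_minus_swap[OF quasinilpotent_one_minus[OF assms(2)]])

lemma semiprime:
  fixes u :: "'a::complex_banach_algebra_1"
  assumes "semisimple TYPE('a)" "\<And>b. u * b * u = 0"
  shows "u = 0"
proof (rule semisimple_left_invertible_eq_0I[OF assms(1)])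
  fix b
  have "b * u * (b * u) = b * (u * b * u)" by (simp add: mult.assoc)
  then have "b * u * (b * u) = 0" using assms by simp
  then show "bi_invertible (1 - b * u)"
    by (intro bi_invertibleI[of "1 + b * u" _ "1 + b * u"]) (simp_all add: algebra_simps)
qed

text \<open>The corner \<open>f B f\<close> is one-dimensional. In this form minimality of
  \<open>B f\<close> enters below: \<open>u * w * f\<close> is a scalar multiple of \<open>f\<close>
  whenever \<open>f * u = u\<close>, so \<open>f B\<close> and \<open>B f\<close> are paired by
  scalars.\<close>

definition minimal_idempotent :: "'a::complex_banach_algebra_1 \<Rightarrow> bool" where
  "minimal_idempotent f \<longleftrightarrow> f * f = f \<and> f \<noteq> 0 \<and> (\<forall>b. \<exists>c. f * b * f = c *\<^sub>C f)"

text \<open>The weights are going to be eigenvalues, so they must be distinct, and small enough for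
  the weighted series to converge.\<close>

lemma exists_summable_coefficients:
  fixes b :: "nat \<Rightarrow> 'a::real_normed_vector"
  obtains t :: "nat \<Rightarrow> real" where "inj t" "\<And>n. t n > 0" "summable (\<lambda>n. norm (t n *\<^sub>R b n))"
proof -
  \<comment> \<open>The running sum makes \<open>s\<close> strictly increasing and at least
    \<open>2 ^ n * norm (b n)\<close>, however the norms behave.\<close>
  define s where "s = (\<lambda>n. 2 ^ n * (1 + (\<Sum>i\<le>n. norm (b i))))"
  have pos: "s n > 0" for n
    unfolding s_def by (intro mult_pos_pos add_pos_nonneg sum_nonneg) auto
  have "s n < s (Suc n)" for n
  proof -
    have "0 \<le> (\<Sum>i\<le>n. norm (b i))" by (intro sum_nonneg) auto
    then have "2 ^ n * (1 + (\<Sum>i\<le>n. norm (b i))) < 2 ^ Suc n * (1 + (\<Sum>i\<le>n. norm (b i)))" by simp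
    also have "\<dots> \<le> 2 ^ Suc n * (1 + (\<Sum>i\<le>Suc n. norm (b i)))" by (intro mult_left_mono) simp_all
    finally show ?thesis by (simp only: s_def)
  qed
  then have "strict_mono s" by (simp add: strict_mono_Suc_iff)
  then have "inj s" by (rule strict_mono_imp_inj_on)
  define t where "t = (\<lambda>n. inverse (s n))"
  have "inj t" using \<open>inj s\<close> by (auto simp: t_def inj_def)
  moreover have "t n > 0" for n using pos by (simp add: t_def)
  moreover have "summable (\<lambda>n. norm (t n *\<^sub>R b n))"
  proof (rule summable_comparison_test'[where N = 0])
    show "summable (\<lambda>n. (1/2::real) ^ n)" by (rule summable_geometric) simp
    fix n
    have "norm (b n) \<le> 1 + (\<Sum>i\<le>n. norm (b i))"
      using member_le_sum[of n "{..n}" "\<lambda>i. norm (b i)"] by simp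
    then have "norm (b n) * 2 ^ n \<le> s n" by (simp add: s_def mult.commute)
    then show "norm (norm (t n *\<^sub>R b n)) \<le> (1/2) ^ n"
      using pos[of n] by (simp add: t_def field_simps power_one_over)
  qed
  ultimately show ?thesis by (rule that)
qed

lemma scaleC_of_real_suminf_eigen:
  fixes v :: "nat \<Rightarrow> 'a::complex_banach_algebra_1"
  assumes s: "summable (\<lambda>n. t n *\<^sub>R v n)" and "\<And>n. n \<noteq> k \<Longrightarrow> v n * m = 0"
  shows "(\<Sum>n. t n *\<^sub>R v n) * m = t k *\<^sub>R (v k * m)"
proof -
  have "(\<Sum>n. t n *\<^sub>R v n) * m = (\<Sum>n. t n *\<^sub>R (v n * m))" using suminf_mult2[OF s, of m] by simp
  also have "\<dots> = (\<Sum>n\<in>{k}. t n *\<^sub>R (v n * m))" by (rule suminf_finite) (use assms in auto)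
  finally show ?thesis by simp
qed

text \<open>Since every \<open>r n\<close> has the left factor \<open>u\<close>, the series is
  formed from the \<open>b n\<close> and multiplied by \<open>u\<close> afterwards; so its sum stays
  in \<open>u B\<close> even if that right ideal is not closed. Each weight \<open>t k\<close> is an
  eigenvalue of it with eigenvector \<open>r k\<close>.\<close>

lemma no_infinite_orthogonal_idempotents:
  fixes u :: "'a::complex_banach_algebra_1" and r :: "nat \<Rightarrow> 'a"
  assumes fin: "\<And>b. finite (spectrum (u * b))"
    and idem: "\<And>n. r n * r n = r n" "\<And>n. r n \<noteq> 0" and orth: "\<And>m n. m \<noteq> n \<Longrightarrow> r m * r n = 0"
    and fac: "\<And>n. r n = u * b n"
  shows False
proof -
  obtain t where t: "inj t" "\<And>n. t n > 0" "summable (\<lambda>n. norm (t n *\<^sub>R b n))"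
    by (rule exists_summable_coefficients[of b]) blast
  have s: "summable (\<lambda>n. t n *\<^sub>R b n)" using t(3) by (rule summable_norm_cancel)
  define B where "B = (\<Sum>n. t n *\<^sub>R b n)"
  have uB: "u * B = (\<Sum>n. t n *\<^sub>R r n)"
    unfolding B_def using suminf_mult[OF s, of u] by (simp add: fac)
  have sr: "summable (\<lambda>n. t n *\<^sub>R r n)"
    using summable_mult[OF s, of u] by (simp add: fac)
  have "complex_of_real (t k) \<in> spectrum (u * B)" for k
  proof (rule eigenvalue_in_spectrum[OF _ idem(2)])
    show "u * B * r k = complex_of_real (t k) *\<^sub>C r k"
      unfolding uB using scaleC_of_real_suminf_eigen[OF sr, of k "r k"] orth idem
      by (simp add: scaleC_of_real)
  qed
  then have "range (\<lambda>k. complex_of_real (t k)) \<subseteq> spectrum (u * B)" by blast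
  moreover have "infinite (range (\<lambda>k. complex_of_real (t k)))"
    using t(1) by (intro range_inj_infinite) (auto simp: inj_def)
  ultimately show False using fin finite_subset by blast
qed

text \<open>If every nonzero idempotent below \<open>e\<close> had a smaller one below it, iteration
  would give a strictly descending chain, whose successive differences are infinitely many
  orthogonal idempotents in \<open>u B\<close>.\<close>

lemma exists_indecomposable_idempotent:
  fixes u e :: "'a::complex_banach_algebra_1"
  assumes fin: "\<And>b. finite (spectrum (u * b))"
    and e: "e * e = e" "e \<noteq> 0" "e = u * b0"
  obtains f where "f * f = f" "f \<noteq> 0" "e * f = f" "f * e = f"
    "\<And>p. p * p = p \<Longrightarrow> p \<noteq> 0 \<Longrightarrow> f * p = p \<Longrightarrow> p * f = p \<Longrightarrow> p = f"
proof -
  define I where "I = {p. p * p = p \<and> p \<noteq> 0 \<and> e * p = p \<and> p * e = p}"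
  define le where "le = (\<lambda>p f::'a. f * p = p \<and> p * f = p)"
  have le_trans: "le p q \<Longrightarrow> le q r \<Longrightarrow> le p r" for p q r
    unfolding le_def by (metis mult.assoc)
  have "\<exists>f\<in>I. \<forall>p\<in>I. le p f \<longrightarrow> p = f"
  proof (rule ccontr)
    assume "\<not> ?thesis"
    then have "\<forall>f\<in>I. \<exists>p\<in>I. le p f \<and> p \<noteq> f" by blast
    then obtain g where g: "\<And>f. f \<in> I \<Longrightarrow> g f \<in> I \<and> le (g f) f \<and> g f \<noteq> f" by metis
    define p where "p = (\<lambda>n. (g ^^ n) e)"
    have pI: "p n \<in> I" for n
    proof (induction n)
      case 0
      then show ?case using e by (simp add: p_def I_def)
    next
      case (Suc n)
      then show ?case using g by (simp add: p_def)
    qed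
    have le_p: "le (p m) (p n)" if "n \<le> m" for m n
      using that
    proof (induction m rule: dec_induct)
      case base
      then show ?case using pI[of n] by (simp add: le_def I_def)
    next
      case (step m)
      then show ?case using g[OF pI[of m]] le_trans[of "g (p m)" "p m" "p n"] by (simp add: p_def)
    qed
    define r where "r = (\<lambda>n. p n - p (Suc n))"
    have pr: "p m * r n = r n" "r n * p m = r n" if "m \<le> n" for m n
      using le_p[of m n] le_p[of m "Suc n"] that
      by (simp_all add: r_def le_def left_diff_distrib right_diff_distrib)
    have pr': "p (Suc n) * r n = 0" "r n * p (Suc n) = 0" for n
      using le_p[of n "Suc n"] pI[of "Suc n"]
      by (simp_all add: r_def le_def I_def left_diff_distrib right_diff_distrib)
    have "r n * r n = r n" for n
      using pr[of n n] pr'[of n] by (simp add: r_def left_diff_distrib)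
    moreover have "r n \<noteq> 0" for n using g[OF pI[of n]] by (auto simp: r_def p_def)
    moreover have "r m * r n = 0" if "m \<noteq> n" for m n
    proof (cases "m < n")
      case True
      then show ?thesis using pr[of m n] pr[of "Suc m" n] by (simp add: r_def[of] left_diff_distrib)
    next
      case False
      then have "n < m" using that by simp
      then show ?thesis using pr[of n m] pr[of "Suc n" m] by (simp add: r_def right_diff_distrib)
    qed
    moreover have "r n = u * (b0 * r n)" for n
      using pI[of n] pI[of "Suc n"] by (simp add: r_def I_def right_diff_distrib e(3) mult.assoc)
    ultimately show False by (rule no_infinite_orthogonal_idempotents[OF fin])
  qed
  then obtain f where f: "f \<in> I" "\<And>p. p \<in> I \<Longrightarrow> le p f \<Longrightarrow> p = f" by blast
  show ?thesis
  proof (rule that[of f])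
    show "p = f" if "p * p = p" "p \<noteq> 0" "f * p = p" "p * f = p" for p
    proof (rule f(2))
      have "e * p = e * f * p" "p * e = p * (f * e)" using that by (simp_all add: mult.assoc)
        (simp flip: mult.assoc)
      then show "p \<in> I" using f(1) that by (auto simp: I_def)
    qed (use that in \<open>simp add: le_def\<close>)
  qed (use f(1) in \<open>simp_all add: I_def\<close>)
qed

text \<open>
  If \<open>n = fn = nf\<close> is quasinilpotent, then so is every \<open>nbf\<close>: otherwise \<open>nbf\<close>, and hence \<open>n\<close>, would
  be right invertible in the corner \<open>fBf\<close>, forcing \<open>f = 0\<close>. So \<open>n\<close> lies in the radical.
\<close>

lemma minimal_idempotent_of_indecomposable:
  fixes f :: "'a::complex_banach_algebra_1"
  assumes ss: "semisimple TYPE('a)" and f: "f * f = f" "f \<noteq> 0"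
    and fin: "\<And>b. finite (spectrum (f * b * f))"
    and indec: "\<And>p. p * p = p \<Longrightarrow> p \<noteq> 0 \<Longrightarrow> f * p = p \<Longrightarrow> p * f = p \<Longrightarrow> p = f"
  shows "minimal_idempotent f"
proof -
  \<comment> \<open>A nonzero spectral value \<open>c\<close> of \<open>y\<close> has its spectral
    idempotent inside \<open>f B f\<close>, where it must be \<open>f\<close> itself; so
    \<open>y\<close> is \<open>c *\<^sub>C f\<close> up to a quasinilpotent element.\<close>
  have qn: "\<exists>c. quasinilpotent (y - c *\<^sub>C f)" if y: "f * y = y" "y * f = y" for y
  proof (cases "spectrum y \<subseteq> {0}")
    case True
    then show ?thesis by (intro exI[of _ 0]) (simp add: quasinilpotent_of_spectrum)
  next
    case False
    then obtain c where c: "c \<in> spectrum y" "c \<noteq> 0" by blast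
    have "finite (spectrum y)" using fin[of y] y by simp
    then obtain e r s where e: "e * e = e" "e \<noteq> 0" "e = y * r" "e = r * y"
      and q: "quasinilpotent ((y - c *\<^sub>C 1) * e)"
      using spectral_idempotent[OF _ c] by metis
    have "f * e = e" using y(1) by (simp add: e(3) flip: mult.assoc)
    moreover have "e * f = e" using y(2) by (simp add: e(4) mult.assoc)
    ultimately have "e = f" using indec e by blast
    then have "(y - c *\<^sub>C 1) * e = y - c *\<^sub>C f" using y by (simp add: left_diff_distrib mult_scaleC_left)
    then show ?thesis using q by metis
  qed
  have zero: "n = 0" if n: "quasinilpotent n" "f * n = n" "n * f = n" for n
  proof (rule semisimple_left_invertible_eq_0I[OF ss])
    fix b
    define y where "y = n * b * f"
    have y: "f * y = y" "y * f = y" using n f by (simp_all add: y_def mult.assoc) (simp flip: mult.assoc)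
    obtain c where c: "quasinilpotent (y - c *\<^sub>C f)" using qn[OF y] by blast
    have "c = 0"
    proof (rule ccontr)
      assume "c \<noteq> 0"
      define m where "m = y - c *\<^sub>C f"
      have m: "f * m = m" "m * f = m"
        using y f by (simp_all add: m_def algebra_simps scaleC_mult_simps)
      obtain k where k: "(m + c *\<^sub>C 1) * k = 1" "k * (m + c *\<^sub>C 1) = 1"
        using quasinilpotent_plus_scalar[OF c \<open>c \<noteq> 0\<close>] by (auto simp: m_def bi_invertible_def)
      have fk: "f * k = k * f"
        by (rule inverse_commutes[OF k]) (simp add: m algebra_simps scaleC_mult_simps)
      have "(m + c *\<^sub>C 1) * f = y" using m by (simp add: m_def distrib_right mult_scaleC_left)
      then have "y * k = (m + c *\<^sub>C 1) * (f * k)" by (simp flip: mult.assoc)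
      also have "\<dots> = f" using k(1) by (simp add: fk flip: mult.assoc)
      finally have yk: "y * k = f" .
      \<comment> \<open>The left factor \<open>f\<close> gives \<open>f * r = r\<close>, so that the
        products \<open>n ^ Suc j * r ^ Suc j\<close> collapse to \<open>f\<close> one factor at a
        time.\<close>
      define r where "r = f * (b * f * k)"
      have nr: "n * r = f"
      proof -
        have "n * r = (n * f) * (b * f * k)" by (simp add: r_def mult.assoc)
        also have "\<dots> = y * k" by (simp add: n(3) y_def mult.assoc)
        finally show ?thesis by (simp add: yk)
      qed
      have fr: "f * r = r" using f by (simp add: r_def flip: mult.assoc)
      have "n ^ Suc j * r ^ Suc j = f" for j
      proof (induction j)
        case (Suc j)
        have "n ^ Suc (Suc j) * r ^ Suc (Suc j) = n ^ Suc j * (n * r) * (r * r ^ j)"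
          by (simp only: power_Suc2[of n "Suc j"] power_Suc[of r "Suc j"] mult.assoc power_Suc[of r j])
        also have "\<dots> = n ^ Suc j * ((f * r) * r ^ j)" by (simp only: nr mult.assoc)
        finally show ?case using Suc fr by simp
      qed (simp add: nr)
      then show False using quasinilpotent_right_inverse_powers[OF n(1)] f by blast
    qed
    then have "quasinilpotent (n * (b * f))" using c by (simp add: y_def mult.assoc)
    then have "bi_invertible (1 - (b * f) * n)"
      by (rule bi_invertible_one_minus_swap[OF quasinilpotent_one_minus])
    then show "bi_invertible (1 - b * n)" using n by (simp add: mult.assoc)
  qed
  have "\<exists>c. f * b * f = c *\<^sub>C f" for b
  proof -
    define y where "y = f * b * f"
    have y: "f * y = y" "y * f = y" using f by (simp_all add: y_def mult.assoc) (simp flip: mult.assoc)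
    obtain c where c: "quasinilpotent (y - c *\<^sub>C f)" using qn[OF y] by blast
    have "y - c *\<^sub>C f = 0"
      using y f by (intro zero c) (simp_all add: algebra_simps scaleC_mult_simps)
    then show ?thesis by (auto simp: y_def)
  qed
  then show ?thesis using f by (simp add: minimal_idempotent_def)
qed

text \<open>By semisimplicity some element of \<open>u B\<close> has a nonzero spectral value. Its
  spectral idempotent lies in \<open>u B\<close>, and so does every idempotent below it, whose
  corner therefore consists of elements with finite spectrum.\<close>

lemma exists_minimal_idempotent:
  fixes u :: "'a::complex_banach_algebra_1"
  assumes ss: "semisimple TYPE('a)" and "u \<noteq> 0" and fin: "\<And>b. finite (spectrum (u * b))"
  obtains f b where "minimal_idempotent f" "f = u * b"
proof -
  obtain b c where c: "c \<in> spectrum (u * b)" "c \<noteq> 0"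
    using semisimple_quasinilpotent_eq_0I[OF ss quasinilpotent_of_spectrum, of u] \<open>u \<noteq> 0\<close> by blast
  obtain e r where e: "e * e = e" "e \<noteq> 0" "e = u * b * r"
    using spectral_idempotent[OF fin c] by metis
  obtain f where f: "f * f = f" "f \<noteq> 0" "e * f = f" "f * e = f"
    "\<And>p. p * p = p \<Longrightarrow> p \<noteq> 0 \<Longrightarrow> f * p = p \<Longrightarrow> p * f = p \<Longrightarrow> p = f"
    using exists_indecomposable_idempotent[OF fin e(1,2) e(3)[unfolded mult.assoc]] by metis
  have fu: "f = u * (b * r * f)" using f(3) by (simp add: e(3) mult.assoc)
  have "finite (spectrum (f * a * f))" for a
    using fin[of "b * r * f * a * f"] fu by (metis mult.assoc)
  then have "minimal_idempotent f"
    using f by (intro minimal_idempotent_of_indecomposable[OF ss]) auto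
  then show ?thesis using fu by (rule that)
qed

section \<open>The annihilator of the socle\<close>

text \<open>The ideal \<open>A\<close> of the overview. The middle factor \<open>b\<close> makes it
  closed under multiplication from the right.\<close>

definition soc_annihilator :: "'a::complex_banach_algebra_1 set" where
  "soc_annihilator = {x. \<forall>f b. minimal_idempotent f \<longrightarrow> x * b * f = 0}"

lemma soc_annihilator_mult:
  "x \<in> soc_annihilator \<Longrightarrow> b * x \<in> soc_annihilator"
  "x \<in> soc_annihilator \<Longrightarrow> x * b \<in> soc_annihilator"
proof -
  assume x: "x \<in> soc_annihilator"
  then show "b * x \<in> soc_annihilator" by (simp add: soc_annihilator_def mult.assoc)
  have "x * b * a * f = x * (b * a) * f" for a f by (simp add: mult.assoc)
  then show "x * b \<in> soc_annihilator" using x by (simp add: soc_annihilator_def)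
qed

lemma soc_annihilator_add:
  "x \<in> soc_annihilator \<Longrightarrow> y \<in> soc_annihilator \<Longrightarrow> x + y \<in> soc_annihilator"
  "x \<in> soc_annihilator \<Longrightarrow> y \<in> soc_annihilator \<Longrightarrow> x - y \<in> soc_annihilator"
  "x \<in> soc_annihilator \<Longrightarrow> - x \<in> soc_annihilator"
  "x \<in> soc_annihilator \<Longrightarrow> c *\<^sub>C x \<in> soc_annihilator"
  by (auto simp: soc_annihilator_def algebra_simps mult_scaleC_left)

lemma minimal_idempotent_notin_soc_annihilator:
  "minimal_idempotent f \<Longrightarrow> f \<notin> soc_annihilator"
  by (force simp: soc_annihilator_def minimal_idempotent_def dest: spec[of _ f] spec[of _ 1])

section \<open>Derivations with finite spectra\<close>

locale finite_spectrum_derivation =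
  fixes d :: "'a::complex_banach_algebra_1 \<Rightarrow> 'a"
  assumes semisimple: "semisimple TYPE('a)"
    and derivation: "derivation d"
    and finite_spectrum: "\<And>x. finite (spectrum (d x))"
begin

lemma d_add: "d (x + y) = d x + d y" and d_scaleC: "d (c *\<^sub>C x) = c *\<^sub>C d x"
  using derivation unfolding derivation_def Vector_Spaces.linear_def
  by (auto simp: module_hom.add module_hom.scale)

lemma d_mult: "d (x * y) = d x * y + x * d y"
  using derivation by (simp add: derivation_def)

lemma d_0 [simp]: "d 0 = 0" and d_1 [simp]: "d 1 = 0"
  using d_add[of 0 0] d_mult[of 1 1] by auto

lemma d_diff: "d (x - y) = d x - d y"
  using d_add[of "x - y" y] by simp

text \<open>
  For \<open>T = d (z b w)\<close> and \<open>y = d w z b\<close> the relation \<open>w z = 0\<close> gives \<open>T z b = z b y\<close> and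
  \<open>w T = - y w\<close>, so that a resolvent of \<open>T\<close> yields one-sided inverses of \<open>y \<plusminus> k\<close>.
\<close>

lemma finite_spectrum_zero_product:
  assumes "w * z = 0"
  shows "finite (spectrum (d w * z * b))"
proof -
  define v where "v = z * b"
  define y where "y = d w * v"
  define T where "T = d (v * w)"
  have wv: "w * v = 0" using assms by (simp add: v_def flip: mult.assoc)
  have "d w * v + w * d v = 0" using d_mult[of w v] wv by simp
  then have wdv: "w * d v = - y" by (simp add: y_def add_eq_0_iff)
  have T: "T = d v * w + v * d w" by (simp add: T_def d_mult)
  have Tv: "T * v = v * y" using wv by (simp add: T y_def distrib_right mult.assoc)
  have wT: "w * T = - (y * w)"
    using wv wdv by (simp add: T distrib_left flip: mult.assoc)
  have "k \<in> {0} \<union> spectrum T \<union> uminus ` spectrum T" if k: "k \<in> spectrum y" for k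
  proof (rule ccontr)
    assume nk: "k \<notin> {0} \<union> spectrum T \<union> uminus ` spectrum T"
    then have "k \<noteq> 0" "k \<notin> spectrum T" "- k \<notin> spectrum T" by force+
    then obtain R R' where R: "R * (T - k *\<^sub>C 1) = 1" and R': "(T + k *\<^sub>C 1) * R' = 1"
      by (auto simp: spectrum_def)
    have "(T - k *\<^sub>C 1) * v = v * (y - k *\<^sub>C 1)"
      using Tv by (simp add: algebra_simps scaleC_mult_simps)
    then have "R * v * (y - k *\<^sub>C 1) = v"
      using R by (metis mult.assoc mult_1_left)
    then have "(d w * R * v) * (y - k *\<^sub>C 1) = y" by (simp add: y_def mult.assoc)
    then have "(d w * R * v - 1) * (y - k *\<^sub>C 1) = k *\<^sub>C 1" by (simp add: algebra_simps)
    then have l: "(inverse k *\<^sub>C (d w * R * v - 1)) * (y - k *\<^sub>C 1) = 1"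
      using \<open>k \<noteq> 0\<close> by (simp add: scaleC_mult_simps)
    have "w * (T + k *\<^sub>C 1) = - ((y - k *\<^sub>C 1) * w)"
      using wT by (simp add: algebra_simps scaleC_mult_simps)
    then have "w = - ((y - k *\<^sub>C 1) * w) * R'"
      using R' by (metis mult.assoc mult_1_right)
    then have "w * d v = - ((y - k *\<^sub>C 1) * w) * R' * d v" by metis
    then have "y = (y - k *\<^sub>C 1) * (w * R' * d v)" using wdv by (simp add: mult.assoc)
    then have "(y - k *\<^sub>C 1) * (w * R' * d v - 1) = k *\<^sub>C 1" by (simp add: algebra_simps)
    then have r: "(y - k *\<^sub>C 1) * (inverse k *\<^sub>C (w * R' * d v - 1)) = 1"
      using \<open>k \<noteq> 0\<close> by (simp add: scaleC_mult_simps)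
    show False using k bi_invertibleI[OF l r] by (simp add: spectrum_iff)
  qed
  moreover have "finite ({0} \<union> spectrum T \<union> uminus ` spectrum T)"
    using finite_spectrum by (simp add: T_def)
  ultimately have "finite (spectrum y)" by (meson finite_subset subsetI)
  then show ?thesis by (simp add: y_def v_def mult.assoc)
qed

text \<open>Since \<open>b * f = b * f * f\<close>, the derivative of \<open>b * f\<close> lies in
  \<open>B f + B f B\<close>, which \<open>x\<close> annihilates.\<close>

lemma d_soc_annihilator:
  assumes "x \<in> soc_annihilator"
  shows "d x \<in> soc_annihilator"
  unfolding soc_annihilator_def
proof (intro CollectI allI impI)
  fix f b :: 'a assume f: "minimal_idempotent f"
  then have ff: "f * f = f" by (simp add: minimal_idempotent_def)
  have z: "x * b * f = 0" for b using assms f by (simp add: soc_annihilator_def)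
  have "d (b * f) = d (b * f) * f + b * f * d f"
    using d_mult[of "b * f" f] ff by (simp add: mult.assoc)
  then have "x * d (b * f) = x * d (b * f) * f + x * b * f * d f"
    by (metis distrib_left mult.assoc)
  then have "x * d (b * f) = 0" using z by simp
  moreover have "d (x * (b * f)) = d x * (b * f) + x * d (b * f)" by (rule d_mult)
  ultimately show "d x * b * f = 0" using z[of b] by (simp add: mult.assoc)
qed

text \<open>If nonzero, \<open>d w * z\<close> would generate a right ideal of elements with finite
  spectrum, hence one containing a minimal idempotent; the annihilator of the socle has
  none.\<close>

lemma zero_product_soc_annihilator:
  assumes "w * z = 0" "d w * z \<in> soc_annihilator"
  shows "d w * z = 0"
proof (rule ccontr)
  assume "d w * z \<noteq> 0"
  then obtain f b where f: "minimal_idempotent f" "f = d w * z * b"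
    using exists_minimal_idempotent[OF semisimple _ finite_spectrum_zero_product[OF assms(1)]] by metis
  then show False
    using soc_annihilator_mult(2)[OF assms(2), of b] minimal_idempotent_notin_soc_annihilator by auto
qed

text \<open>The zero products \<open>(1 - e) * e\<close> and \<open>e * (1 - e)\<close> yield
  \<open>d e * e = 0\<close> and \<open>d e * (1 - e) = 0\<close>.\<close>

lemma d_idempotent_eq_0:
  assumes e: "e * e = e" "e \<in> soc_annihilator"
  shows "d e = 0"
proof -
  have de: "d e \<in> soc_annihilator" by (rule d_soc_annihilator[OF e(2)])
  have "d (1 - e) * e = 0"
    using e de by (intro zero_product_soc_annihilator)
      (auto simp: d_diff left_diff_distrib intro: soc_annihilator_add soc_annihilator_mult)
  moreover have "d e * (1 - e) = 0"
    using e de by (intro zero_product_soc_annihilator)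
      (auto simp: right_diff_distrib intro: soc_annihilator_add soc_annihilator_mult)
  ultimately show ?thesis by (simp add: d_diff algebra_simps)
qed

text \<open>Adding an element of an off-diagonal corner to \<open>e\<close> gives another idempotent
  of the annihilator, so \<open>d\<close> vanishes on both corners and on their products.
  Consequently \<open>e * d j = 0\<close> and \<open>d j * e = 0\<close> for
  \<open>j = a * (1 - e) * b\<close>. Since \<open>x * j\<close> and \<open>j * x\<close> have the
  same shape, the product rule isolates \<open>d x\<close>, and semiprimeness removes the remaining
  factors.\<close>

lemma idempotent_corners:
  assumes e: "e * e = e" "e \<in> soc_annihilator"
  shows "e * d x * a * (1 - e) = 0" "(1 - e) * a * d x * e = 0"
proof -
  have de: "d e = 0" by (rule d_idempotent_eq_0[OF e])
  have e1: "e * (1 - e) = 0" "(1 - e) * e = 0" using e by (simp_all add: algebra_simps)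
  have ee: "e * (e * a) = e * a" for a using e by (simp flip: mult.assoc)
  have e1a: "e * ((1 - e) * a) = 0" "(1 - e) * (e * a) = 0" for a
    using e1 by (simp_all flip: mult.assoc)
  have dp: "d (e * x * (1 - e)) = 0" for x
  proof -
    have "d (e + e * x * (1 - e)) = 0"
    proof (rule d_idempotent_eq_0)
      show "(e + e * x * (1 - e)) * (e + e * x * (1 - e)) = e + e * x * (1 - e)"
        using e e1 e1a ee by (simp add: distrib_left distrib_right mult.assoc)
      show "e + e * x * (1 - e) \<in> soc_annihilator"
        using e by (simp add: soc_annihilator_add soc_annihilator_mult mult.assoc)
    qed
    then show ?thesis using de by (simp add: d_add)
  qed
  have dq: "d ((1 - e) * x * e) = 0" for x
  proof -
    have "d (e + (1 - e) * x * e) = 0"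
    proof (rule d_idempotent_eq_0)
      show "(e + (1 - e) * x * e) * (e + (1 - e) * x * e) = e + (1 - e) * x * e"
        using e e1 e1a ee by (simp add: distrib_left distrib_right mult.assoc)
      show "e + (1 - e) * x * e \<in> soc_annihilator"
        using e by (simp add: soc_annihilator_add soc_annihilator_mult)
    qed
    then show ?thesis using de by (simp add: d_add)
  qed
  have c: "e * d x * (1 - e) = 0" "(1 - e) * d x * e = 0" for x
    using dp[of x] dq[of x] de by (simp_all add: d_mult d_diff)
  have edx: "e * d x = e * d x * e" "d x * e = e * d x * e" for x
    using c[of x]
    by (simp_all only: left_diff_distrib right_diff_distrib mult_1_left mult_1_right right_minus_eq)
  have corner: "e * d (a * (1 - e) * b) * e = 0" for a b
  proof -
    have z: "d (e * a * (1 - e) * ((1 - e) * b * e)) = 0"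
      using dp[of a] dq[of b] d_mult[of "e * a * (1 - e)" "(1 - e) * b * e"] by simp
    have "(1 - e) * (1 - e) = 1 - e" using e1 by (simp add: right_diff_distrib)
    then have "e * a * (1 - e) * ((1 - e) * b * e) = e * (a * (1 - e) * b) * e"
      by (metis mult.assoc)
    moreover have "d (e * y * e) = e * d y * e" for y using de by (simp add: d_mult)
    ultimately have "d (e * a * (1 - e) * ((1 - e) * b * e)) = e * d (a * (1 - e) * b) * e"
      by metis
    with z show ?thesis by simp
  qed
  have corner': "e * d (a * (1 - e) * b) = 0" "d (a * (1 - e) * b) * e = 0" for a b
    using edx[of "a * (1 - e) * b"] corner[of a b] by metis+
  have one: "e * d x * a * (1 - e) * b * e = 0" for x a b
  proof -
    define j where "j = a * (1 - e) * b"
    have "x * j = x * a * (1 - e) * b" by (simp add: j_def mult.assoc)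
    then have "d (x * j) * e = 0" using corner'(2)[of "x * a" b] by simp
    then have "d x * j * e + x * (d j * e) = 0" by (simp add: d_mult distrib_right mult.assoc)
    then have "d x * j * e = 0" using corner'(2)[of a b] by (simp add: j_def)
    then have "e * (d x * j * e) = 0" by simp
    then show ?thesis by (simp add: j_def mult.assoc)
  qed
  have two: "e * b * (1 - e) * a * d x * e = 0" for x a b
  proof -
    define j where "j = b * (1 - e) * a"
    have "j * x = b * (1 - e) * (a * x)" by (simp add: j_def mult.assoc)
    then have "e * d (j * x) = 0" using corner'(1)[of b "a * x"] by simp
    then have "(e * d j) * x + e * j * d x = 0" by (simp add: d_mult distrib_left mult.assoc)
    then have "e * j * d x = 0" using corner'(1)[of b a] by (simp add: j_def)
    then have "(e * j * d x) * e = 0" by simp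
    then show ?thesis by (simp add: j_def mult.assoc)
  qed
  show "e * d x * a * (1 - e) = 0"
  proof (rule semiprime[OF semisimple])
    fix b
    have "e * d x * a * (1 - e) * b * (e * d x * a * (1 - e))
        = (e * d x * a * (1 - e) * b * e) * (d x * a * (1 - e))" by (simp add: mult.assoc)
    then show "e * d x * a * (1 - e) * b * (e * d x * a * (1 - e)) = 0" using one by simp
  qed
  show "(1 - e) * a * d x * e = 0"
  proof (rule semiprime[OF semisimple])
    fix b
    have "(1 - e) * a * d x * e * b * ((1 - e) * a * d x * e)
        = (1 - e) * a * d x * (e * b * (1 - e) * a * d x * e)" by (simp add: mult.assoc)
    then show "(1 - e) * a * d x * e * b * ((1 - e) * a * d x * e) = 0" using two by simp
  qed
qed

text \<open>As \<open>e\<close> is a multiple of \<open>d x\<close> from either side, the corner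
  identities for \<open>d x\<close> become \<open>e * a * (1 - e) = 0\<close> and
  \<open>(1 - e) * a * e = 0\<close>.\<close>

lemma central_spectral_idempotent:
  assumes x: "x \<in> soc_annihilator" and c: "c \<in> spectrum (d x)" "c \<noteq> 0"
  obtains e r s where "e * e = e" "e = d x * r" "e = r * d x"
    "1 - e = s * (d x - c *\<^sub>C 1)" "quasinilpotent ((d x - c *\<^sub>C 1) * e)"
    "e \<in> soc_annihilator" "\<And>a. e * a = a * e" "d e = 0"
proof -
  obtain e r s where e: "e * e = e" "e = d x * r" "e = r * d x"
    and s: "1 - e = s * (d x - c *\<^sub>C 1)" "quasinilpotent ((d x - c *\<^sub>C 1) * e)"
    using spectral_idempotent[OF finite_spectrum c] by metis
  have eA: "e \<in> soc_annihilator"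
    unfolding e(2) by (intro soc_annihilator_mult d_soc_annihilator x)
  have "e * a = a * e" for a
  proof -
    have "e * d x * (r * a) * (1 - e) = 0" by (rule idempotent_corners[OF e(1) eA])
    then have "e * (d x * r) * a * (1 - e) = 0" by (simp add: mult.assoc)
    then have "e * a * (1 - e) = 0" by (simp only: e(2)[symmetric] e(1))
    moreover have "(1 - e) * (a * r) * d x * e = 0" by (rule idempotent_corners[OF e(1) eA])
    then have "(1 - e) * a * ((r * d x) * e) = 0" by (simp add: mult.assoc)
    then have "(1 - e) * a * e = 0" by (simp only: e(3)[symmetric] e(1))
    ultimately have "e * a = e * a * e" "a * e = e * a * e"
      by (simp_all only: left_diff_distrib right_diff_distrib mult_1_left mult_1_right right_minus_eq)
    then show ?thesis by simp
  qed
  then show ?thesis using that[of e r s] e s eA d_idempotent_eq_0[OF e(1) eA] by blast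
qed

end

section \<open>Derivations act trivially off the socle\<close>

text \<open>
  An element \<open>m\<close> stands for its class in the simple module \<open>B/L\<close>. Linear independence over the
  division algebra of endomorphisms of \<open>B/L\<close> is expressed by annihilators.
\<close>

locale finite_spectrum_derivation_on_module = finite_spectrum_derivation d
  for d :: "'a::complex_banach_algebra_1 \<Rightarrow> 'a" +
  fixes L :: "'a set"
  assumes maximal: "maximal_left_ideal L"
begin

lemma L_0: "0 \<in> L" and L_add: "x \<in> L \<Longrightarrow> y \<in> L \<Longrightarrow> x + y \<in> L" and L_mult: "x \<in> L \<Longrightarrow> a * x \<in> L"
  and L_diff: "x \<in> L \<Longrightarrow> y \<in> L \<Longrightarrow> x - y \<in> L"
  using maximal left_ideal_diff[of L] by (auto simp: maximal_left_ideal_def left_ideal_def)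

lemma L_minus: "x \<in> L \<Longrightarrow> - x \<in> L"
  using L_diff[OF L_0] by simp

lemma L_scaleC: "x \<in> L \<Longrightarrow> c *\<^sub>C x \<in> L"
  using L_mult[of x "c *\<^sub>C 1"] by (simp add: scaleC_mult_simps)

lemma L_generates: "m \<notin> L \<Longrightarrow> \<exists>b. b * m - t \<in> L"
  using maximal_left_ideal_generates[OF maximal] by metis

text \<open>Schur's lemma: sending the class of \<open>b * n\<close> to that of \<open>b * m\<close>
  is a well-defined nonzero endomorphism of \<open>B/L\<close>, hence injective.\<close>

lemma annihilator_swap:
  assumes "m \<notin> L" "\<And>b. b * n \<in> L \<Longrightarrow> b * m \<in> L" "c * m \<in> L"
  shows "c * n \<in> L"
proof (rule ccontr)
  assume "c * n \<notin> L"
  then obtain b where b: "b * (c * n) - n \<in> L" using L_generates by blast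
  have "(1 - b * c) * n \<in> L" using L_minus[OF b] by (simp add: algebra_simps)
  then have "(1 - b * c) * m \<in> L" by (rule assms(2))
  moreover have "m = (1 - b * c) * m + b * (c * m)" by (simp add: algebra_simps)
  ultimately have "m \<in> L" using L_add L_mult[OF assms(3)] by metis
  then show False using assms(1) by contradiction
qed

definition indep :: "'a \<Rightarrow> 'a \<Rightarrow> bool" where
  "indep m n \<longleftrightarrow> m \<notin> L \<and> (\<exists>c. c * m \<in> L \<and> c * n \<notin> L)"

lemma indep_sym: "indep m n \<Longrightarrow> indep n m"
  unfolding indep_def by (metis L_mult annihilator_swap)

lemma annihilator_acts:
  assumes "\<not> soc_annihilator \<subseteq> L" "m \<notin> L"
  shows "\<exists>a\<in>soc_annihilator. a * m - t \<in> L"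
proof -
  obtain a where a: "a \<in> soc_annihilator" "a \<notin> L" using assms by blast
  obtain b where b: "b * m - 1 \<in> L" using L_generates[OF assms(2)] by blast
  have "a * (b * m) \<notin> L"
  proof
    assume "a * (b * m) \<in> L"
    moreover have "a = a * (b * m) - a * (b * m - 1)" by (simp add: algebra_simps)
    ultimately show False using a L_diff L_mult[OF b] by metis
  qed
  then obtain c where "c * (a * (b * m)) - t \<in> L" using L_generates by blast
  then show ?thesis
    using a by (intro bexI[of _ "c * (a * b)"]) (simp_all add: mult.assoc soc_annihilator_mult)
qed

text \<open>Jacobson density for two vectors, with the interpolating element taken inside the ideal
  \<open>soc_annihilator\<close>.\<close>

lemma annihilator_interpolates:
  assumes nt: "\<not> soc_annihilator \<subseteq> L" and "indep m n"
  shows "\<exists>c\<in>soc_annihilator. c * m - s \<in> L \<and> c * n - t \<in> L"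
proof -
  have *: "\<exists>c\<in>soc_annihilator. c * m \<in> L \<and> c * n - t \<in> L" if ind: "indep m n" for m n t
  proof -
    obtain c where c: "c * m \<in> L" "c * n \<notin> L" using ind by (auto simp: indep_def)
    obtain a where "a \<in> soc_annihilator" "a * (c * n) - t \<in> L" using annihilator_acts[OF nt c(2)] by blast
    then show ?thesis using L_mult[OF c(1), of a]
      by (intro bexI[of _ "a * c"]) (auto simp: mult.assoc intro!: soc_annihilator_mult)
  qed
  obtain a where a: "a \<in> soc_annihilator" "a * m \<in> L" "a * n - t \<in> L"
    using *[OF assms(2)] by blast
  obtain b where b: "b \<in> soc_annihilator" "b * n \<in> L" "b * m - s \<in> L"
    using *[OF indep_sym[OF assms(2)]] by blast
  have "(a + b) * m - s \<in> L" "(a + b) * n - t \<in> L"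
    using L_add[OF a(2) b(3)] L_add[OF a(3) b(2)] by (simp_all add: algebra_simps)
  then show ?thesis using a(1) b(1) soc_annihilator_add(1) by blast
qed

text \<open>The spectral idempotent \<open>e\<close> of \<open>k\<close> is central, so it acts on
  the simple module as 0 or 1, and because of \<open>m\<close> as 1. But
  \<open>d x - k *\<^sub>C 1\<close> is quasinilpotent after multiplication by \<open>e\<close>,
  which excludes any eigenvalue \<open>l\<close> other than \<open>k\<close>.\<close>

lemma no_two_eigenvalues:
  assumes x: "x \<in> soc_annihilator" and m: "m \<notin> L" "d x * m - k *\<^sub>C m \<in> L" "k \<noteq> 0"
    and n: "n \<notin> L" "d x * n - l *\<^sub>C n \<in> L"
  shows "k = l"
proof (rule ccontr)
  assume "k \<noteq> l"
  have "k \<in> spectrum (d x)"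
  proof (rule ccontr)
    assume "k \<notin> spectrum (d x)"
    then obtain y where y: "y * (d x - k *\<^sub>C 1) = 1" by (auto simp: spectrum_def)
    have "y * (d x * m - k *\<^sub>C m) = y * (d x - k *\<^sub>C 1) * m" by (simp add: algebra_simps scaleC_mult_simps)
    then have "m \<in> L" using y L_mult[OF m(2), of y] by simp
    then show False using m(1) by contradiction
  qed
  then obtain e s where e: "e * e = e" "1 - e = s * (d x - k *\<^sub>C 1)"
    "quasinilpotent ((d x - k *\<^sub>C 1) * e)" "\<And>a. e * a = a * e"
    using central_spectral_idempotent[OF x _ m(3)] by metis
  have "(1 - e) * m = s * (d x * m - k *\<^sub>C m)" unfolding e(2) by (simp add: algebra_simps scaleC_mult_simps)
  then have 1: "(1 - e) * m \<in> L" using L_mult[OF m(2)] by simp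
  define q where "q = (d x - k *\<^sub>C 1) * e"
  have qe: "q * e = q" unfolding q_def mult.assoc e(1) ..
  obtain g where g: "g * (q + (k - l) *\<^sub>C 1) = 1"
    using quasinilpotent_plus_scalar[OF e(3), of "k - l"] \<open>k \<noteq> l\<close> unfolding q_def bi_invertible_def by auto
  have "(q + (k - l) *\<^sub>C 1) * (e * n) = (q * e) * n + (k - l) *\<^sub>C (e * n)"
    by (simp add: distrib_right mult.assoc mult_scaleC_left)
  also have "\<dots> = d x * (e * n) - l *\<^sub>C (e * n)"
    unfolding qe by (simp add: q_def left_diff_distrib mult.assoc mult_scaleC_left cvs.scale_left_diff_distrib)
  also have "\<dots> = e * (d x * n - l *\<^sub>C n)"
  proof -
    have "d x * (e * n) = e * (d x * n)" using e(4)[of "d x"] by (simp flip: mult.assoc)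
    then show ?thesis by (simp add: right_diff_distrib mult_scaleC_right)
  qed
  finally have "g * ((q + (k - l) *\<^sub>C 1) * (e * n)) \<in> L" using L_mult[OF L_mult[OF n(2)]] by simp
  then have en: "e * n \<in> L" using g by (simp flip: mult.assoc)
  obtain b where b: "b * n - m \<in> L" using L_generates[OF n(1)] by blast
  have "e * (b * n) = b * (e * n)" using e(4)[of b] by (simp flip: mult.assoc)
  then have "m = (1 - e) * m + b * (e * n) - e * (b * n - m)" by (simp add: algebra_simps)
  then have "m \<in> L" using 1 L_mult[OF en, of b] L_mult[OF b, of e] L_add L_diff by metis
  then show False using m(1) by contradiction
qed

lemma not_eigenvalues_1_0:
  assumes "x \<in> soc_annihilator" "m \<notin> L" "d x * m - m \<in> L" "d x * n \<in> L"
  shows "n \<in> L"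
  using no_two_eigenvalues[of x m 1 n 0] assms by (auto simp: scaleC_one)

lemma not_eigenvalues_1_minus_1:
  assumes "x \<in> soc_annihilator" "m \<notin> L" "d x * m - m \<in> L" "d x * n + n \<in> L"
  shows "n \<in> L"
  using no_two_eigenvalues[of x m 1 n "-1"] assms by (auto simp: scaleC_one)

section \<open>Modules of dimension at least two\<close>

lemma normalize_derivative:
  assumes "x \<in> soc_annihilator" "x * m \<in> L" "d x * m \<notin> L"
  obtains c where "c * x \<in> soc_annihilator" "d (c * x) * m - m \<in> L"
proof -
  obtain c where c: "c * (d x * m) - m \<in> L" using L_generates[OF assms(3)] by blast
  have "d (c * x) * m - m = d c * (x * m) + (c * (d x * m) - m)"
    by (simp add: d_mult algebra_simps)
  then show ?thesis using that[of c] c assms L_add L_mult soc_annihilator_mult(1) by metis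
qed

text \<open>Otherwise some left multiple \<open>z\<close> of \<open>x\<close> has a derivative
  fixing the class of \<open>m\<close>. The contradiction is a second vector, outside
  \<open>L\<close>, that such a derivative kills: the eigenvalues 1 and 0 cannot coexist.\<close>

lemma d_kills_of_indep:
  assumes ind: "indep m n" and x: "x \<in> soc_annihilator" "x * m \<in> L" "x * n \<in> L"
  shows "d x * m \<in> L"
proof (rule ccontr)
  assume "d x * m \<notin> L"
  then obtain b where b: "b * x \<in> soc_annihilator" "d (b * x) * m - m \<in> L"
    using normalize_derivative x by blast
  define z where "z = b * x"
  have z: "z \<in> soc_annihilator" "z * m \<in> L" "z * n \<in> L" "d z * m - m \<in> L"
    using b x L_mult[of _ b] by (simp_all add: z_def mult.assoc)
  obtain c where c: "m \<notin> L" "c * m \<in> L" "c * n \<notin> L" using ind by (auto simp: indep_def)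
  define v where "v = d z * n"
  show False
  proof (cases "\<forall>a. a * m \<in> L \<longrightarrow> a * v \<in> L")
    \<comment> \<open>Here \<open>v\<close> is the image of \<open>m\<close> under an endomorphism,
      hence fixed by \<open>d z\<close>. So \<open>d z\<close> kills \<open>n - v\<close>, which is
      then 0 in \<open>B/L\<close> and makes \<open>n\<close> dependent on \<open>m\<close>.\<close>
    case True
    have "(d z - 1) * m \<in> L" using z(4) by (simp add: algebra_simps)
    then have "(d z - 1) * v \<in> L" using True by blast
    then have "d z * (n - v) \<in> L" using L_minus[of "(d z - 1) * v"] by (simp add: v_def algebra_simps)
    then have "n - v \<in> L" using not_eigenvalues_1_0 z c by blast
    then have "c * (n - v) + c * v \<in> L" using True c L_add L_mult by blast
    then show False using c by (simp add: algebra_simps)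
  next
    case False
    then obtain a where a: "a * m \<in> L" "a * v \<notin> L" by blast
    obtain a' where a': "a' * (a * v) - v \<in> L" using L_generates[OF a(2)] by blast
    \<comment> \<open>Modulo \<open>L\<close>, \<open>p\<close> fixes \<open>m\<close> and kills
      \<open>v\<close>, so \<open>d (p * z)\<close> still fixes \<open>m\<close> but kills
      \<open>n\<close>.\<close>
    define p where "p = 1 - a' * a"
    have "d (p * z) * m - m = d p * (z * m) + p * (d z * m - m) - a' * (a * m)"
      by (subst d_mult) (simp add: p_def algebra_simps)
    then have 1: "d (p * z) * m - m \<in> L" using z a L_add L_diff L_mult by metis
    have "d (p * z) * n = d p * (z * n) - (a' * (a * v) - v)"
      by (subst d_mult) (simp add: p_def v_def algebra_simps)
    then have 0: "d (p * z) * n \<in> L" using z a' L_diff L_mult by metis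
    have "n \<in> L" using not_eigenvalues_1_0[OF _ c(1) 1 0] z soc_annihilator_mult by blast
    then show False using c L_mult by blast
  qed
qed

text \<open>After normalising to a \<open>z\<close> whose derivative fixes \<open>m\<close>, the
  vector \<open>w = z * n\<close> spans the same line as \<open>m\<close>, so \<open>z * z\<close>
  kills \<open>m\<close> and \<open>n\<close>. Differentiating \<open>z * z\<close> at
  \<open>n\<close> gives \<open>z * (v + n) \<in> L\<close>. This sign is the source of the
  eigenvalue -1, which cannot coexist with 1.\<close>

lemma d_kills_annihilator_aux:
  assumes nt: "\<not> soc_annihilator \<subseteq> L" and ind: "indep m n"
    and x: "x \<in> soc_annihilator" "x * m \<in> L"
  shows "d x * m \<in> L"
proof (rule ccontr)
  assume "d x * m \<notin> L"
  then obtain b where b: "b * x \<in> soc_annihilator" "d (b * x) * m - m \<in> L"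
    using normalize_derivative x by blast
  define z where "z = b * x"
  have z: "z \<in> soc_annihilator" "z * m \<in> L" "d z * m - m \<in> L"
    using b x L_mult[of _ b] by (simp_all add: z_def mult.assoc)
  have m: "m \<notin> L" using ind by (simp add: indep_def)
  have n: "n \<notin> L" using indep_sym[OF ind] by (simp add: indep_def)
  define w where "w = z * n"
  have wm: "a * m \<in> L" if "a * w \<in> L" for a
  proof -
    have "d (a * z) * m \<in> L"
      using that z L_mult[OF z(2), of a]
      by (intro d_kills_of_indep[OF ind]) (simp_all add: w_def soc_annihilator_mult mult.assoc)
    moreover have "a * m = d (a * z) * m - d a * (z * m) - a * (d z * m - m)"
      by (simp add: d_mult algebra_simps)
    ultimately show ?thesis using z L_diff L_mult by metis
  qed
  have mw: "a * w \<in> L" if "a * m \<in> L" for a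
    using annihilator_swap[OF m wm that] by blast
  have w: "w \<notin> L"
    using wm[of 1] m by auto
  define v where "v = d z * n"
  have zv: "w + z * v \<in> L"
  proof -
    have "d (z * z) * n \<in> L"
    proof (rule d_kills_of_indep[OF indep_sym[OF ind]])
      show "z * z * n \<in> L" using mw[OF z(2)] by (simp add: w_def mult.assoc)
    qed (use z L_mult[OF z(2), of z] in \<open>simp_all add: mult.assoc soc_annihilator_mult\<close>)
    moreover have "(d z - 1) * w \<in> L" using z(3) by (intro mw) (simp add: algebra_simps)
    moreover have "w + z * v = d (z * z) * n - (d z - 1) * w"
      by (simp add: d_mult w_def v_def algebra_simps)
    ultimately show ?thesis using L_diff by metis
  qed
  show False
  proof (cases "\<forall>a. a * m \<in> L \<longrightarrow> a * n \<in> L \<longrightarrow> a * v \<in> L")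
    \<comment> \<open>Now \<open>v\<close> is in the span of \<open>m\<close> and \<open>n\<close>.
      As \<open>z\<close> kills \<open>v + n\<close> and \<open>m\<close> but not \<open>n\<close>,
      the vector \<open>v + n\<close> depends on \<open>m\<close> and is fixed by
      \<open>d z\<close>; this makes \<open>d z\<close> act as -1 on \<open>n - v\<close>.\<close>
    case True
    have vn: "a * (v + n) \<in> L" if a: "a * m \<in> L" for a
    proof -
      obtain p where p: "p * w - a * n \<in> L" using L_generates[OF w] by blast
      have "(a - p * z) * m = a * m - p * (z * m)" "(a - p * z) * n = - (p * w - a * n)"
        by (simp_all add: w_def algebra_simps)
      then have "(a - p * z) * v \<in> L" using True a p z L_diff L_mult L_minus by metis
      moreover have "a * (v + n) = (a - p * z) * v + p * (w + z * v) - (p * w - a * n)"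
        by (simp add: algebra_simps)
      ultimately show ?thesis using p zv L_add L_diff L_mult by metis
    qed
    have "(d z - 1) * (v + n) \<in> L" using z(3) by (intro vn) (simp add: algebra_simps)
    then have "d z * (n - v) + (n - v) \<in> L"
      using L_minus[of "(d z - 1) * (v + n)"] by (simp add: v_def algebra_simps)
    then have nv: "n - v \<in> L" using not_eigenvalues_1_minus_1 z m by blast
    obtain c where c: "c * m \<in> L" "c * n \<notin> L" using ind by (auto simp: indep_def)
    have "(1/2) *\<^sub>C (c * (v + n) + c * (n - v)) \<in> L" by (intro L_scaleC L_add vn c L_mult nv)
    moreover have "c * (v + n) + c * (n - v) = 2 *\<^sub>C (c * n)"
      using scaleC_add_left[of 1 1 "c * n"] by (simp add: algebra_simps scaleC_one)
    ultimately show False using c by (simp add: scaleC_mult_simps)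
  next
    case False
    then obtain a where a: "a * m \<in> L" "a * n \<in> L" "a * v \<notin> L" by blast
    \<comment> \<open>The target is chosen so that \<open>p\<close> sends \<open>v\<close> to
      \<open>- (v + n)\<close> while killing \<open>m\<close> and \<open>n\<close>; the derivative
      of \<open>(1 + p) * z\<close> then acts as 1 on \<open>m\<close> and as -1 on
      \<open>n\<close>.\<close>
    obtain a' where a': "a' \<in> soc_annihilator" "a' * (a * v) - (- (v + n)) \<in> L"
      using annihilator_acts[OF nt a(3)] by blast
    define p where "p = a' * a"
    have p: "p \<in> soc_annihilator" "p * m \<in> L" "p * n \<in> L" "p * v + (v + n) \<in> L"
      using a a' L_mult by (simp_all add: p_def soc_annihilator_mult mult.assoc algebra_simps)
    define y where "y = (1 + p) * z"
    have "d y * m - m = d p * (z * m) + (d z * m - m) + p * (d z * m - m) + p * m"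
      by (simp add: y_def d_mult d_add algebra_simps)
    then have 1: "d y * m - m \<in> L" using z p L_add L_mult by metis
    have "indep w n" using ind w mw by (auto simp: indep_def)
    then have "d p * w \<in> L" using p mw by (intro d_kills_of_indep[of w n]) auto
    moreover have "d y * n + n = d p * w + (p * v + (v + n))"
      by (simp add: y_def d_mult d_add w_def v_def algebra_simps)
    ultimately have 2: "d y * n + n \<in> L" using p L_add by metis
    have "y \<in> soc_annihilator" using z by (simp add: y_def soc_annihilator_mult)
    then have "n \<in> L" using not_eigenvalues_1_minus_1[OF _ m 1 2] by blast
    then show False using n by contradiction
  qed
qed

lemma indep_exists:
  assumes "indep m0 n0" "m \<notin> L"
  shows "\<exists>n. indep m n"
proof (cases "\<exists>c. c * m \<in> L \<and> c * m0 \<notin> L")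
  case True
  then show ?thesis using assms by (auto simp: indep_def)
next
  case False
  then have "c * m \<in> L" if "c * m0 \<in> L" for c
    using annihilator_swap[of m0 m c] assms that by (auto simp: indep_def)
  then show ?thesis using assms by (auto simp: indep_def)
qed

text \<open>By \<open>ann\<close>, what kills \<open>b * m\<close> also kills
  \<open>d b * m\<close>, which leaves only an endomorphism factor between the two vectors. That
  factor is shown to be 0 when \<open>b\<close> fixes \<open>m\<close> and when \<open>b * m\<close>
  and \<open>m\<close> are independent; the remaining position is a difference of two independent
  ones.\<close>

lemma d_soc_annihilator_in_ideal:
  assumes ind: "indep m0 n0" and x: "x \<in> soc_annihilator"
  shows "d x \<in> L"
proof (cases "soc_annihilator \<subseteq> L")
  case True
  then show ?thesis using d_soc_annihilator[OF x] by blast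
next
  case nt: False
  have kill: "d a * m \<in> L" if "a \<in> soc_annihilator" "a * m \<in> L" for a m
  proof (cases "m \<in> L")
    case True
    then show ?thesis by (rule L_mult)
  next
    case False
    then obtain n where "indep m n" using indep_exists[OF ind] by blast
    then show ?thesis using d_kills_annihilator_aux nt that by blast
  qed
  have ann: "c * (d b * m) \<in> L" if "b \<in> soc_annihilator" "c \<in> soc_annihilator" "c * (b * m) \<in> L" for b c m
  proof -
    have "d (c * b) * m \<in> L" using that by (intro kill) (simp_all add: soc_annihilator_mult mult.assoc)
    moreover have "c * (d b * m) = d (c * b) * m - d c * (b * m)" by (simp add: d_mult algebra_simps)
    ultimately show ?thesis using kill[OF that(2,3)] L_diff by metis
  qed
  have zeroI: "v \<in> L" if "\<And>a. a \<in> soc_annihilator \<Longrightarrow> a * v \<in> L" for v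
  proof (rule ccontr)
    assume "v \<notin> L"
    then obtain a where a: "a \<in> soc_annihilator" "a * v - v \<in> L" using annihilator_acts[OF nt] by blast
    have "v = a * v - (a * v - v)" by simp
    then show False using that[OF a(1)] a(2) L_diff \<open>v \<notin> L\<close> by metis
  qed
  have fixed: "d b * m \<in> L" if b: "b \<in> soc_annihilator" "b * m - m \<in> L" for b m
  proof (rule zeroI)
    fix a :: 'a assume a: "a \<in> soc_annihilator"
    \<comment> \<open>\<open>b * b - b\<close> kills \<open>m\<close>, hence so does its derivative,
      which sends \<open>m\<close> to \<open>b * (d b * m)\<close> modulo \<open>L\<close>.\<close>
    have bb: "d (b * b - b) * m \<in> L"
      using b L_mult[OF b(2), of b] by (intro kill) (simp_all add: soc_annihilator_add soc_annihilator_mult algebra_simps)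
    have "b * (d b * m) = d (b * b - b) * m - d b * (b * m - m)"
      by (simp add: d_mult d_diff algebra_simps)
    then have "b * (d b * m) \<in> L" using bb b L_diff L_mult by metis
    then have 1: "a * (b * (d b * m)) \<in> L" by (rule L_mult)
    have "(a * b - a) * (b * m) = a * (b * (b * m - m) + (b * m - m)) - a * (b * m - m)"
      by (simp add: algebra_simps)
    then have "(a * b - a) * (b * m) \<in> L" using b L_add L_diff L_mult by metis
    then have "(a * b - a) * (d b * m) \<in> L"
      using a b by (intro ann) (simp_all add: soc_annihilator_add soc_annihilator_mult)
    moreover have "a * (d b * m) = a * (b * (d b * m)) - (a * b - a) * (d b * m)" by (simp add: algebra_simps)
    ultimately show "a * (d b * m) \<in> L" using 1 L_diff by metis
  qed
  have moved: "d b * m \<in> L" if b: "b \<in> soc_annihilator" "indep (b * m) m" for b m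
  proof (rule zeroI)
    fix a :: 'a assume a: "a \<in> soc_annihilator"
    have "m \<notin> L" using indep_sym[OF b(2)] by (simp add: indep_def)
    then obtain p where p: "p \<in> soc_annihilator" "p * m - m \<in> L" using annihilator_acts[OF nt] by blast
    \<comment> \<open>\<open>c\<close> fixes \<open>b * m\<close> and kills
      \<open>(b + p) * m\<close>. The first makes it act as 1 on \<open>d b * m\<close>, the second
      makes it kill \<open>d b * m\<close>.\<close>
    obtain c where c: "c \<in> soc_annihilator" "c * (b * m) - b * m \<in> L" "c * m - (- (b * m)) \<in> L"
      using annihilator_interpolates[OF nt b(2)] by blast
    have "c * ((b + p) * m) = (c * (b * m) - b * m) + (c * m - (- (b * m))) + c * (p * m - m)"
      by (simp add: algebra_simps)
    then have "c * ((b + p) * m) \<in> L" using c p L_add L_mult by metis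
    then have "c * (d (b + p) * m) \<in> L" using b p c by (intro ann) (simp_all add: soc_annihilator_add)
    moreover have "c * (d b * m) = c * (d (b + p) * m) - c * (d p * m)" by (simp add: d_add algebra_simps)
    ultimately have cv: "c * (d b * m) \<in> L" using L_diff L_mult[OF fixed[OF p]] by metis
    have "(a * c - a) * (b * m) = a * (c * (b * m) - b * m)" by (simp add: algebra_simps)
    then have "(a * c - a) * (b * m) \<in> L" using c L_mult by metis
    then have "(a * c - a) * (d b * m) \<in> L"
      using a b c by (intro ann) (simp_all add: soc_annihilator_add soc_annihilator_mult)
    moreover have "a * (d b * m) = a * (c * (d b * m)) - (a * c - a) * (d b * m)" by (simp add: algebra_simps)
    ultimately show "a * (d b * m) \<in> L" using L_diff L_mult[OF cv] by metis
  qed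
  have "d x * 1 \<in> L"
  proof (cases "x \<in> L \<or> indep x 1")
    case True
    then show ?thesis using kill[of x 1] moved[of x 1] x by auto
  next
    case False
    have one: "1 \<notin> L" by (rule maximal_left_ideal_one[OF maximal])
    obtain n where "indep 1 n" using indep_exists[OF ind one] by blast
    then obtain c where c: "c \<in> L" "c * n \<notin> L" by (auto simp: indep_def)
    have "n \<notin> L" using c L_mult by blast
    obtain p where p: "p \<in> soc_annihilator" "p * 1 - n \<in> L" using annihilator_acts[OF nt one] by blast
    have "c * p \<notin> L"
    proof
      assume "c * p \<in> L"
      moreover have "c * n = c * p - c * (p * 1 - n)" by (simp add: algebra_simps)
      ultimately show False using c p L_diff L_mult by metis
    qed
    then have "indep 1 p" using c one by (auto simp: indep_def)
    then have "d p * 1 \<in> L" using moved[of p 1] p indep_sym by simp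
    have "c * x \<in> L" using annihilator_swap[OF one, of x c] False c by (auto simp: indep_def)
    then have "c * (x + p) \<notin> L" using \<open>c * p \<notin> L\<close> L_diff[of "c * (x + p)" "c * x"] by (auto simp: algebra_simps)
    then have "indep 1 (x + p)" using c one by (auto simp: indep_def)
    then have "d (x + p) * 1 \<in> L" using moved[of "x + p" 1] p x indep_sym by (simp add: soc_annihilator_add)
    moreover have "d x * 1 = d (x + p) * 1 - d p * 1" by (simp add: d_add)
    ultimately show ?thesis using \<open>d p * 1 \<in> L\<close> L_diff by metis
  qed
  then show ?thesis by simp
qed

end

section \<open>Quotients by two-sided maximal left ideals\<close>

lemma two_sided_ideal_prime:
  assumes L: "maximal_left_ideal L" and ts: "\<And>c b. c \<in> L \<Longrightarrow> c * b \<in> L" and ab: "a * b \<in> L"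
  shows "a \<in> L \<or> b \<in> L"
proof (rule ccontr)
  assume *: "\<not> ?thesis"
  then obtain m where m: "m * a - 1 \<in> L" using maximal_left_ideal_generates[OF L, of a 1] by blast
  have LL: "left_ideal L" using L by (simp add: maximal_left_ideal_def)
  have "m * (a * b) \<in> L" using ab LL by (simp add: left_ideal_def)
  moreover have "(m * a - 1) * b \<in> L" by (rule ts[OF m])
  moreover have "b = m * (a * b) - (m * a - 1) * b" by (simp add: algebra_simps)
  ultimately have "b \<in> L" using left_ideal_diff[OF LL] by metis
  with * show False by blast
qed

text \<open>If \<open>r\<close> inverts \<open>n\<close> modulo \<open>L\<close>, then
  \<open>r ^ j\<close> inverts \<open>n ^ j\<close>. For large \<open>j\<close> the product
  \<open>r ^ j * n ^ j\<close> has norm below 1, so that \<open>1 - r ^ j * n ^ j\<close> is an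
  invertible element of \<open>L\<close>.\<close>

lemma two_sided_ideal_quasinilpotent:
  fixes n :: "'a::complex_banach_algebra_1"
  assumes L: "maximal_left_ideal L" and ts: "\<And>c b. c \<in> L \<Longrightarrow> c * b \<in> L" and n: "quasinilpotent n"
  shows "n \<in> L"
proof (rule ccontr)
  assume "n \<notin> L"
  then obtain r where r: "r * n - 1 \<in> L" using maximal_left_ideal_generates[OF L, of n 1] by blast
  have LL: "left_ideal L" using L by (simp add: maximal_left_ideal_def)
  have pow: "r ^ j * n ^ j - 1 \<in> L" for j
  proof (induction j)
    case 0
    then show ?case using LL by (simp add: left_ideal_def)
  next
    case (Suc j)
    have "r ^ Suc j * n ^ Suc j - 1 = r ^ j * ((r * n - 1) * n ^ j) + (r ^ j * n ^ j - 1)"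
      unfolding power_Suc2[of r] power_Suc[of n] by (simp add: algebra_simps)
    moreover have "r ^ j * ((r * n - 1) * n ^ j) \<in> L" using ts[OF r] LL by (simp add: left_ideal_def)
    moreover have "a + b \<in> L" if "a \<in> L" "b \<in> L" for a b using that LL by (simp add: left_ideal_def)
    ultimately show ?case using Suc by (simp only:)
  qed
  have "(\<lambda>j. norm (1::'a) * (norm r ^ j * norm (n ^ j))) \<longlonglongrightarrow> norm (1::'a) * 0"
    by (intro tendsto_mult_left quasinilpotent_power_small n) simp
  then have "\<forall>\<^sub>F j in sequentially. norm (1::'a) * (norm r ^ j * norm (n ^ j)) < 1"
    by (rule order_tendstoD) simp
  then obtain j where j: "norm (1::'a) * (norm r ^ j * norm (n ^ j)) < 1"
    by (auto simp: eventually_sequentially)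
  have "norm (r ^ j * n ^ j) \<le> norm (r ^ j) * norm (n ^ j)" by (rule norm_mult_ineq)
  also have "\<dots> \<le> (norm (1::'a) * norm r ^ j) * norm (n ^ j)"
    by (intro mult_right_mono norm_power_le) simp
  finally have "norm (r ^ j * n ^ j) < 1" using j by (simp add: mult.assoc)
  then obtain y where "y * (1 - r ^ j * n ^ j) = 1"
    using bi_invertible_one_minus_of_norm_less by (auto simp: bi_invertible_def)
  then have "(- y) * (r ^ j * n ^ j - 1) = 1" by (simp add: algebra_simps)
  then have "1 \<in> L" using pow[of j] LL by (metis left_ideal_def)
  then show False using maximal_left_ideal_one[OF L] by contradiction
qed

text \<open>The product of the factors \<open>x - \<mu> *\<^sub>C 1\<close> over the finite spectrum
  is quasinilpotent, hence 0 in the division ring \<open>B/L\<close>; so one of the factors is 0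
  there.\<close>

lemma two_sided_ideal_spectral_value:
  fixes x :: "'a::complex_banach_algebra_1"
  assumes L: "maximal_left_ideal L" and ts: "\<And>c b. c \<in> L \<Longrightarrow> c * b \<in> L" and fin: "finite (spectrum x)"
  obtains k where "x - k *\<^sub>C 1 \<in> L"
proof -
  have "\<exists>k. x - k *\<^sub>C 1 \<in> L" if "finite S" "peval x (\<Prod>\<mu>\<in>S. [:- \<mu>, 1:]) \<in> L" for S
    using that
  proof (induction S rule: finite_induct)
    case empty
    then show ?case using maximal_left_ideal_one[OF L] by simp
  next
    case (insert k S)
    have "peval x (\<Prod>\<mu>\<in>insert k S. [:- \<mu>, 1:]) = (x - k *\<^sub>C 1) * peval x (\<Prod>\<mu>\<in>S. [:- \<mu>, 1:])"
      unfolding prod.insert[OF insert(1,2)] peval_mult by (simp add: scaleC_one)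
    then show ?case using two_sided_ideal_prime[OF L ts] insert by metis
  qed
  moreover have "peval x (\<Prod>\<mu>\<in>spectrum x. [:- \<mu>, 1:]) \<in> L"
    by (rule two_sided_ideal_quasinilpotent[OF L _ quasinilpotent_spectral_product[OF fin spectrum_nonempty]])
      (rule ts)
  ultimately show ?thesis using fin that by blast
qed

context finite_spectrum_derivation
begin

text \<open>If \<open>L\<close> is not two-sided, some \<open>c\<close> kills the class of 1 but not
  that of \<open>b\<close>, so \<open>B/L\<close> has dimension at least two.\<close>

lemma d_soc_annihilator_in_ideal_or_two_sided:
  assumes L: "maximal_left_ideal L" and x: "x \<in> soc_annihilator"
  shows "d x \<in> L \<or> (\<forall>c\<in>L. \<forall>b. c * b \<in> L)"
proof (cases "\<forall>c\<in>L. \<forall>b. c * b \<in> L")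
  case False
  then obtain c b where "c \<in> L" "c * b \<notin> L" by blast
  interpret finite_spectrum_derivation_on_module d L by unfold_locales (rule L)
  have "indep 1 b" using \<open>c \<in> L\<close> \<open>c * b \<notin> L\<close> maximal_left_ideal_one[OF L] by (auto simp: indep_def)
  then show ?thesis using d_soc_annihilator_in_ideal x by blast
qed blast

text \<open>
  If \<open>d x \<notin> L\<close>, cutting with a central spectral idempotent \<open>e\<close> yields \<open>y\<close> with \<open>d y = e\<close>. Then
  \<open>2y = d (y\<^sup>2)\<close> has finite spectrum as well, so \<open>y\<close> is a scalar on a spectral idempotent killed
  by \<open>d\<close>, which contradicts \<open>d y = e\<close>.
\<close>

lemma d_soc_annihilator_in_maximal_left_ideal:
  assumes L: "maximal_left_ideal L" and x: "x \<in> soc_annihilator"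
  shows "d x \<in> L"
proof (rule ccontr)
  assume nin: "d x \<notin> L"
  then have ts: "\<And>c b. c \<in> L \<Longrightarrow> c * b \<in> L"
    using d_soc_annihilator_in_ideal_or_two_sided[OF L x] by blast
  have LL: "left_ideal L" using L by (simp add: maximal_left_ideal_def)
  have invL: "k \<in> spectrum u" if "u - k *\<^sub>C 1 \<in> L" for u k
  proof (rule ccontr)
    assume "k \<notin> spectrum u"
    then obtain y where "y * (u - k *\<^sub>C 1) = 1" by (auto simp: spectrum_def)
    then have "1 \<in> L" using that LL by (metis left_ideal_def)
    then show False using maximal_left_ideal_one[OF L] by contradiction
  qed
  obtain k where k: "d x - k *\<^sub>C 1 \<in> L"
    by (rule two_sided_ideal_spectral_value[OF L ts finite_spectrum])
  then have "k \<noteq> 0" using nin by auto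
  obtain e s where e: "e * e = e" "1 - e = s * (d x - k *\<^sub>C 1)"
    "quasinilpotent ((d x - k *\<^sub>C 1) * e)" "e \<in> soc_annihilator" "\<And>a. e * a = a * e" "d e = 0"
    using central_spectral_idempotent[OF x invL[OF k] \<open>k \<noteq> 0\<close>] by metis
  \<comment> \<open>The error term of the first approximation: \<open>y\<close> is \<open>x\<close>
    cut down by \<open>e\<close> and divided by \<open>k\<close>, and \<open>d y = e + n\<close>.
    The fact \<open>small\<close> then gives \<open>n = 0\<close>.\<close>
  define n where "n = inverse k *\<^sub>C ((d x - k *\<^sub>C 1) * e)"
  define y where "y = inverse k *\<^sub>C (x * e)"
  have yA: "y \<in> soc_annihilator" using x by (simp add: y_def soc_annihilator_add soc_annihilator_mult)
  have ye: "y * e = y" using e(1) by (simp add: y_def mult_scaleC_left mult.assoc)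
  have ne: "n * e = n" using e(1) by (simp add: n_def mult_scaleC_left mult.assoc)
  have n: "quasinilpotent n" unfolding n_def by (intro quasinilpotent_scaleC e)
  have dy: "d y = e + n"
    using e(6) \<open>k \<noteq> 0\<close>
    by (simp add: y_def n_def d_scaleC d_mult left_diff_distrib scaleC_mult_simps cvs.scale_right_diff_distrib)
  have eL: "e \<in> L'" if L': "maximal_left_ideal L'" "d y \<in> L'" for L'
  proof -
    obtain g where "g * (n + 1 *\<^sub>C 1) = 1"
      using quasinilpotent_plus_scalar[OF n, of 1] by (auto simp: bi_invertible_def)
    then have g: "g * (n + 1) = 1" by (simp add: scaleC_one)
    have "d y = (n + 1) * e" using ne by (simp add: dy distrib_right)
    then have "g * d y = e" using g by (simp flip: mult.assoc)
    then show ?thesis using L' by (metis left_ideal_def maximal_left_ideal_def)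
  qed
  \<comment> \<open>A maximal left ideal that contains \<open>d y\<close> contains \<open>e\<close>
    and hence \<open>u\<close>; any other is two-sided and contains all quasinilpotent
    elements.\<close>
  have small: "u = 0" if u: "quasinilpotent u" "u * e = u" for u
  proof (rule semisimple_eq_0I[OF semisimple])
    fix L' :: "'a set" assume L': "maximal_left_ideal L'"
    show "u \<in> L'"
    proof (cases "d y \<in> L'")
      case True
      then have "u * e \<in> L'" using eL[OF L'] L' by (simp add: maximal_left_ideal_def left_ideal_def)
      then show ?thesis using u by simp
    next
      case False
      then show ?thesis
        using d_soc_annihilator_in_ideal_or_two_sided[OF L' yA] two_sided_ideal_quasinilpotent[OF L' _ u(1)]
        by blast
    qed
  qed
  have dy: "d y = e" using small[OF n ne] dy by simp
  have half: "d ((1/2) *\<^sub>C (z * z)) = z" if z: "d z = e" "z * e = z" for z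
  proof -
    have "d (z * z) = 2 *\<^sub>C z"
      using e(5)[of z] z scaleC_add_left[of 1 1 z] by (simp add: d_mult scaleC_one)
    then show ?thesis by (simp add: d_scaleC scaleC_mult_simps)
  qed
  have e1: "1 - e \<in> L" unfolding e(2) using k LL by (simp add: left_ideal_def)
  obtain z c where z: "z \<in> soc_annihilator" "d z = e" "z * e = z" "z - c *\<^sub>C 1 \<in> L" "c \<noteq> 0"
  proof -
    have fy: "finite (spectrum y)" using finite_spectrum half[OF dy ye] by metis
    obtain c where c: "y - c *\<^sub>C 1 \<in> L" by (rule two_sided_ideal_spectral_value[OF L ts fy])
    show ?thesis
    proof (cases "c = 0")
      \<comment> \<open>The spectral idempotent is only available at a nonzero value. Adding
        \<open>e\<close> keeps the derivative, as \<open>d e = 0\<close>, and moves the value from 0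
        to 1, as \<open>e\<close> is 1 modulo \<open>L\<close>.\<close>
      case True
      have "y - (1 - e) \<in> L" using True c left_ideal_diff[OF LL _ e1] by simp
      then have "(y + e) - 1 *\<^sub>C 1 \<in> L" by (simp add: scaleC_one diff_diff_eq2)
      then show ?thesis
        using that[of "y + e" 1] yA e(1,4,6) ye dy by (simp add: soc_annihilator_add d_add distrib_right)
    qed (rule that[OF yA dy ye c], assumption)
  qed
  have z2: "(1/2) *\<^sub>C (z * z) \<in> soc_annihilator" using z(1) by (simp add: soc_annihilator_add soc_annihilator_mult)
  have hz: "d ((1/2) *\<^sub>C (z * z)) = z" by (rule half[OF z(2,3)])
  obtain p r s' where p: "p * p = p" "p = r * z" "1 - p = s' * (z - c *\<^sub>C 1)"
    "quasinilpotent ((z - c *\<^sub>C 1) * p)" "d p = 0"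
    by (rule central_spectral_idempotent[OF z2, unfolded hz, OF invL[OF z(4)] z(5)])
  have pe: "p * e = p" unfolding p(2) mult.assoc z(3) ..
  have "(z - c *\<^sub>C 1) * p = 0" using pe by (intro small p) (simp add: mult.assoc)
  then have "z * p = c *\<^sub>C p" by (simp add: left_diff_distrib mult_scaleC_left)
  then have "d (z * p) = 0" using p(5) by (simp add: d_scaleC)
  then have "e * p = 0" using p(5) z(2) by (simp add: d_mult)
  then have "p = 0" using pe e(5)[of p] by simp
  then have "s' * (z - c *\<^sub>C 1) = 1" using p(3) by simp
  moreover have "s' * (z - c *\<^sub>C 1) \<in> L" using LL z(4) by (simp add: left_ideal_def)
  ultimately have "1 \<in> L" by simp
  then show False using maximal_left_ideal_one[OF L] by contradiction
qed

lemma d_soc_annihilator_eq_0: "x \<in> soc_annihilator \<Longrightarrow> d x = 0"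
  by (rule semisimple_eq_0I[OF semisimple d_soc_annihilator_in_maximal_left_ideal])

lemma d_mult_soc_annihilator_eq_0:
  assumes "a \<in> soc_annihilator"
  shows "d x * a = 0"
  using d_mult[of x a] d_soc_annihilator_eq_0[OF soc_annihilator_mult(1)[OF assms]]
    d_soc_annihilator_eq_0[OF assms] by simp

end

section \<open>The socle\<close>

inductive_set ideal_generated :: "'a::ring_1 set \<Rightarrow> 'a set" for F where
  zero: "0 \<in> ideal_generated F"
| step: "f \<in> F \<Longrightarrow> x \<in> ideal_generated F \<Longrightarrow> b * f * c + x \<in> ideal_generated F"

lemma ideal_generatedI: "f \<in> F \<Longrightarrow> b * f * c \<in> ideal_generated F"
  using ideal_generated.step[OF _ ideal_generated.zero] by simp

lemma ideal_generated_add: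
  "x \<in> ideal_generated F \<Longrightarrow> y \<in> ideal_generated F \<Longrightarrow> x + y \<in> ideal_generated F"
  by (induction rule: ideal_generated.induct) (auto simp: add.assoc intro: ideal_generated.step)

lemma ideal_generated_mult_left: "x \<in> ideal_generated F \<Longrightarrow> a * x \<in> ideal_generated F"
proof (induction rule: ideal_generated.induct)
  case (step f x b c)
  then show ?case
    using ideal_generated.step[of f F "a * x" "a * b" c] by (simp add: distrib_left mult.assoc)
qed (simp add: ideal_generated.zero)

lemma ideal_generated_mult_right: "x \<in> ideal_generated F \<Longrightarrow> x * a \<in> ideal_generated F"
proof (induction rule: ideal_generated.induct)
  case (step f x b c)
  then show ?case
    using ideal_generated.step[of f F "x * a" b "c * a"] by (simp add: distrib_right mult.assoc)
qed (simp add: ideal_generated.zero)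

lemma ideal_generated_diff:
  "x \<in> ideal_generated F \<Longrightarrow> y \<in> ideal_generated F \<Longrightarrow> x - y \<in> ideal_generated F"
  using ideal_generated_add[of x F "(-1) * y"] ideal_generated_mult_left[of y F "-1"] by simp

lemmas ideal_generated_closed = ideal_generated.zero ideal_generated_add ideal_generated_diff
  ideal_generated_mult_left ideal_generated_mult_right

abbreviation soc :: "'a::complex_banach_algebra_1 set" where
  "soc \<equiv> ideal_generated (Collect minimal_idempotent)"

lemma minimal_idempotent_in_soc: "minimal_idempotent f \<Longrightarrow> b * f \<in> soc" "minimal_idempotent f \<Longrightarrow> f * b \<in> soc"
  using ideal_generatedI[of f "Collect minimal_idempotent" b 1]
    ideal_generatedI[of f "Collect minimal_idempotent" 1 b] by simp_all

lemma (in finite_spectrum_derivation) d_ideal_generated: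
  assumes F: "\<And>f. f \<in> F \<Longrightarrow> f * f = f"
  shows "x \<in> ideal_generated F \<Longrightarrow> d x \<in> ideal_generated F"
proof (induction rule: ideal_generated.induct)
  case (step f x b c)
  have 1: "d b * f * c \<in> ideal_generated F" "b * f * d c \<in> ideal_generated F"
    "b * d f * f * c \<in> ideal_generated F" "b * f * (d f * c) \<in> ideal_generated F"
    by (intro ideal_generatedI step)+
  have "d (b * f * c) = d b * f * c + (b * (d f * f + f * d f) * c + b * f * d c)"
    using d_mult[of f f] F[OF step(1)] by (simp add: d_mult algebra_simps)
  also have "\<dots> = d b * f * c + (b * d f * f * c + b * f * (d f * c) + b * f * d c)"
    by (simp add: algebra_simps)
  finally have "d (b * f * c) \<in> ideal_generated F" using 1 by (metis ideal_generated_add)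
  then show ?case using step by (simp add: d_add ideal_generated_add)
qed (simp add: ideal_generated.zero)

section \<open>The nondegenerate pairing of \<open>f B\<close> with \<open>B f\<close>, and
  idempotents in the socle\<close>

lemma minimal_idempotent_separates_left:
  fixes f m :: "'a::complex_banach_algebra_1"
  assumes "semisimple TYPE('a)" "minimal_idempotent f" "m * f = m" "m \<noteq> 0"
  obtains b where "f * b * m = f"
proof -
  obtain a where a: "m * a * m \<noteq> 0" using semiprime[OF assms(1), of m] assms(4) by blast
  obtain c where c: "f * (a * m) * f = c *\<^sub>C f" using assms(2) by (auto simp: minimal_idempotent_def)
  have "m * a * m = m * (f * (a * m) * f)" using assms(3) by (simp add: mult.assoc) (simp flip: mult.assoc)
  then have "c \<noteq> 0" using a c by auto
  have "f * (inverse c *\<^sub>C a) * m = inverse c *\<^sub>C (f * (a * m) * f)"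
    using assms(3) by (simp add: scaleC_mult_simps mult.assoc)
  then show ?thesis using that[of "inverse c *\<^sub>C a"] c \<open>c \<noteq> 0\<close> by (simp add: scaleC_mult_simps)
qed

lemma minimal_idempotent_separates_right:
  fixes f m :: "'a::complex_banach_algebra_1"
  assumes "semisimple TYPE('a)" "minimal_idempotent f" "f * m = m" "m \<noteq> 0"
  obtains b where "m * b * f = f"
proof -
  obtain a where a: "m * a * m \<noteq> 0" using semiprime[OF assms(1), of m] assms(4) by blast
  obtain c where c: "f * (m * a) * f = c *\<^sub>C f" using assms(2) by (auto simp: minimal_idempotent_def)
  have "m * a * m = (f * (m * a) * f) * m" using assms(3) by (simp add: mult.assoc) (simp flip: mult.assoc)
  then have "c \<noteq> 0" using a c by auto
  have "m * (inverse c *\<^sub>C a) * f = inverse c *\<^sub>C (f * (m * a) * f)"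
    using assms(3) by (simp add: scaleC_mult_simps flip: mult.assoc)
  then show ?thesis using that[of "inverse c *\<^sub>C a"] c \<open>c \<noteq> 0\<close> by (simp add: scaleC_mult_simps)
qed

definition extends :: "'a::ring_1 \<Rightarrow> 'a \<Rightarrow> bool" where
  "extends p q \<longleftrightarrow> q * p = p \<and> p * q = p"

lemma extends_trans: "extends p q \<Longrightarrow> extends q r \<Longrightarrow> extends p r"
  unfolding extends_def by (metis mult.assoc)

lemma extends_fixes: "extends p q \<Longrightarrow> p * m = m \<Longrightarrow> q * m = m" "extends p q \<Longrightarrow> m * p = m \<Longrightarrow> m * q = m"
  unfolding extends_def by (metis mult.assoc)+

text \<open>\<open>n\<close> is the part of \<open>m\<close> that \<open>p\<close> misses, and
  \<open>h\<close> is dual to it: \<open>h * n = f\<close> and \<open>h * p = 0\<close>. So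
  \<open>n * h\<close> is an idempotent orthogonal to \<open>p\<close>, and adding it to
  \<open>p\<close> absorbs \<open>m\<close>.\<close>

lemma extend_idempotent_left:
  fixes p :: "'a::complex_banach_algebra_1"
  assumes ss: "semisimple TYPE('a)" and p: "p * p = p" "p \<in> soc"
    and f: "minimal_idempotent f" "m * f = m"
  obtains q where "q * q = q" "q \<in> soc" "extends p q" "q * m = m"
proof (cases "p * m = m")
  case True
  then show ?thesis using that[of p] p by (simp add: extends_def)
next
  case False
  define n where "n = m - p * m"
  have pn: "p * n = 0" using p by (simp add: n_def right_diff_distrib flip: mult.assoc)
  have nf: "n * f = n" using f by (simp add: n_def left_diff_distrib mult.assoc)
  obtain b where b: "f * b * n = f"
    using minimal_idempotent_separates_left[OF ss f(1) nf] False by (auto simp: n_def)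
  define h where "h = f * b * (1 - p)"
  have hp: "h * p = 0" using p by (simp add: h_def mult.assoc left_diff_distrib)
  have hm: "h * m = f" using b by (simp add: h_def n_def algebra_simps)
  have hn: "h * n = f" using b pn by (simp add: h_def algebra_simps)
  have "n * h * (n * h) = n * (h * n) * h" by (simp add: mult.assoc)
  then have nhnh: "n * h * (n * h) = n * h" by (simp add: hn nf)
  have z: "p * (n * h) = 0" "n * h * p = 0" using pn hp by (simp_all add: mult.assoc) (simp flip: mult.assoc)
  show ?thesis
  proof (rule that[of "p + n * h"])
    show "(p + n * h) * (p + n * h) = p + n * h" using p nhnh z by (simp add: algebra_simps)
    have "n * h \<in> soc" using minimal_idempotent_in_soc(1)[OF f(1), of n] nf by (simp add: ideal_generated_closed)
    then show "p + n * h \<in> soc" using p by (simp add: ideal_generated_closed)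
    show "extends p (p + n * h)" using p z by (simp add: extends_def algebra_simps)
    show "(p + n * h) * m = m" using hm nf by (simp add: distrib_right mult.assoc n_def)
  qed
qed

lemma extend_idempotent_right:
  fixes p :: "'a::complex_banach_algebra_1"
  assumes ss: "semisimple TYPE('a)" and p: "p * p = p" "p \<in> soc"
    and f: "minimal_idempotent f" "f * m = m"
  obtains q where "q * q = q" "q \<in> soc" "extends p q" "m * q = m"
proof (cases "m * p = m")
  case True
  then show ?thesis using that[of p] p by (simp add: extends_def)
next
  case False
  define n where "n = m - m * p"
  have pn: "n * p = 0" using p by (simp add: n_def left_diff_distrib mult.assoc)
  have nf: "f * n = n" using f by (simp add: n_def right_diff_distrib flip: mult.assoc)
  obtain b where b: "n * b * f = f"
    using minimal_idempotent_separates_right[OF ss f(1) nf] False by (auto simp: n_def)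
  define h where "h = (1 - p) * b * f"
  have hp: "p * h = 0" using p by (simp add: h_def right_diff_distrib flip: mult.assoc)
  have hm: "m * h = f" using b by (simp add: h_def n_def algebra_simps)
  have hn: "n * h = f"
  proof -
    have "n * h = n * b * f - n * p * b * f" by (simp add: h_def algebra_simps)
    then show ?thesis using b pn by simp
  qed
  have "h * n * (h * n) = h * ((n * h) * n)" by (simp add: mult.assoc)
  then have nhnh: "h * n * (h * n) = h * n" by (simp add: hn nf)
  have z: "p * (h * n) = 0" "h * n * p = 0" using pn hp by (simp_all add: mult.assoc) (simp flip: mult.assoc)
  show ?thesis
  proof (rule that[of "p + h * n"])
    show "(p + h * n) * (p + h * n) = p + h * n" using p nhnh z by (simp add: algebra_simps)
    have "h * n \<in> soc" using minimal_idempotent_in_soc(2)[OF f(1), of n] nf by (simp add: ideal_generated_closed)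
    then show "p + h * n \<in> soc" using p by (simp add: ideal_generated_closed)
    show "extends p (p + h * n)" using p z by (simp add: extends_def algebra_simps)
    have "m * (h * n) = n" using hm nf by (simp flip: mult.assoc)
    then show "m * (p + h * n) = m" by (simp add: distrib_left n_def)
  qed
qed

text \<open>On the complement of \<open>p\<close>, \<open>u * v\<close> and
  \<open>u * h v * f\<close> are bilinear forms with values in the line of \<open>f\<close>, and the
  second vanishes wherever the first does. Such forms are proportional.\<close>

lemma scalar_form:
  fixes f p :: "'a::complex_banach_algebra_1" and h :: "'a \<Rightarrow> 'a"
  assumes f: "minimal_idempotent f"
    and add: "\<And>x y. h (x + y) = h x + h y" and scale: "\<And>c x. h (c *\<^sub>C x) = c *\<^sub>C h x"
    and orth: "\<And>u v. f * u = u \<Longrightarrow> u * p = 0 \<Longrightarrow> v * f = v \<Longrightarrow> p * v = 0 \<Longrightarrow> u * v = 0 \<Longrightarrow> u * h v * f = 0"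
  obtains k where "\<And>u v. f * u = u \<Longrightarrow> u * p = 0 \<Longrightarrow> v * f = v \<Longrightarrow> p * v = 0 \<Longrightarrow> u * h v * f = k *\<^sub>C (u * v)"
proof -
  define U where "U = {u. f * u = u \<and> u * p = 0}"
  define V where "V = {v. v * f = v \<and> p * v = 0}"
  have Ucl: "u + c *\<^sub>C u' \<in> U" if "u \<in> U" "u' \<in> U" for u u' c
    using that by (simp add: U_def algebra_simps scaleC_mult_simps)
  have Vcl: "v + c *\<^sub>C v' \<in> V" if "v \<in> V" "v' \<in> V" for v v' c
    using that by (simp add: V_def algebra_simps scaleC_mult_simps)
  have sc: "\<exists>c. u * w * f = c *\<^sub>C f" if "u \<in> U" for u w
  proof -
    have "f * u = u" using that by (simp add: U_def)
    then have "f * (u * w) * f = u * w * f" by (simp flip: mult.assoc)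
    then show ?thesis using f unfolding minimal_idempotent_def by metis
  qed
  have sc': "\<exists>c. u * v = c *\<^sub>C f" if "u \<in> U" "v \<in> V" for u v
    using sc[OF that(1), of v] that(2) by (simp add: V_def mult.assoc)
  have O: "u * h v * f = 0" if "u \<in> U" "v \<in> V" "u * v = 0" for u v
    by (rule orth) (use that in \<open>auto simp: U_def V_def\<close>)
  show ?thesis
  proof (cases "\<forall>u\<in>U. \<forall>v\<in>V. u * v = 0")
    case True
    show ?thesis
    proof (rule that[of 0])
      fix u v assume "f * u = u" "u * p = 0" "v * f = v" "p * v = 0"
      then have "u \<in> U" "v \<in> V" by (auto simp: U_def V_def)
      then show "u * h v * f = 0 *\<^sub>C (u * v)" using True O by simp
    qed
  next
    case False
    then obtain u0 v1 c0 where 0: "u0 \<in> U" "v1 \<in> V" "u0 * v1 = c0 *\<^sub>C f" "c0 \<noteq> 0"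
      using sc' by (metis cvs.scale_zero_left)
    define v0 where "v0 = 0 + inverse c0 *\<^sub>C v1"
    have "0 \<in> V" by (simp add: V_def)
    then have v0: "v0 \<in> V" unfolding v0_def by (rule Vcl) (rule 0)
    have uv0: "u0 * v0 = f" using 0 by (simp add: v0_def scaleC_mult_simps)
    \<comment> \<open>A normalised pair fixes the constant. Passing from \<open>u0\<close> to
      \<open>u\<close> divides by the coefficient of \<open>u0 * v\<close>; where that is 0,
      \<open>v\<close> is replaced by \<open>v\<close> plus \<open>v0\<close>.\<close>
    obtain k where k: "u0 * h v0 * f = k *\<^sub>C f" using sc[OF 0(1)] by blast
    have first: "u0 * h v * f = k *\<^sub>C (u0 * v)" if v: "v \<in> V" for v
    proof -
      obtain c where c: "u0 * v = c *\<^sub>C f" using sc'[OF 0(1) v] by blast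
      have "u0 * h (v + (- c) *\<^sub>C v0) * f = 0"
        by (intro O 0 Vcl v v0) (simp add: right_diff_distrib scaleC_mult_simps c uv0)
      then show ?thesis
        by (simp only: add scale c distrib_left distrib_right scaleC_mult_simps k)
          (simp add: add_eq_0_iff scaleC_mult_simps mult.commute)
    qed
    have direct: "u * h v * f = k *\<^sub>C (u * v)" if uv: "u \<in> U" "v \<in> V" "u0 * v = c *\<^sub>C f" "c \<noteq> 0" for u v c
    proof -
      obtain a where a: "u * v = a *\<^sub>C f" using sc' uv by blast
      have "(u + (- a / c) *\<^sub>C u0) * h v * f = 0"
        using uv by (intro O 0 Ucl uv) (simp add: left_diff_distrib scaleC_mult_simps a)
      then have "u * h v * f = (a / c) *\<^sub>C (u0 * h v * f)"
        by (simp add: left_diff_distrib scaleC_mult_simps)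
      then show ?thesis using first[OF uv(2)] uv a by (simp add: scaleC_mult_simps mult.commute)
    qed
    have "u * h v * f = k *\<^sub>C (u * v)" if uv: "u \<in> U" "v \<in> V" for u v
    proof -
      obtain c where c: "u0 * v = c *\<^sub>C f" using sc'[OF 0(1) uv(2)] by blast
      show ?thesis
      proof (cases "c = 0")
        case True
        have 2: "v + 1 *\<^sub>C v0 \<in> V" by (intro Vcl uv v0)
        have "u * h (v + 1 *\<^sub>C v0) * f = k *\<^sub>C (u * (v + 1 *\<^sub>C v0))"
          using c True uv0 by (intro direct[OF uv(1) 2, of 1]) (simp_all add: distrib_left scaleC_one)
        moreover have "u * h v0 * f = k *\<^sub>C (u * v0)"
          using uv0 by (intro direct[OF uv(1) v0, of 1]) (simp_all add: scaleC_one)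
        ultimately show ?thesis by (simp add: add scaleC_one algebra_simps scaleC_add_right)
      qed (use direct uv c in blast)
    qed
    then show ?thesis by (intro that[of k]) (auto simp: U_def V_def)
  qed
qed

lemma soc_annihilator_mult_soc:
  assumes "s \<in> soc" "x \<in> soc_annihilator"
  shows "x * s = 0"
  using assms
proof (induction rule: ideal_generated.induct)
  case (step f s b c)
  have "x * (b * f * c + s) = (x * b * f) * c + x * s" by (simp add: distrib_left mult.assoc)
  then show ?case using step by (auto simp: soc_annihilator_def)
qed simp

section \<open>Scalar modulo finite rank\<close>

context finite_spectrum_derivation
begin

text \<open>Orthogonality gives \<open>x * v k = 0\<close>, which shifts the derivative from the
  series \<open>x\<close> to the vector \<open>v k\<close>. By duality the result is
  \<open>- t k\<close> times \<open>v k\<close>, and the weights are distinct.\<close>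

lemma no_infinite_biorthogonal_system:
  fixes f u v :: "nat \<Rightarrow> 'a"
  assumes f: "\<And>n. f n \<noteq> 0" and v: "\<And>n. v n * f n = v n" and orth: "\<And>i k. u i * v k = 0"
    and dual: "\<And>i k. u i * d (v k) * f k = (if i = k then f k else 0)"
  shows False
proof -
  obtain t where t: "inj t" "\<And>n. t n > 0" "summable (\<lambda>n. norm (t n *\<^sub>R (v n * u n)))"
    by (rule exists_summable_coefficients[of "\<lambda>n. v n * u n"]) blast
  define x where "x = (\<Sum>n. t n *\<^sub>R (v n * u n))"
  have s: "summable (\<lambda>n. t n *\<^sub>R (v n * u n))" using t(3) by (rule summable_norm_cancel)
  have "- complex_of_real (t k) \<in> spectrum (d x)" for k
  proof (rule eigenvalue_in_spectrum)
    have "x * v k = t k *\<^sub>R ((v k * u k) * v k)"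
      unfolding x_def using orth by (intro scaleC_of_real_suminf_eigen[OF s]) (simp add: mult.assoc)
    then have "x * v k = 0" using orth by (simp add: mult.assoc)
    then have "d x * v k + x * d (v k) = 0" using d_mult[of x "v k"] by simp
    then have "(d x * v k + x * d (v k)) * f k = 0" by simp
    then have "d x * v k = - (x * (d (v k) * f k))"
      using v[of k] by (simp add: distrib_right mult.assoc add_eq_0_iff)
    also have "x * (d (v k) * f k) = t k *\<^sub>R ((v k * u k) * (d (v k) * f k))"
      unfolding x_def using dual[of _ k]
      by (intro scaleC_of_real_suminf_eigen[OF s]) (simp add: mult.assoc)
    also have "\<dots> = t k *\<^sub>R v k" using dual[of k k] v[of k] by (simp add: mult.assoc)
    finally show "d x * v k = (- complex_of_real (t k)) *\<^sub>C v k" by (simp add: scaleC_of_real)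
    show "v k \<noteq> 0" using dual[of k k] f[of k] by auto
  qed
  then have "range (\<lambda>k. - complex_of_real (t k)) \<subseteq> spectrum (d x)" by blast
  moreover have "infinite (range (\<lambda>k. - complex_of_real (t k)))"
    using t(1) by (intro range_inj_infinite) (auto simp: inj_def)
  ultimately show False using finite_spectrum finite_subset by blast
qed

text \<open>Besides \<open>u\<close> and \<open>v\<close> the idempotent has to absorb
  \<open>d v * f\<close> and \<open>f * d u\<close>: a later pair with \<open>u' * q = 0\<close> and
  \<open>q * v' = 0\<close> is then biorthogonal to this one in both orders.\<close>

lemma extend_idempotent_for_derivation:
  assumes p: "p * p = p" "p \<in> soc" and f: "minimal_idempotent f" and uv: "f * u = u" "v * f = v"
  obtains q where "q * q = q" "q \<in> soc" "extends p q" "q * v = v" "q * (d v * f) = d v * f"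
    "u * q = u" "f * d u * q = f * d u"
proof -
  have ff: "f * f = f" using f by (simp add: minimal_idempotent_def)
  obtain q1 where q1: "q1 * q1 = q1" "q1 \<in> soc" "extends p q1" "q1 * v = v"
    by (rule extend_idempotent_left[OF semisimple p f uv(2)])
  obtain q2 where q2: "q2 * q2 = q2" "q2 \<in> soc" "extends q1 q2" "q2 * (d v * f) = d v * f"
    by (rule extend_idempotent_left[OF semisimple q1(1,2) f, of "d v * f"]) (simp_all add: mult.assoc ff)
  obtain q3 where q3: "q3 * q3 = q3" "q3 \<in> soc" "extends q2 q3" "u * q3 = u"
    by (rule extend_idempotent_right[OF semisimple q2(1,2) f uv(1)])
  obtain q4 where q4: "q4 * q4 = q4" "q4 \<in> soc" "extends q3 q4" "f * d u * q4 = f * d u"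
    by (rule extend_idempotent_right[OF semisimple q3(1,2) f, of "f * d u"])
      (simp_all add: ff flip: mult.assoc)
  have e: "extends q2 q4" "extends q1 q4" "extends p q4"
    using q1(3) q2(3) q3(3) q4(3) by (meson extends_trans)+
  show ?thesis
    by (rule that[OF q4(1,2) e(3) extends_fixes(1)[OF e(2) q1(4)] extends_fixes(1)[OF e(1) q2(4)]
          extends_fixes(2)[OF q4(3) q3(4)] q4(4)])
qed

text \<open>
  As long as the bilinear form \<open>u d(v) f\<close> is not a multiple of \<open>u v\<close> on the complement of \<open>p\<close>, the
  idempotent \<open>p\<close> can be enlarged to absorb a further pair of a biorthogonal system.
\<close>

lemma exists_scalar_complement:
  "\<exists>p. p * p = p \<and> p \<in> soc \<and> (\<forall>f u v. minimal_idempotent f \<longrightarrow> f * u = u \<longrightarrow> u * p = 0 \<longrightarrow>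
      v * f = v \<longrightarrow> p * v = 0 \<longrightarrow> u * v = 0 \<longrightarrow> u * d v * f = 0)"
proof (rule ccontr)
  assume no: "\<not> ?thesis"
  define I :: "'a set" where "I = {p. p * p = p \<and> p \<in> soc}"
  have "\<forall>p\<in>I. \<exists>f u v q. q \<in> I \<and> minimal_idempotent f \<and> f * u = u \<and> u * p = 0 \<and> v * f = v \<and>
      p * v = 0 \<and> u * v = 0 \<and> u * d v * f = f \<and> extends p q \<and> q * v = v \<and>
      q * (d v * f) = d v * f \<and> u * q = u \<and> f * d u * q = f * d u"
  proof
    fix p assume p: "p \<in> I"
    then obtain f u' v where f: "minimal_idempotent f" "f * u' = u'" "u' * p = 0" "v * f = v" "p * v = 0"
      "u' * v = 0" "u' * d v * f \<noteq> 0"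
      using no unfolding I_def by blast
    obtain c where c: "f * (u' * d v) * f = c *\<^sub>C f" using f(1) by (auto simp: minimal_idempotent_def)
    have c': "u' * d v * f = c *\<^sub>C f" using c f(2) by (simp flip: mult.assoc)
    then have "c \<noteq> 0" using f by auto
    define u where "u = inverse c *\<^sub>C u'"
    have u: "f * u = u" "u * p = 0" "u * v = 0" "u * d v * f = f"
      using f c' \<open>c \<noteq> 0\<close> by (simp_all add: u_def scaleC_mult_simps)
    obtain q where "q * q = q" "q \<in> soc" "extends p q" "q * v = v" "q * (d v * f) = d v * f"
      "u * q = u" "f * d u * q = f * d u"
      using extend_idempotent_for_derivation[OF _ _ f(1) u(1) f(4), of p] p by (auto simp: I_def)
    then show "\<exists>f u v q. q \<in> I \<and> minimal_idempotent f \<and> f * u = u \<and> u * p = 0 \<and> v * f = v \<and>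
      p * v = 0 \<and> u * v = 0 \<and> u * d v * f = f \<and> extends p q \<and> q * v = v \<and>
      q * (d v * f) = d v * f \<and> u * q = u \<and> f * d u * q = f * d u"
      using f u unfolding I_def by blast
  qed
  then obtain F U V N where *: "\<forall>p\<in>I. N p \<in> I \<and> minimal_idempotent (F p) \<and> F p * U p = U p \<and>
      U p * p = 0 \<and> V p * F p = V p \<and> p * V p = 0 \<and> U p * V p = 0 \<and> U p * d (V p) * F p = F p \<and>
      extends p (N p) \<and> N p * V p = V p \<and> N p * (d (V p) * F p) = d (V p) * F p \<and>
      U p * N p = U p \<and> F p * d (U p) * N p = F p * d (U p)"
    by metis
  define p where "p = (\<lambda>n. (N ^^ n) 0)"
  have pI: "p n \<in> I" for n
    by (induction n) (use * in \<open>auto simp: p_def I_def ideal_generated.zero\<close>)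
  have pS: "p (Suc n) = N (p n)" for n by (simp add: p_def)
  note props = *[rule_format, OF pI]
  have ext: "extends (p i) (p k)" if "i \<le> k" for i k
    using that
  proof (induction k rule: dec_induct)
    case base
    then show ?case using pI[of i] by (simp add: extends_def I_def)
  next
    case (step k)
    then show ?case using extends_trans[OF step.IH, of "p (Suc k)"] props[of k] by (simp add: pS)
  qed
  define f u v where "f = (\<lambda>n. F (p n))" and "u = (\<lambda>n. U (p n))" and "v = (\<lambda>n. V (p n))"
  have P: "f n \<noteq> 0" "f n * f n = f n" "f n * u n = u n" "u n * p n = 0" "v n * f n = v n" "p n * v n = 0" "u n * v n = 0"
    "u n * d (v n) * f n = f n" for n
    using props[of n] by (auto simp: f_def u_def v_def minimal_idempotent_def)
  have Q: "p k * v i = v i" "p k * (d (v i) * f i) = d (v i) * f i" "u i * p k = u i"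
    "f i * d (u i) * p k = f i * d (u i)" if "i < k" for i k
  proof -
    have e: "extends (p (Suc i)) (p k)" using that by (intro ext) simp
    show "p k * v i = v i" "p k * (d (v i) * f i) = d (v i) * f i" "u i * p k = u i"
      "f i * d (u i) * p k = f i * d (u i)"
      using props[of i] extends_fixes[OF e, unfolded pS] by (auto simp: f_def u_def v_def pS)
  qed
  have orth: "u i * v k = 0" for i k
  proof (cases i k rule: linorder_cases)
    case less
    then have "u i * v k = u i * p k * v k" using Q by simp
    also have "\<dots> = 0" using P(6)[of k] by (simp add: mult.assoc)
    finally show ?thesis .
  next
    case greater
    then have "u i * v k = u i * (p i * v k)" using Q by simp
    also have "\<dots> = 0" using P(4)[of i] by (simp flip: mult.assoc)
    finally show ?thesis .
  qed (simp add: P)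
  \<comment> \<open>For \<open>i < k\<close> the derivative of \<open>u i * v k = 0\<close> moves
    \<open>d\<close> to \<open>u i\<close>; \<open>p k\<close> absorbs \<open>f i * d (u i)\<close>
    and kills \<open>v k\<close>. For \<open>i > k\<close> it is \<open>d (v k) * f k\<close> that
    \<open>p i\<close> absorbs, and \<open>u i * p i = 0\<close>.\<close>
  have dual: "u i * d (v k) * f k = (if i = k then f k else 0)" for i k
  proof (cases i k rule: linorder_cases)
    case less
    have "d (u i) * v k + u i * d (v k) = 0" using orth[of i k] d_mult[of "u i" "v k"] by simp
    then have "f i * (d (u i) * v k + u i * d (v k)) = 0" by simp
    then have "f i * d (u i) * v k + u i * d (v k) = 0" using P(3)[of i] by (simp add: distrib_left flip: mult.assoc)
    moreover have "f i * d (u i) * v k = (f i * d (u i) * p k) * v k" using Q[OF less] by simp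
    then have "f i * d (u i) * v k = 0" using P(6)[of k] by (simp add: mult.assoc)
    ultimately show ?thesis using less by simp
  next
    case greater
    then have "u i * (d (v k) * f k) = u i * (p i * (d (v k) * f k))" using Q by simp
    also have "\<dots> = 0" using P(4)[of i] by (simp flip: mult.assoc)
    finally show ?thesis using greater by (simp add: mult.assoc)
  qed (simp add: P)
  show False by (rule no_infinite_biorthogonal_system[OF P(1) P(5) orth dual])
qed

text \<open>If the form of \<open>h\<close> is \<open>k\<close> times \<open>u * v\<close>, its
  values at \<open>u, b * v\<close> and at \<open>u * b, v\<close> agree, and the product rule
  leaves \<open>u * h b * v = 0\<close>. The statement is about an abstract \<open>h\<close> because
  it serves for \<open>d\<close> and for the combinations of \<open>g\<close> and \<open>d\<close>
  compared later.\<close>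

lemma derivation_scalar_form_eq_0:
  fixes h :: "'a \<Rightarrow> 'a"
  assumes f: "minimal_idempotent f" and p: "p * p = p"
    and add: "\<And>x y. h (x + y) = h x + h y" and scale: "\<And>c x. h (c *\<^sub>C x) = c *\<^sub>C h x"
    and mult: "\<And>x y. h (x * y) = h x * y + x * h y"
    and orth: "\<And>u v. f * u = u \<Longrightarrow> u * p = 0 \<Longrightarrow> v * f = v \<Longrightarrow> p * v = 0 \<Longrightarrow> u * v = 0 \<Longrightarrow> u * h v * f = 0"
    and b: "p * b = 0" "b * p = 0"
  shows "(1 - p) * h b * (1 - p) * a * f = 0"
proof -
  have ff: "f * f = f" using f by (simp add: minimal_idempotent_def)
  obtain k where k: "\<And>u v. f * u = u \<Longrightarrow> u * p = 0 \<Longrightarrow> v * f = v \<Longrightarrow> p * v = 0 \<Longrightarrow> u * h v * f = k *\<^sub>C (u * v)"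
  proof (rule scalar_form[OF f, where h = h and p = p])
    show "h (x + y) = h x + h y" "h (c *\<^sub>C x) = c *\<^sub>C h x" for x y c by (rule add scale)+
    show "u * h v * f = 0" if "f * u = u" "u * p = 0" "v * f = v" "p * v = 0" "u * v = 0" for u v
      by (rule orth[OF that])
  qed (rule that)
  define z where "z = (1 - p) * h b * (1 - p) * a * f"
  have zz: "f * c * z = 0" for c
  proof -
    define u where "u = f * c * (1 - p)"
    define v where "v = (1 - p) * a * f"
    have p1: "(1 - p) * p = 0" "p * (1 - p) = 0" using p by (simp_all add: algebra_simps)
    have "f * u = (f * f) * c * (1 - p)" "u * p = f * c * ((1 - p) * p)" by (simp_all only: u_def mult.assoc)
    then have u: "f * u = u" "u * p = 0" by (simp_all only: ff p1 u_def mult_zero_right)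
    have "v * f = (1 - p) * a * (f * f)" "p * v = (p * (1 - p)) * a * f" by (simp_all only: v_def mult.assoc)
    then have v: "v * f = v" "p * v = 0" by (simp_all only: ff p1 v_def mult_zero_left)
    have "b * v * f = b * v" "p * (b * v) = 0" by (simp_all add: mult.assoc v(1)) (simp add: b flip: mult.assoc)
    then have 1: "u * h (b * v) * f = k *\<^sub>C (u * (b * v))" by (rule k[OF u])
    have "f * (u * b) = u * b" "u * b * p = 0" by (simp_all add: mult.assoc b(2)) (simp add: u flip: mult.assoc)
    then have 2: "(u * b) * h v * f = k *\<^sub>C (u * b * v)" by (rule k[OF _ _ v])
    have "u * h (b * v) * f = u * h b * (v * f) + (u * b) * h v * f"
      unfolding mult[of b v] by (simp only: distrib_left distrib_right mult.assoc)
    then have "u * h b * v = 0" using 1 2 by (simp add: v(1) mult.assoc)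
    then show ?thesis by (simp add: u_def v_def z_def mult.assoc)
  qed
  have zf: "z * f = z" using ff by (simp add: z_def mult.assoc)
  have "z * c * z = z * (f * c * z)" for c
    using arg_cong[OF zf, of "\<lambda>y. y * (c * z)"] by (simp add: mult.assoc)
  then have "z * c * z = 0" for c using zz by simp
  then have "z = 0" by (rule semiprime[OF semisimple])
  then show ?thesis by (simp add: z_def)
qed

text \<open>As \<open>d\<close> preserves the socle, \<open>x\<close> may be replaced by its part
  \<open>b\<close> in the complement of \<open>p\<close>. The corner \<open>z\<close> of
  \<open>d b\<close> off \<open>p\<close> lies in the annihilator of the socle, and
  \<open>d b\<close> kills that annihilator, so \<open>z * c * z = 0\<close>.\<close>

lemma d_in_soc: "d x \<in> soc"
proof -
  obtain p where p: "p * p = p" "p \<in> soc"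
    and orth: "\<And>f u v. minimal_idempotent f \<Longrightarrow> f * u = u \<Longrightarrow> u * p = 0 \<Longrightarrow> v * f = v \<Longrightarrow> p * v = 0 \<Longrightarrow>
      u * v = 0 \<Longrightarrow> u * d v * f = 0"
    using exists_scalar_complement by blast
  have psoc: "p * y \<in> soc" "y * p \<in> soc" "p * y * y' \<in> soc" for y y'
    using p(2) by (auto intro: ideal_generated_mult_left ideal_generated_mult_right)
  define b where "b = (1 - p) * x * (1 - p)"
  have b: "p * b = 0" "b * p = 0"
    using p by (simp_all add: b_def mult.assoc left_diff_distrib) (simp add: right_diff_distrib flip: mult.assoc)
  define z where "z = (1 - p) * d b * (1 - p)"
  have zA: "z \<in> soc_annihilator"
    unfolding soc_annihilator_def
  proof (intro CollectI allI impI)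
    fix f a :: 'a assume f: "minimal_idempotent f"
    show "z * a * f = 0" unfolding z_def
      using derivation_scalar_form_eq_0[OF f p(1) d_add d_scaleC d_mult orth[OF f] b] .
  qed
  have "z = 0"
  proof (rule semiprime[OF semisimple])
    fix c
    have "(1 - p) * (c * z) \<in> soc_annihilator" using zA by (intro soc_annihilator_mult)
    then have "d b * ((1 - p) * (c * z)) = 0" by (rule d_mult_soc_annihilator_eq_0)
    then show "z * c * z = 0" unfolding z_def mult.assoc by (simp only: mult_zero_right)
  qed
  then have "d b = p * d b + d b * p - p * d b * p" by (simp add: z_def algebra_simps)
  moreover have "p * d b + d b * p - p * d b * p \<in> soc"
    by (intro ideal_generated_add ideal_generated_diff psoc)
  ultimately have "d b \<in> soc" by simp
  moreover have "x = b + (x * p + p * x * (1 - p))" by (simp add: b_def algebra_simps)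
  then have "d x = d b + d (x * p + p * x * (1 - p))" by (metis d_add)
  moreover have "d (x * p + p * x * (1 - p)) \<in> soc"
    by (intro d_ideal_generated ideal_generated_add psoc) (auto simp: minimal_idempotent_def)
  ultimately show ?thesis by (simp add: ideal_generated_closed)
qed

end

section \<open>Comparing two derivations on a minimal ideal\<close>

text \<open>\<open>T = a * u + v * b\<close> acts on \<open>a\<close> and \<open>v\<close> by a
  triangular matrix with diagonal \<open>c, - c\<close>, which yields
  \<open>T * (T * T) = (c ^ 2) *\<^sub>C T\<close>.\<close>

lemma (in finite_spectrum_derivation) spectrum_square_zero:
  assumes f: "minimal_idempotent f" and uv: "f * u = u" "v * f = v" "u * v = 0"
    and c: "u * d v * f = c *\<^sub>C f"
  shows "d (v * u) * v = (- c) *\<^sub>C v"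
    and "k \<in> spectrum (d (v * u)) \<Longrightarrow> k ^ 3 = c ^ 2 * k"
proof -
  have ff: "f * f = f" using f by (simp add: minimal_idempotent_def)
  define a where "a = d v * f"
  define b where "b = f * d u"
  define T where "T = d (v * u)"
  have af: "a * f = a" by (simp add: a_def mult.assoc ff)
  have ua: "u * a = c *\<^sub>C f" using c by (simp add: a_def mult.assoc)
  obtain r where "f * (d u * d v) * f = r *\<^sub>C f" using f by (auto simp: minimal_idempotent_def)
  then have ba: "b * a = r *\<^sub>C f" by (simp add: a_def b_def mult.assoc)
  have "d u * v + u * d v = 0" using uv(3) d_mult[of u v] by simp
  then have "d u * v = - (u * d v)" by (simp add: add_eq_0_iff)
  then have "f * (d u * v) * f = - (f * (u * d v) * f)" by simp
  moreover have "f * (d u * v) * f = b * v" using uv(2) by (simp add: b_def mult.assoc)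
  moreover have "f * (u * d v) * f = u * d v * f" using uv(1) by (simp flip: mult.assoc)
  ultimately have bv: "b * v = (- c) *\<^sub>C f" using c by simp
  have "d v * u = a * u" using uv(1) by (simp add: a_def mult.assoc)
  moreover have "v * d u = v * b" using uv(2) by (simp add: b_def flip: mult.assoc)
  ultimately have T: "T = a * u + v * b" by (simp add: T_def d_mult)
  have Ta: "T * a = c *\<^sub>C a + r *\<^sub>C v"
    by (simp add: T distrib_right mult.assoc ua ba mult_scaleC_right af uv)
  have Tv: "T * v = (- c) *\<^sub>C v"
    by (simp add: T distrib_right mult.assoc uv bv mult_scaleC_right)
  then show "d (v * u) * v = (- c) *\<^sub>C v" by (simp add: T_def)
  have Tx: "T * (a * x) = c *\<^sub>C (a * x) + r *\<^sub>C (v * x)" "T * (v * x) = (- c) *\<^sub>C (v * x)" for x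
    by (simp_all only: mult.assoc[symmetric] Ta Tv distrib_right mult_scaleC_left)
  have TT: "T * T = c *\<^sub>C (a * u) + r *\<^sub>C (v * u) + (- c) *\<^sub>C (v * b)"
  proof -
    have "T * T = T * (a * u) + T * (v * b)" by (subst (2) T) (simp add: distrib_left)
    then show ?thesis by (simp only: Tx)
  qed
  have TTT: "T * (T * T) = (c ^ 2) *\<^sub>C T"
    unfolding TT
    by (simp only: distrib_left mult_scaleC_right Tx scaleC_add_right scaleC_scaleC)
      (simp add: T scaleC_add_right power2_eq_square mult.commute)
  show "k ^ 3 = c ^ 2 * k" if k: "k \<in> spectrum (d (v * u))" for k
  proof (rule ccontr)
    assume ne: "k ^ 3 \<noteq> c ^ 2 * k"
    define s where "s = c ^ 2 * k - k ^ 3"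
    \<comment> \<open>The quotient of X^3 - c^2 X + s by X - k, taken at \<open>T\<close>; the
      constant \<open>s\<close> is what makes \<open>k\<close> a root.\<close>
    define S where "S = T * T + k *\<^sub>C T + (k ^ 2 - c ^ 2) *\<^sub>C 1"
    have "(T - k *\<^sub>C 1) * S = T * (T * T) - (c ^ 2) *\<^sub>C T + s *\<^sub>C 1"
      by (simp add: S_def s_def algebra_simps scaleC_mult_simps scaleC_add_right cvs.scale_left_diff_distrib
          cvs.scale_right_diff_distrib power2_eq_square power3_eq_cube)
    then have 1: "(T - k *\<^sub>C 1) * S = s *\<^sub>C 1" using TTT by simp
    have "S * (T - k *\<^sub>C 1) = T * (T * T) - (c ^ 2) *\<^sub>C T + s *\<^sub>C 1"
      by (simp add: S_def s_def algebra_simps scaleC_mult_simps scaleC_add_right cvs.scale_left_diff_distrib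
          cvs.scale_right_diff_distrib power2_eq_square power3_eq_cube)
    then have 2: "S * (T - k *\<^sub>C 1) = s *\<^sub>C 1" using TTT by simp
    have "s \<noteq> 0" using ne by (simp add: s_def)
    then have "bi_invertible (T - k *\<^sub>C 1)"
      using 1 2 by (intro bi_invertibleI[of "inverse s *\<^sub>C S" _ "inverse s *\<^sub>C S"]) (simp_all add: scaleC_mult_simps)
    then show False using k by (simp add: spectrum_iff T_def)
  qed
qed

text \<open>An algebraic stand-in for open dense cones: along a line through a point of
  \<open>S\<close> only finitely many parameters leave \<open>S\<close>.\<close>

definition generic_in :: "'a::complex_banach_algebra_1 set \<Rightarrow> 'a set \<Rightarrow> bool" where
  "generic_in V S \<longleftrightarrow> S \<subseteq> V \<and> (\<forall>x\<in>S. \<forall>c. c \<noteq> 0 \<longrightarrow> c *\<^sub>C x \<in> S) \<and>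
     (\<forall>x\<in>S. \<forall>y\<in>V. finite {t. x + t *\<^sub>C y \<notin> S})"

text \<open>For \<open>x \<in> S\<close> and \<open>y \<in> T\<close> the point x + t y = t (y +
  x/t) is on a line through \<open>x\<close> and, up to scaling, on a line through \<open>y\<close>;
  all but finitely many \<open>t\<close> serve both sets.\<close>

lemma generic_in_Int:
  assumes S: "generic_in V S" "S \<noteq> {}" and T: "generic_in V T" "T \<noteq> {}"
  shows "generic_in V (S \<inter> T)" "S \<inter> T \<noteq> {}"
proof -
  have "finite {t. x + t *\<^sub>C y \<notin> S \<inter> T}" if "x \<in> S \<inter> T" "y \<in> V" for x y
  proof -
    have "{t. x + t *\<^sub>C y \<notin> S \<inter> T} = {t. x + t *\<^sub>C y \<notin> S} \<union> {t. x + t *\<^sub>C y \<notin> T}" by blast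
    then show ?thesis using S T that by (simp add: generic_in_def)
  qed
  then show "generic_in V (S \<inter> T)" using S T by (auto simp: generic_in_def)
  obtain x y where xy: "x \<in> S" "y \<in> T" using S T by blast
  define A where "A = {t. x + t *\<^sub>C y \<notin> S}"
  define B where "B = {t. y + t *\<^sub>C x \<notin> T}"
  have "finite A" "finite B" using S T xy unfolding A_def B_def generic_in_def by blast+
  then have "finite ({0} \<union> A \<union> inverse ` B)" by simp
  then obtain t where t: "t \<notin> {0} \<union> A \<union> inverse ` B" using infinite_UNIV_char_0 ex_new_if_finite by metis
  then have "inverse t \<notin> B" by (metis UnI2 imageI inverse_inverse_eq)
  then have "t *\<^sub>C (y + inverse t *\<^sub>C x) \<in> T" using t T by (simp add: B_def generic_in_def)
  then have "x + t *\<^sub>C y \<in> T" using t by (simp add: scaleC_add_right scaleC_mult_simps add.commute)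
  moreover have "x + t *\<^sub>C y \<in> S" using t by (simp add: A_def)
  ultimately show "S \<inter> T \<noteq> {}" by blast
qed

lemma generic_in_functional:
  fixes f m :: "'a::complex_banach_algebra_1"
  assumes f: "minimal_idempotent f" and V: "\<And>x y t. x \<in> V \<Longrightarrow> y \<in> V \<Longrightarrow> x + t *\<^sub>C y \<in> V"
    "\<And>x. x \<in> V \<Longrightarrow> f * x = x" "0 \<in> V"
  shows "generic_in V {u \<in> V. u * m * f \<noteq> 0}"
proof -
  have "finite {t. (x + t *\<^sub>C y) * m * f = 0}" if x: "x \<in> V" "x * m * f \<noteq> 0" and y: "y \<in> V" for x y
  proof -
    have sc: "\<exists>c. u * m * f = c *\<^sub>C f" if "u \<in> V" for u
      using f V(2)[OF that] unfolding minimal_idempotent_def by (metis mult.assoc)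
    obtain a b where ab: "x * m * f = a *\<^sub>C f" "y * m * f = b *\<^sub>C f" using sc x(1) y by blast
    have "(x + t *\<^sub>C y) * m * f = (a + t * b) *\<^sub>C f" for t
      by (simp add: distrib_right mult_scaleC_left ab scaleC_add_left scaleC_scaleC)
    then have "{t. (x + t *\<^sub>C y) * m * f = 0} = {t. poly [:a, b:] t = 0}"
      using f by (simp add: minimal_idempotent_def)
    moreover have "[:a, b:] \<noteq> 0" using x(2) ab by auto
    ultimately show ?thesis using poly_roots_finite by metis
  qed
  moreover have "{t. x + t *\<^sub>C y \<notin> {u \<in> V. u * m * f \<noteq> 0}} = {t. (x + t *\<^sub>C y) * m * f = 0}"
    if "x \<in> V" "y \<in> V" for x y using V(1) that by auto
  moreover have "c *\<^sub>C x \<in> V" if "x \<in> V" for x c using V(1)[OF V(3) that, of c] by simp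
  ultimately show ?thesis by (auto simp: generic_in_def mult_scaleC_left)
qed

text \<open>Moving \<open>v\<close> along a line destroys \<open>u * v = 0\<close>, so
  \<open>u\<close> must move as well. Correcting it by a \<open>w\<close> with
  \<open>w * x = f\<close> makes the form a polynomial of degree at most 2 in the parameter, whose
  constant term is the nonzero value at the start.\<close>

lemma generic_in_nonscalar:
  fixes f :: "'a::complex_banach_algebra_1" and h :: "'a \<Rightarrow> 'a"
  assumes ss: "semisimple TYPE('a)" and f: "minimal_idempotent f"
    and add: "\<And>x y. h (x + y) = h x + h y" and scale: "\<And>c x. h (c *\<^sub>C x) = c *\<^sub>C h x"
  shows "generic_in {v. v * f = v} {v. v * f = v \<and> (\<exists>u. f * u = u \<and> u * v = 0 \<and> u * h v * f \<noteq> 0)}"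
proof -
  define S where "S = {v. v * f = v \<and> (\<exists>u. f * u = u \<and> u * v = 0 \<and> u * h v * f \<noteq> 0)}"
  have ff: "f * f = f" "f \<noteq> 0" using f by (simp_all add: minimal_idempotent_def)
  have sc: "\<exists>c. u * w * f = c *\<^sub>C f" if "f * u = u" for u w
    using f that unfolding minimal_idempotent_def by (metis mult.assoc)
  have "finite {t. x + t *\<^sub>C y \<notin> S}" if x: "x \<in> S" and y: "y * f = y" for x y
  proof -
    obtain u where u: "f * u = u" "u * x = 0" "u * h x * f \<noteq> 0" and xf: "x * f = x" using x by (auto simp: S_def)
    have "h 0 = 0" using add[of 0 0] by simp
    then have "x \<noteq> 0" using u by auto
    then obtain b where b: "f * b * x = f" using minimal_idempotent_separates_left[OF ss f xf] by blast
    define w where "w = f * b"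
    have w: "f * w = w" "w * x = f" using b ff by (simp_all add: w_def flip: mult.assoc)
    obtain \<alpha> where \<alpha>: "w * y = \<alpha> *\<^sub>C f" using sc[OF w(1), of y] y by (auto simp: mult.assoc)
    obtain \<beta> where \<beta>: "u * y = \<beta> *\<^sub>C f" using sc[OF u(1), of y] y by (auto simp: mult.assoc)
    obtain c where c: "u * h x * f = c *\<^sub>C f" using sc[OF u(1)] by blast
    obtain e where e: "u * h y * f = e *\<^sub>C f" using sc[OF u(1)] by blast
    obtain c' where c': "w * h x * f = c' *\<^sub>C f" using sc[OF w(1)] by blast
    obtain e' where e': "w * h y * f = e' *\<^sub>C f" using sc[OF w(1)] by blast
    define P where "P = [:c, e + \<alpha> * c - \<beta> * c', \<alpha> * e - \<beta> * e':]"
    have "x + t *\<^sub>C y \<in> S" if t: "poly P t \<noteq> 0" for t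
    proof -
      define z where "z = x + t *\<^sub>C y"
      define u' where "u' = (1 + \<alpha> * t) *\<^sub>C u - (\<beta> * t) *\<^sub>C w"
      have uz: "u * z = (\<beta> * t) *\<^sub>C f" using u \<beta> by (simp add: z_def distrib_left scaleC_mult_simps mult.commute)
      have wz: "w * z = (1 + \<alpha> * t) *\<^sub>C f"
        using w \<alpha> by (simp add: z_def distrib_left scaleC_mult_simps mult.commute scaleC_add_left)
      have "u' * z = 0" using uz wz by (simp add: u'_def left_diff_distrib scaleC_mult_simps mult.commute)
      moreover have "f * u' = u'" using u w by (simp add: u'_def right_diff_distrib mult_scaleC_right)
      moreover have "z * f = z" using xf y by (simp add: z_def distrib_right mult_scaleC_left)
      moreover have "u' * h z * f = poly P t *\<^sub>C f"
      proof -
        have uh: "u * h z * f = (c + t * e) *\<^sub>C f" and wh: "w * h z * f = (c' + t * e') *\<^sub>C f"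
          by (simp_all add: z_def add scale distrib_left distrib_right scaleC_mult_simps c e c' e' scaleC_add_left)
        have "u' * h z * f = (1 + \<alpha> * t) *\<^sub>C (u * h z * f) - (\<beta> * t) *\<^sub>C (w * h z * f)"
          by (simp add: u'_def left_diff_distrib mult_scaleC_left)
        also have "\<dots> = ((1 + \<alpha> * t) * (c + t * e) - (\<beta> * t) * (c' + t * e')) *\<^sub>C f"
          by (simp only: uh wh scaleC_scaleC cvs.scale_left_diff_distrib)
        also have "(1 + \<alpha> * t) * (c + t * e) - (\<beta> * t) * (c' + t * e') = poly P t"
          by (simp add: P_def algebra_simps)
        finally show ?thesis .
      qed
      ultimately show ?thesis using t ff unfolding z_def[symmetric] by (auto simp: S_def)
    qed
    then have "{t. x + t *\<^sub>C y \<notin> S} \<subseteq> {t. poly P t = 0}" by blast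
    moreover have "P \<noteq> 0" using u(3) c by (auto simp: P_def)
    ultimately show ?thesis using poly_roots_finite finite_subset by metis
  qed
  moreover have "c *\<^sub>C x \<in> S" if "x \<in> S" "c \<noteq> 0" for x c
    using that by (auto simp: S_def mult_scaleC_left mult_scaleC_right scale)
  ultimately show ?thesis unfolding generic_in_def S_def[symmetric] by (auto simp: S_def)
qed

text \<open>If all three values of \<open>k\<close> failed, genericity would give one pair
  \<open>u, v\<close> with \<open>u * v = 0\<close> that violates them simultaneously. The
  eigenvalue of \<open>g (v * u)\<close> on \<open>v\<close> is then not a possible spectral value
  of \<open>d (v * u)\<close>.\<close>

lemma derivations_proportional_on_minimal_ideal:
  fixes d g :: "'a::complex_banach_algebra_1 \<Rightarrow> 'a"
  assumes d: "finite_spectrum_derivation d" and g: "finite_spectrum_derivation g"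
    and sub: "\<And>x. spectrum (g x) \<subseteq> spectrum (d x)" and f: "minimal_idempotent f"
  shows "\<exists>k\<in>{0, 1, -1}. \<forall>x a. (g x - k *\<^sub>C d x) * a * f = 0"
proof -
  interpret d: finite_spectrum_derivation d by (rule d)
  interpret g: finite_spectrum_derivation g by (rule g)
  have ff: "f * f = f" "f \<noteq> 0" using f by (simp_all add: minimal_idempotent_def)
  define h where "h = (\<lambda>k x. g x - k *\<^sub>C d x)"
  have add: "h k (x + y) = h k x + h k y" for k x y
    by (simp add: h_def g.d_add d.d_add scaleC_add_right)
  have scale: "h k (c *\<^sub>C x) = c *\<^sub>C h k x" for k c x
    by (simp add: h_def g.d_scaleC d.d_scaleC cvs.scale_right_diff_distrib scaleC_scaleC mult.commute)
  have mult: "h k (x * y) = h k x * y + x * h k y" for k x y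
    by (simp add: h_def g.d_mult d.d_mult algebra_simps scaleC_mult_simps scaleC_add_right)
  define S where "S = (\<lambda>k. {v. v * f = v \<and> (\<exists>u. f * u = u \<and> u * v = 0 \<and> u * h k v * f \<noteq> 0)})"
  have gS: "generic_in {v. v * f = v} (S k)" for k
    unfolding S_def by (rule generic_in_nonscalar[OF d.semisimple f add scale])
  have "\<exists>k\<in>{0, 1, -1}. S k = {}"
  proof (rule ccontr)
    assume "\<not> ?thesis"
    then have ne: "S 0 \<noteq> {}" "S 1 \<noteq> {}" "S (-1) \<noteq> {}" by auto
    have "S 0 \<inter> S 1 \<inter> S (-1) \<noteq> {}"
      by (rule generic_in_Int[OF generic_in_Int[OF gS ne(1) gS ne(2)] gS ne(3)])
    then obtain v where v: "v \<in> S 0" "v \<in> S 1" "v \<in> S (-1)" by blast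
    define W where "W = {u. f * u = u \<and> u * v = 0}"
    define R where "R = (\<lambda>k. {u \<in> W. u * h k v * f \<noteq> 0})"
    have gR: "generic_in W (R k)" for k
      unfolding R_def
      by (rule generic_in_functional[OF f])
        (auto simp: W_def distrib_left distrib_right mult_scaleC_left mult_scaleC_right)
    have ne': "R 0 \<noteq> {}" "R 1 \<noteq> {}" "R (-1) \<noteq> {}" using v by (auto simp: R_def W_def S_def)
    have "R 0 \<inter> R 1 \<inter> R (-1) \<noteq> {}"
      by (rule generic_in_Int[OF generic_in_Int[OF gR ne'(1) gR ne'(2)] gR ne'(3)])
    then obtain u where u: "u \<in> R 0" "u \<in> R 1" "u \<in> R (-1)" by blast
    have uv: "f * u = u" "v * f = v" "u * v = 0" using u(1) v(1) by (auto simp: R_def W_def S_def)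
    have sc: "\<exists>c. u * w * f = c *\<^sub>C f" for w
      using f uv(1) unfolding minimal_idempotent_def by (metis mult.assoc)
    obtain c where c: "u * d v * f = c *\<^sub>C f" using sc by blast
    obtain k where k: "u * g v * f = k *\<^sub>C f" using sc by blast
    have "u * h t v * f = (k - t * c) *\<^sub>C f" for t
      using c k by (simp add: h_def right_diff_distrib left_diff_distrib scaleC_mult_simps cvs.scale_left_diff_distrib)
    then have nz: "k \<noteq> 0" "k \<noteq> c" "k \<noteq> - c" using u by (auto simp: R_def)
    have "v \<noteq> 0" using k nz(1) ff g.d_0 by auto
    then have "- k \<in> spectrum (g (v * u))"
      by (intro eigenvalue_in_spectrum[OF g.spectrum_square_zero(1)[OF f uv k]])
    then have "- k \<in> spectrum (d (v * u))" using sub by blast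
    then have "(- k) ^ 3 = c ^ 2 * (- k)" by (rule d.spectrum_square_zero(2)[OF f uv c])
    then have "k * ((k - c) * (k + c)) = 0" by (simp add: algebra_simps power2_eq_square power3_eq_cube)
    then show False using nz by (auto simp: add_eq_0_iff)
  qed
  then obtain k where k: "k \<in> {0, 1, -1}" "S k = {}" by blast
  \<comment> \<open>With \<open>p = 0\<close> the complement is everything, and emptiness of
    \<open>S k\<close> says that the form of \<open>h k\<close> vanishes on all pairs with
    \<open>u * v = 0\<close>.\<close>
  have "(1 - 0) * h k x * (1 - 0) * a * f = 0" for x a
    by (rule d.derivation_scalar_form_eq_0[OF f, where p = 0, OF _ add scale mult])
      (use k(2) in \<open>auto simp: S_def\<close>)
  then show ?thesis using k(1) unfolding h_def by auto
qed

section \<open>Splitting the socle\<close>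

lemma ideal_generated_product_eq_0:
  assumes FG: "\<And>f g b. f \<in> F \<Longrightarrow> g \<in> G \<Longrightarrow> f * b * g = 0"
    and x: "x \<in> ideal_generated F" and y: "y \<in> ideal_generated G"
  shows "x * b * y = 0"
proof -
  have 1: "f * b * y = 0" if f: "f \<in> F" for f b
    using y
  proof (induction rule: ideal_generated.induct)
    case (step g y a c)
    have "f * b * (a * g * c + y) = f * (b * a) * g * c + f * b * y" by (simp add: distrib_left mult.assoc)
    then show ?case using step FG[OF f] by simp
  qed simp
  show ?thesis using x
  proof (induction rule: ideal_generated.induct)
    case (step f x a c)
    have "(a * f * c + x) * b * y = a * (f * (c * b) * y) + x * b * y" by (simp add: distrib_right mult.assoc)
    then show ?case using step 1 by simp
  qed simp
qed

text \<open>Two minimal idempotents with \<open>f b f' \<noteq> 0\<close> generate the same minimal ideal.\<close>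

lemma linked_idempotents_killed_iff:
  fixes f f' :: "'a::complex_banach_algebra_1"
  assumes ss: "semisimple TYPE('a)" and f: "minimal_idempotent f" "minimal_idempotent f'"
    and link: "f * b * f' \<noteq> 0"
  shows "(\<forall>x a. h x * a * f = 0) \<longleftrightarrow> (\<forall>x a. h x * a * f' = 0)"
proof -
  have ff: "f * f = f" "f' * f' = f'" using f by (simp_all add: minimal_idempotent_def)
  have m: "f * (f * b * f') = f * b * f'" "(f * b * f') * f' = f * b * f'"
    using ff by (simp_all add: mult.assoc) (simp flip: mult.assoc)
  obtain p where p: "f' * p * (f * b * f') = f'"
    using minimal_idempotent_separates_left[OF ss f(2) m(2) link] by blast
  obtain q where q: "(f * b * f') * q * f = f"
    using minimal_idempotent_separates_right[OF ss f(1) m(1) link] by blast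
  have "h x * a * f' = (h x * (a * f' * p) * f) * b * f'" for x a
    using arg_cong[OF p, of "\<lambda>y. h x * a * y"] by (simp add: mult.assoc)
  moreover have "h x * a * f = (h x * (a * f * b) * f') * q * f" for x a
    using arg_cong[OF q, of "\<lambda>y. h x * a * y"] by (simp add: mult.assoc)
  ultimately show ?thesis by (metis mult_zero_left)
qed

theorem theorem3p4:
  fixes d g :: "'a::complex_banach_algebra_1 \<Rightarrow> 'a"
  assumes "semisimple TYPE('a)"
    and "derivation d" and "derivation g"
    and "\<And>x. finite (spectrum (d x))"
    and "\<And>x. spectrum (g x) \<subseteq> spectrum (d x)"
  shows "\<exists>D :: nat \<Rightarrow> 'a \<Rightarrow> 'a.
           (\<forall>i\<in>{0, 1, 2}. derivation (D i)) \<and>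
           (\<forall>x. d x = D 0 x + D 1 x + D 2 x) \<and>
           (\<forall>x. g x = D 1 x - D 2 x) \<and>
           (\<forall>i\<in>{0, 1, 2}. \<forall>j\<in>{0, 1, 2}. i \<noteq> j \<longrightarrow> (\<forall>x y z. D i x * y * D j z = 0))"
proof -
  interpret d: finite_spectrum_derivation d
    by unfold_locales (use assms in auto)
  interpret g: finite_spectrum_derivation g
    by unfold_locales (use assms finite_subset[OF assms(5,4)] in auto)
  note ss = assms(1)
  define K where "K = (\<lambda>(h :: 'a \<Rightarrow> 'a) f. \<forall>x a. h x * a * f = 0)"
  define gd where "gd = (\<lambda>x. g x - d x)"
  define sd where "sd = (\<lambda>x. g x + d x)"
  \<comment> \<open>Where \<open>d\<close> vanishes, proportionality makes \<open>g\<close> vanish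
    too; such idempotents go to class 0, and excluding them from the other two keeps the classes
    disjoint.\<close>
  define F :: "nat \<Rightarrow> 'a set" where
    "F = (\<lambda>i. {f. minimal_idempotent f \<and> (if i = 0 then K g f else if i = 1 then K gd f \<and> \<not> K d f
      else K sd f \<and> \<not> K d f)})"
  define I where "I = (\<lambda>i. ideal_generated (F i))"
  have Kd: "K d f" if "K g f" "K gd f \<or> K sd f" for f
    using that by (auto simp: K_def gd_def sd_def left_diff_distrib distrib_right)
  have Kd': "K d f" if "K gd f" "K sd f" for f
    unfolding K_def
  proof (intro allI)
    fix x a
    have "g x * a * f = d x * a * f" "g x * a * f + d x * a * f = 0"
      using that by (simp_all add: K_def gd_def sd_def left_diff_distrib distrib_right)
    then have "2 *\<^sub>R (d x * a * f) = 0" by (simp add: scaleR_2)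
    then show "d x * a * f = 0" by simp
  qed
  have link: "K h f = K h f'" if "minimal_idempotent f" "minimal_idempotent f'" "f * b * f' \<noteq> 0" for h f f' b
    unfolding K_def by (rule linked_idempotents_killed_iff[OF ss that])
  have cross: "f * b * f' = 0" if ij: "i \<in> {0, 1, 2}" "j \<in> {0, 1, 2}" "i \<noteq> j" and f: "f \<in> F i" "f' \<in> F j"
    for i j f f' b
  proof (rule ccontr)
    assume "f * b * f' \<noteq> 0"
    then have "K h f = K h f'" for h using f by (intro link[of f f' b]) (auto simp: F_def)
    then show False using ij f Kd[of f] Kd'[of f] by (auto simp: F_def split: if_splits)
  qed
  have prod: "x * b * y = 0" if "i \<in> {0, 1, 2}" "j \<in> {0, 1, 2}" "i \<noteq> j" "x \<in> I i" "y \<in> I j" for i j x y b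
    using cross[OF that(1-3)] that(4,5) unfolding I_def by (rule ideal_generated_product_eq_0)
  have cover: "\<exists>i\<in>{0, 1, 2}. f \<in> F i" if f: "minimal_idempotent f" for f
  proof -
    obtain k where k: "k \<in> {0, 1, -1}" "\<And>x a. (g x - k *\<^sub>C d x) * a * f = 0"
      using derivations_proportional_on_minimal_ideal[OF d.finite_spectrum_derivation_axioms
          g.finite_spectrum_derivation_axioms assms(5) f] by blast
    show ?thesis
    proof (cases "K g f")
      case True
      then show ?thesis using f by (auto simp: F_def)
    next
      case False
      then have "k \<noteq> 0" "\<not> K d f"
        using k(2) by (auto simp: K_def left_diff_distrib mult_scaleC_left)
      moreover have "K gd f" if "k = 1" using k(2) that by (simp add: K_def gd_def scaleC_one)
      moreover have "K sd f" if "k = -1" using k(2) that by (simp add: K_def sd_def scaleC_one)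
      ultimately show ?thesis using f k(1) False by (auto simp: F_def)
    qed
  qed
  have Icl: "I i \<noteq> {}" "x \<in> I i \<Longrightarrow> y \<in> I i \<Longrightarrow> x + y \<in> I i" "x \<in> I i \<Longrightarrow> y \<in> I i \<Longrightarrow> x - y \<in> I i"
    "x \<in> I i \<Longrightarrow> a * x \<in> I i" "x \<in> I i \<Longrightarrow> x * a \<in> I i" "0 \<in> I i" for i x y a
    unfolding I_def by (auto intro: ideal_generated_closed)
  have split: "\<exists>C. (\<forall>i. C i \<in> I i) \<and> s = C 0 + C 1 + C 2" if "s \<in> soc" for s
    using that
  proof (induction rule: ideal_generated.induct)
    case zero
    show ?case by (rule exI[of _ "\<lambda>_. 0"]) (simp add: Icl)
  next
    case (step f s b c)
    obtain C where C: "\<And>i. C i \<in> I i" "s = C 0 + C 1 + C 2" using step by blast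
    obtain i where i: "i \<in> {0, 1, 2}" "f \<in> F i" using cover step by blast
    have "b * f * c \<in> I i" using i unfolding I_def by (intro ideal_generatedI)
    then have "\<forall>j. (C(i := b * f * c + C i)) j \<in> I j" using C Icl by auto
    moreover have "b * f * c + s = (C(i := b * f * c + C i)) 0 + (C(i := b * f * c + C i)) 1 + (C(i := b * f * c + C i)) 2"
      using i(1) C(2) by auto
    ultimately show ?case by blast
  qed
  \<comment> \<open>The difference \<open>E i\<close> is minus the sum of the other two differences,
    which it annihilates across any \<open>b\<close>; so \<open>E i * b * E i = 0\<close>.\<close>
  have indep: "C i = C' i"
    if C: "\<And>i. C i \<in> I i" "\<And>i. C' i \<in> I i" "C 0 + C 1 + C 2 = C' 0 + C' 1 + C' 2" and i: "i \<in> {0, 1, 2}"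
    for C C' i
  proof -
    define E where "E = (\<lambda>i. C i - C' i)"
    have E: "E i \<in> I i" for i using C Icl by (simp add: E_def)
    have sum: "E 0 + E 1 + E 2 = 0" using C(3) by (simp add: E_def algebra_simps)
    have "E i * b * E i = 0" for b
    proof -
      have 1: "E i * b * E 0 + E i * b * E 1 + E i * b * E 2 = 0"
        using arg_cong[OF sum, of "\<lambda>y. E i * b * y"] by (simp only: distrib_left mult_zero_right)
      have 2: "E i * b * E j = 0" if "j \<in> {0, 1, 2}" "i \<noteq> j" for j
        by (rule prod[OF i that E E])
      consider "i = 0" | "i = 1" | "i = 2" using i by auto
      then show ?thesis using 1 2[of 0] 2[of 1] 2[of 2] by cases simp_all
    qed
    then have "E i = 0" by (rule semiprime[OF ss])
    then show ?thesis by (simp add: E_def)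
  qed
  have "\<forall>x. \<exists>C. (\<forall>i. C i \<in> I i) \<and> d x = C 0 + C 1 + C 2" using split d.d_in_soc by blast
  then obtain C where C: "\<And>x i. C x i \<in> I i" "\<And>x. d x = C x 0 + C x 1 + C x 2" by metis
  \<comment> \<open>The components are picked by choice; their uniqueness in the ideals
    \<open>I i\<close> transfers linearity and the product rule from \<open>d\<close>.\<close>
  define D where "D = (\<lambda>i x. C x i)"
  have DI: "D i x \<in> I i" for i x using C by (simp add: D_def)
  have dD: "d x = D 0 x + D 1 x + D 2 x" for x using C by (simp add: D_def)
  have Dadd: "D i (x + y) = D i x + D i y" if "i \<in> {0, 1, 2}" for i x y
  proof (rule indep[of "\<lambda>i. D i (x + y)" "\<lambda>i. D i x + D i y", OF DI _ _ that])
    show "D i x + D i y \<in> I i" for i by (intro Icl DI)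
    show "D 0 (x + y) + D 1 (x + y) + D 2 (x + y) = D 0 x + D 0 y + (D 1 x + D 1 y) + (D 2 x + D 2 y)"
      using dD[of "x + y"] dD[of x] dD[of y] by (simp add: d.d_add algebra_simps)
  qed
  have Dscale: "D i (c *\<^sub>C x) = c *\<^sub>C D i x" if "i \<in> {0, 1, 2}" for i c x
  proof (rule indep[of "\<lambda>i. D i (c *\<^sub>C x)" "\<lambda>i. c *\<^sub>C D i x", OF DI _ _ that])
    show "c *\<^sub>C D i x \<in> I i" for i using Icl(4)[OF DI, where a = "c *\<^sub>C 1"] by (simp add: scaleC_mult_simps)
    show "D 0 (c *\<^sub>C x) + D 1 (c *\<^sub>C x) + D 2 (c *\<^sub>C x) = c *\<^sub>C D 0 x + c *\<^sub>C D 1 x + c *\<^sub>C D 2 x"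
      using dD[of "c *\<^sub>C x"] dD[of x] by (simp add: d.d_scaleC scaleC_add_right)
  qed
  have Dmult: "D i (x * y) = D i x * y + x * D i y" if "i \<in> {0, 1, 2}" for i x y
  proof (rule indep[of "\<lambda>i. D i (x * y)" "\<lambda>i. D i x * y + x * D i y", OF DI _ _ that])
    show "D i x * y + x * D i y \<in> I i" for i by (intro Icl(2) Icl(4)[OF DI] Icl(5)[OF DI])
    show "D 0 (x * y) + D 1 (x * y) + D 2 (x * y)
        = D 0 x * y + x * D 0 y + (D 1 x * y + x * D 1 y) + (D 2 x * y + x * D 2 y)"
      using dD[of "x * y"] dD[of x] dD[of y] by (simp add: d.d_mult algebra_simps)
  qed
  have Dder: "derivation (D i)" if i: "i \<in> {0, 1, 2}" for i
    unfolding derivation_def Vector_Spaces.linear_def module_hom_def module_hom_axioms_def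
    using Dadd[OF i] Dscale[OF i] Dmult[OF i] cvs.vector_space_axioms cvs.module_axioms by blast
  have gD: "g x = D 1 x - D 2 x" for x
  proof -
    \<comment> \<open>Checked class by class on minimal idempotents, \<open>w\<close> lies in the
      annihilator of the socle. It also lies in the socle, so \<open>w * b * w = 0\<close>.\<close>
    define w where "w = g x - (D 1 x - D 2 x)"
    have Fprod: "D j x * a * f = 0" if "i \<in> {0, 1, 2}" "j \<in> {0, 1, 2}" "j \<noteq> i" "f \<in> F i" for i j a f
      using prod[OF that(2,1,3) DI] ideal_generatedI[OF that(4), of 1 1] by (simp add: I_def)
    have wA: "w \<in> soc_annihilator"
      unfolding soc_annihilator_def
    proof (intro CollectI allI impI)
      fix f a :: 'a assume "minimal_idempotent f"
      then obtain i where i: "i \<in> {0, 1, 2}" "f \<in> F i" using cover by blast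
      have dx: "d x * a * f = D 0 x * a * f + D 1 x * a * f + D 2 x * a * f"
        by (simp add: dD[of x] distrib_right)
      have wx: "w * a * f = g x * a * f - D 1 x * a * f + D 2 x * a * f"
        by (simp add: w_def left_diff_distrib)
      consider "i = 0" | "i = 1" | "i = 2" using i by auto
      then show "w * a * f = 0"
      proof cases
        case 1
        then have "g x * a * f = 0" using i by (simp add: F_def K_def)
        then show ?thesis using wx Fprod[OF i(1) _ _ i(2), of 1] Fprod[OF i(1) _ _ i(2), of 2] 1 by simp
      next
        case 2
        then have "g x * a * f = d x * a * f" using i by (simp add: F_def K_def gd_def left_diff_distrib)
        then show ?thesis using wx dx Fprod[OF i(1) _ _ i(2), of 0] Fprod[OF i(1) _ _ i(2), of 2] 2 by simp
      next
        case 3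
        then have "g x * a * f + d x * a * f = 0" using i by (simp add: F_def K_def sd_def distrib_right)
        then show ?thesis using wx dx Fprod[OF i(1) _ _ i(2), of 0] Fprod[OF i(1) _ _ i(2), of 1] 3 by simp
      qed
    qed
    have Isoc: "I i \<subseteq> soc" for i
    proof
      fix s assume "s \<in> I i"
      then show "s \<in> soc" unfolding I_def
        by (induction rule: ideal_generated.induct) (auto simp: F_def intro: ideal_generated.intros)
    qed
    have "w \<in> soc" unfolding w_def by (intro ideal_generated_diff g.d_in_soc subsetD[OF Isoc DI])
    then have "w * (b * w) = 0" for b
      using wA by (intro soc_annihilator_mult_soc ideal_generated_mult_left)
    then have "w * b * w = 0" for b by (simp add: mult.assoc)
    then have "w = 0" by (rule semiprime[OF ss])
    then show ?thesis by (simp add: w_def)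
  qed
  show ?thesis
    by (intro exI[of _ D] conjI ballI allI impI; (rule Dder dD gD prod[OF _ _ _ DI DI]; assumption)?)
qed

end
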